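(* Let $S$ be a time-like surface in $\mathbb R^3_1$ with Gauss curvature $K>0$ and mean curvature $H$ satisfying $K-H^2>0$. Then locally $S$ admits canonical asymptotic parameters; that is, every point of $S$ has a neighbourhood in $S$ which can be parametrized by canonical asymptotic parameters about that point.
   Context: $\mathbb R^3_1$ is $\mathbb R^3$ with the scalar product $\langle x,y\rangle=x_1y_1+x_2y_2-x_3y_3$; write $x^2=\langle x,x\rangle$. A (smooth, regular) surface in $\mathbb R^3_1$ is time-like if its normal vector is space-like ($\langle\cdot,\cdot\rangle>0$) at every point (equivalently, the induced metric is Lorentzian). For a parametrization $z=z(u,v)$ let $E=z_u^2$, $F=\langle z_u,z_v\rangle$, $G=z_v^2$; let $n$ be the unit normal ($n^2=1$) such that $\{z_u,z_v,n\}$ is positively oriented; let $L=\langle n,z_{uu}\rangle$, $M=\langle n,z_{uv}\rangle$, $N=\langle n,z_{vv}\rangle$. The Gauss and mean curvatures are $K=\frac{LN-M^2}{EG-F^2}$ and $H=\frac{EN-2FM+GL}{2(EG-F^2)}$. The parameters $(u,v)$ are asymptotic if $L=N=0$. For time-like surfaces with $K-H^2>0$, asymptotic parameters are always taken (after interchanging $u$ and $v$ if necessary) so that $E>0$, $G<0$. In such parameters put $$ a=\frac{F}{\sqrt E\sqrt{-G}},\qquad \alpha=\frac{M}{\sqrt E\sqrt{-G}},\qquad f=\tfrac12\left(\log\sqrt{1+a^2}-\log|\alpha|\right)=-\log\sqrt[4]{K}. $$ Let $(u_0,v_0)$ be a point of the parameter domain (taken to be an open rectangle containing $(u_0,v_0)$).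 The functions $$ \varphi=\sqrt E\,\exp\left(-\int_{v_0}^v\left(f_v+af_u\frac{\sqrt{-G}}{\sqrt E}\right)(u,s)\,ds-\int_{u_0}^u\left(-af_v\frac{\sqrt E}{\sqrt{-G}}+f_u\right)(t,v_0)\,dt-f(u_0,v_0)\right), $$ $$ \psi=\sqrt{-G}\,\exp\left(-\int_{u_0}^u\left(-af_v\frac{\sqrt E}{\sqrt{-G}}+f_u\right)(t,v)\,dt-\int_{v_0}^v\left(f_v+af_u\frac{\sqrt{-G}}{\sqrt E}\right)(u_0,s)\,ds-f(u_0,v_0)\right) $$ do not depend on $v$ and on $u$, respectively, so $\varphi=\varphi(u)$ and $\psi=\psi(v)$. The asymptotic parameters $(u,v)$ are called canonical asymptotic parameters (about the point with coordinates $(u_0,v_0)$) if $\varphi\equiv1$ and $\psi\equiv1$. *)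

theory Defs
  imports "HOL-Analysis.Analysis"
begin

text \<open>Smoothness of class \<open>C\<^sup>\<infinity>\<close>, intended for open sets \<open>S\<close>.\<close>

primrec differentiable_times_on ::
  "nat \<Rightarrow> 'a::real_normed_vector set \<Rightarrow> ('a \<Rightarrow> 'b::real_normed_vector) \<Rightarrow> bool" where
  "differentiable_times_on 0 S g \<longleftrightarrow> continuous_on S g"
| "differentiable_times_on (Suc k) S g \<longleftrightarrow>
     (\<forall>x\<in>S. g differentiable (at x)) \<and>
     (\<forall>d. differentiable_times_on k S (\<lambda>x. frechet_derivative g (at x) d))"

definition smooth_on :: "'a::real_normed_vector set \<Rightarrow> ('a \<Rightarrow> 'b::real_normed_vector) \<Rightarrow> bool" where
  "smooth_on S g \<longleftrightarrow> (\<forall>k. differentiable_times_on k S g)"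

definition pd_u :: "(real \<times> real \<Rightarrow> 'b::real_normed_vector) \<Rightarrow> real \<times> real \<Rightarrow> 'b" where
  "pd_u g = (\<lambda>(u, v). vector_derivative (\<lambda>t. g (t, v)) (at u))"

definition pd_v :: "(real \<times> real \<Rightarrow> 'b::real_normed_vector) \<Rightarrow> real \<times> real \<Rightarrow> 'b" where
  "pd_v g = (\<lambda>(u, v). vector_derivative (\<lambda>s. g (u, s)) (at v))"

definition lorentz :: "real ^ 3 \<Rightarrow> real ^ 3 \<Rightarrow> real" where
  "lorentz x y = x $ 1 * y $ 1 + x $ 2 * y $ 2 - x $ 3 * y $ 3"


text \<open>Regular surfaces are subsets of \<open>\<real>\<^sup>3\<close>; the set \<open>z ` U\<close> below is a (relative) neighbourhood
  in \<open>S\<close> of each of its points.\<close>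

definition local_parametrization ::
  "(real ^ 3) set \<Rightarrow> (real \<times> real) set \<Rightarrow> (real \<times> real \<Rightarrow> real ^ 3) \<Rightarrow> bool" where
  "local_parametrization S U z \<longleftrightarrow>
     open U \<and> smooth_on U z \<and>
     (\<forall>q\<in>U. inj (frechet_derivative z (at q))) \<and>
     openin (top_of_set S) (z ` U) \<and>
     (\<exists>w. homeomorphism U (z ` U) z w)"

definition regular_surface :: "(real ^ 3) set \<Rightarrow> bool" where
  "regular_surface S \<longleftrightarrow> (\<forall>p\<in>S. \<exists>U z. local_parametrization S U z \<and> p \<in> z ` U)"

definition normal_vector :: "(real \<times> real \<Rightarrow> real ^ 3) \<Rightarrow> real \<times> real \<Rightarrow> real ^ 3 \<Rightarrow> bool" where
  "normal_vector z q w \<longleftrightarrow> w \<noteq> 0 \<and> lorentz w (pd_u z q) = 0 \<and> lorentz w (pd_v z q) = 0"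

definition time_like_surface :: "(real ^ 3) set \<Rightarrow> bool" where
  "time_like_surface S \<longleftrightarrow> regular_surface S \<and>
     (\<forall>U z. local_parametrization S U z \<longrightarrow>
        (\<forall>q\<in>U. \<forall>w. normal_vector z q w \<longrightarrow> lorentz w w > 0))"


definition unit_normal :: "(real \<times> real \<Rightarrow> real ^ 3) \<Rightarrow> real \<times> real \<Rightarrow> real ^ 3" where
  "unit_normal z q = (THE n. normal_vector z q n \<and> lorentz n n = 1 \<and>
     det (vector [pd_u z q, pd_v z q, n] :: real ^ 3 ^ 3) > 0)"

definition coef_E :: "(real \<times> real \<Rightarrow> real ^ 3) \<Rightarrow> real \<times> real \<Rightarrow> real" where
  "coef_E z q = lorentz (pd_u z q) (pd_u z q)"

definition coef_F :: "(real \<times> real \<Rightarrow> real ^ 3) \<Rightarrow> real \<times> real \<Rightarrow> real" where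
  "coef_F z q = lorentz (pd_u z q) (pd_v z q)"

definition coef_G :: "(real \<times> real \<Rightarrow> real ^ 3) \<Rightarrow> real \<times> real \<Rightarrow> real" where
  "coef_G z q = lorentz (pd_v z q) (pd_v z q)"

definition coef_L :: "(real \<times> real \<Rightarrow> real ^ 3) \<Rightarrow> real \<times> real \<Rightarrow> real" where
  "coef_L z q = lorentz (unit_normal z q) (pd_u (pd_u z) q)"

definition coef_M :: "(real \<times> real \<Rightarrow> real ^ 3) \<Rightarrow> real \<times> real \<Rightarrow> real" where
  "coef_M z q = lorentz (unit_normal z q) (pd_v (pd_u z) q)"

definition coef_N :: "(real \<times> real \<Rightarrow> real ^ 3) \<Rightarrow> real \<times> real \<Rightarrow> real" where
  "coef_N z q = lorentz (unit_normal z q) (pd_v (pd_v z) q)"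

definition Gauss_curvature :: "(real \<times> real \<Rightarrow> real ^ 3) \<Rightarrow> real \<times> real \<Rightarrow> real" where
  "Gauss_curvature z q =
     (coef_L z q * coef_N z q - (coef_M z q)\<^sup>2) / (coef_E z q * coef_G z q - (coef_F z q)\<^sup>2)"

definition mean_curvature :: "(real \<times> real \<Rightarrow> real ^ 3) \<Rightarrow> real \<times> real \<Rightarrow> real" where
  "mean_curvature z q =
     (coef_E z q * coef_N z q - 2 * coef_F z q * coef_M z q + coef_G z q * coef_L z q) /
     (2 * (coef_E z q * coef_G z q - (coef_F z q)\<^sup>2))"


text \<open>The sign normalization \<open>E > 0\<close>, \<open>G < 0\<close> is part of the notion.\<close>

definition asymptotic_parameters ::
  "(real ^ 3) set \<Rightarrow> (real \<times> real) set \<Rightarrow> (real \<times> real \<Rightarrow> real ^ 3) \<Rightarrow> bool" where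
  "asymptotic_parameters S D z \<longleftrightarrow> local_parametrization S D z \<and>
     (\<forall>q\<in>D. coef_L z q = 0 \<and> coef_N z q = 0 \<and> coef_E z q > 0 \<and> coef_G z q < 0)"

definition asym_a :: "(real \<times> real \<Rightarrow> real ^ 3) \<Rightarrow> real \<times> real \<Rightarrow> real" where
  "asym_a z q = coef_F z q / (sqrt (coef_E z q) * sqrt (- coef_G z q))"

definition asym_alpha :: "(real \<times> real \<Rightarrow> real ^ 3) \<Rightarrow> real \<times> real \<Rightarrow> real" where
  "asym_alpha z q = coef_M z q / (sqrt (coef_E z q) * sqrt (- coef_G z q))"

definition asym_f :: "(real \<times> real \<Rightarrow> real ^ 3) \<Rightarrow> real \<times> real \<Rightarrow> real" where
  "asym_f z q = 1 / 2 * (ln (sqrt (1 + (asym_a z q)\<^sup>2)) - ln \<bar>asym_alpha z q\<bar>)"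

definition u_integrand :: "(real \<times> real \<Rightarrow> real ^ 3) \<Rightarrow> real \<times> real \<Rightarrow> real" where
  "u_integrand z q =
     - asym_a z q * pd_v (asym_f z) q * (sqrt (coef_E z q) / sqrt (- coef_G z q)) + pd_u (asym_f z) q"

definition v_integrand :: "(real \<times> real \<Rightarrow> real ^ 3) \<Rightarrow> real \<times> real \<Rightarrow> real" where
  "v_integrand z q =
     pd_v (asym_f z) q + asym_a z q * pd_u (asym_f z) q * (sqrt (- coef_G z q) / sqrt (coef_E z q))"

text \<open>The integrals are oriented: they change sign when the limits are interchanged.\<close>

definition asym_phi ::
  "(real \<times> real \<Rightarrow> real ^ 3) \<Rightarrow> real \<Rightarrow> real \<Rightarrow> real \<Rightarrow> real \<Rightarrow> real" where
  "asym_phi z u0 v0 u v = sqrt (coef_E z (u, v)) *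
     exp (- (LBINT s=ereal v0..ereal v. v_integrand z (u, s))
          - (LBINT t=ereal u0..ereal u. u_integrand z (t, v0)) - asym_f z (u0, v0))"

definition asym_psi ::
  "(real \<times> real \<Rightarrow> real ^ 3) \<Rightarrow> real \<Rightarrow> real \<Rightarrow> real \<Rightarrow> real \<Rightarrow> real" where
  "asym_psi z u0 v0 u v = sqrt (- coef_G z (u, v)) *
     exp (- (LBINT t=ereal u0..ereal u. u_integrand z (t, v))
          - (LBINT s=ereal v0..ereal v. v_integrand z (u0, s)) - asym_f z (u0, v0))"

definition canonical_asymptotic_parameters ::
  "(real ^ 3) set \<Rightarrow> (real \<times> real) set \<Rightarrow> (real \<times> real \<Rightarrow> real ^ 3) \<Rightarrow> real \<Rightarrow> real \<Rightarrow> bool" where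
  "canonical_asymptotic_parameters S D z u0 v0 \<longleftrightarrow>
     (\<exists>u1 u2 v1 v2. D = {u1<..<u2} \<times> {v1<..<v2}) \<and> (u0, v0) \<in> D \<and>
     asymptotic_parameters S D z \<and>
     (\<forall>(u, v)\<in>D. asym_phi z u0 v0 u v = 1 \<and> asym_psi z u0 v0 u v = 1)"

end

theory Submission
  imports Defs
begin

text \<open>
  The second fundamental form of a time-like surface with \<open>K > 0\<close> is indefinite, so there are two
  smooth fields of asymptotic directions; \<open>K - H\<^sup>2 > 0\<close> means that one of them is space-like and the
  other time-like. Near a point they have slopes \<open>dt/ds = p(s, t)\<close> and \<open>ds/dt = q(s, t)\<close> in suitable
  parameters. Smooth first integrals \<open>u\<close>, \<open>v\<close> of these two scalar equations, obtained by following the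
  solutions back to the coordinate axes, are asymptotic parameters. In asymptotic parameters the Codazzi
  equations say that \<open>f\<^sub>u\<close> and \<open>f\<^sub>v\<close> are the two coefficients of \<open>z\<^sub>u\<^sub>v\<close> along \<open>z\<^sub>v\<close> and \<open>z\<^sub>u\<close>, whence
  the integrand in \<open>v\<close> is \<open>(ln \<surd>E)\<^sub>v\<close> and the integrand in \<open>u\<close> is \<open>(ln \<surd>-G)\<^sub>u\<close>. A change of parameters
  \<open>u = U(x)\<close> multiplies \<open>\<phi>\<close> by \<open>U'\<close>, so canonical parameters are obtained by solving \<open>U' = 1 / \<phi>(U)\<close>,
  and likewise for \<open>v\<close>.
\<close>

text \<open>The main obstacle is smooth dependence of the solutions of a differential equation on
  the initial value. Writing the asymptotic fields as slopes keeps both equations scalar, so the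
  linearised equation is solved by the exponential of an integral, and \<open>C^k\<close> regularity
  follows by bootstrapping. Slopes exist only away from one direction each; a linear change of
  parameters first makes both coordinate axes asymptotic at the given point, so that both slopes
  vanish there and are smooth nearby. The unit normal with its square root is replaced by triple
  products, which are polynomial in the partial derivatives of \<open>z\<close>. Finally,
  \<open>f\<close> is unchanged under \<open>u = U(x)\<close>, \<open>v = V(y)\<close>, and by the
  Codazzi equations the integrals transverse to the axes are differences of logarithms, so the two
  conditions of canonicity on a whole rectangle reduce to one scalar equation on each axis.\<close>

section \<open>Closure properties of the classes C^k and of smooth maps\<close>

abbreviation Ck :: "nat \<Rightarrow> 'a::real_normed_vector set \<Rightarrow> ('a \<Rightarrow> 'b::real_normed_vector) \<Rightarrow> bool" where
  "Ck \<equiv> differentiable_times_on"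

lemma Ck_cong:
  assumes "open S" "\<And>x. x \<in> S \<Longrightarrow> f x = g x" "Ck k S f"
  shows "Ck k S g"
  using assms(2,3)
proof (induction k arbitrary: f g)
  case 0
  then show ?case using continuous_on_eq by auto
next
  case (Suc k)
  have d: "g differentiable at x" if "x \<in> S" for x
    using Suc.prems(2) that has_derivative_transform_within_open[of f _ x UNIV S g, OF _ assms(1) that Suc.prems(1)]
    unfolding differentiable_times_on.simps differentiable_def by blast
  have "frechet_derivative f (at x) = frechet_derivative g (at x)" if "x \<in> S" for x
    using frechet_derivative_transform_within_open[of f x S g] Suc.prems that assms(1) by auto
  then have "Ck k S (\<lambda>x. frechet_derivative g (at x) d)" for d
    using Suc.prems Suc.IH[of "\<lambda>x. frechet_derivative f (at x) d" "\<lambda>x. frechet_derivative g (at x) d"]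
    by auto
  with d show ?case by simp
qed

text \<open>The recursion of \<open>differentiable_times_on\<close> speaks of
  \<open>frechet_derivative\<close>; this rule accepts any formula for the derivative, so that an
  induction on \<open>k\<close> can work with an explicit one.\<close>

lemma Ck_SucI:
  assumes "open S" "\<And>x. x \<in> S \<Longrightarrow> (f has_derivative f' x) (at x)" "\<And>d. Ck k S (\<lambda>x. f' x d)"
  shows "Ck (Suc k) S f"
proof -
  have "frechet_derivative f (at x) = f' x" if "x \<in> S" for x
    using frechet_derivative_at assms(2) that by metis
  then have "Ck k S (\<lambda>x. frechet_derivative f (at x) d)" for d
    using Ck_cong[OF assms(1) _ assms(3)[of d]] by auto
  then show ?thesis using assms(2) by (auto simp: differentiable_def)
qed

lemma Ck_Suc_has_derivative:
  "Ck (Suc k) S f \<Longrightarrow> x \<in> S \<Longrightarrow> (f has_derivative frechet_derivative f (at x)) (at x)"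
  by (simp add: frechet_derivative_works)

lemma Ck_SucD: "Ck (Suc k) S f \<Longrightarrow> Ck k S f"
proof (induction k arbitrary: f)
  case 0
  then show ?case
    by (auto simp: continuous_on_eq_continuous_within differentiable_imp_continuous_within
        intro: continuous_at_imp_continuous_at_within)
next
  case (Suc k)
  then show ?case by (metis differentiable_times_on.simps(2))
qed

lemma Ck_subset: "Ck k S f \<Longrightarrow> T \<subseteq> S \<Longrightarrow> Ck k T f"
proof (induction k arbitrary: f)
  case 0
  then show ?case using continuous_on_subset by auto
next
  case (Suc k)
  then show ?case by auto
qed

lemma Ck_imp_continuous: "Ck k S f \<Longrightarrow> continuous_on S f"
proof (induction k)
  case (Suc k)
  then show ?case using Ck_SucD by blast
qed simp

lemma Ck_const: "Ck k S (\<lambda>x. c)"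
  by (induction k arbitrary: c) auto

lemma Ck_id: "Ck k S (\<lambda>x. x)"
  by (cases k) (auto simp: Ck_const)

lemma Ck_bounded_linear:
  assumes "bounded_linear h" "open S" "Ck k S f"
  shows "Ck k S (\<lambda>x. h (f x))"
  using assms(3)
proof (induction k arbitrary: f)
  case 0
  then show ?case using bounded_linear.continuous_on[OF assms(1)] by auto
next
  case (Suc k)
  show ?case
  proof (rule Ck_SucI[OF assms(2)])
    show "((\<lambda>x. h (f x)) has_derivative (\<lambda>d. h (frechet_derivative f (at x) d))) (at x)" if "x \<in> S" for x
      using bounded_linear.has_derivative[OF assms(1)] Ck_Suc_has_derivative[OF Suc.prems that] by blast
    show "Ck k S (\<lambda>x. h (frechet_derivative f (at x) d))" for d
      using Suc by auto
  qed
qed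

lemma Ck_add:
  assumes "open S" "Ck k S f" "Ck k S g"
  shows "Ck k S (\<lambda>x. f x + g x)"
  using assms(2,3)
proof (induction k arbitrary: f g)
  case 0
  then show ?case by (auto intro: continuous_intros)
next
  case (Suc k)
  show ?case
  proof (rule Ck_SucI[OF assms(1)])
    show "((\<lambda>x. f x + g x) has_derivative
        (\<lambda>d. frechet_derivative f (at x) d + frechet_derivative g (at x) d)) (at x)" if "x \<in> S" for x
      using Suc.prems[THEN Ck_Suc_has_derivative, OF that] by (rule has_derivative_add)
  qed (use Suc in auto)
qed

lemma Ck_bilinear:
  assumes "bounded_bilinear h" "open S" "Ck k S f" "Ck k S g"
  shows "Ck k S (\<lambda>x. h (f x) (g x))"
  using assms(3,4)
proof (induction k arbitrary: f g)
  case 0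
  then show ?case using bounded_bilinear.continuous_on[OF assms(1)] by auto
next
  case (Suc k)
  show ?case
  proof (rule Ck_SucI[OF assms(2)])
    show "((\<lambda>x. h (f x) (g x)) has_derivative
        (\<lambda>d. h (f x) (frechet_derivative g (at x) d) + h (frechet_derivative f (at x) d) (g x))) (at x)"
      if "x \<in> S" for x
      using bounded_bilinear.FDERIV[OF assms(1)] Suc.prems[THEN Ck_Suc_has_derivative, OF that] by blast
    show "Ck k S (\<lambda>x. h (f x) (frechet_derivative g (at x) d) + h (frechet_derivative f (at x) d) (g x))" for d
      using Suc.IH Suc.prems Suc.prems[THEN Ck_SucD] by (intro Ck_add[OF assms(2)]) auto
  qed
qed

lemma Ck_sum:
  assumes "open S" "finite I" "\<And>i. i \<in> I \<Longrightarrow> Ck k S (f i)"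
  shows "Ck k S (\<lambda>x. \<Sum>i\<in>I. f i x)"
  using assms(2,3)
proof (induction I rule: finite_induct)
  case (insert i I)
  then show ?case using Ck_add[OF assms(1), of k "f i" "\<lambda>x. \<Sum>i\<in>I. f i x"] by simp
qed (simp add: Ck_const)

text \<open>By the chain rule the derivative of \<open>g\<close> at \<open>f x\<close> is applied to
  a moving vector, whereas the recursion only treats fixed directions. Expanding that vector in
  \<open>Basis\<close> leaves products of coordinates with derivatives in fixed directions, to which
  the induction hypothesis applies; hence the Euclidean space in the middle.\<close>

lemma Ck_compose:
  fixes f :: "'a::real_normed_vector \<Rightarrow> 'b::euclidean_space"
  assumes "open S" "open T" "f ` S \<subseteq> T" "Ck k S f" "Ck k T g"
  shows "Ck k S (\<lambda>x. g (f x))"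
  using assms(3-)
proof (induction k arbitrary: f g)
  case 0
  then show ?case by (auto intro: continuous_on_compose2)
next
  case (Suc k)
  let ?f = "\<lambda>x. frechet_derivative f (at x)" and ?g = "\<lambda>y. frechet_derivative g (at y)"
  show ?case
  proof (rule Ck_SucI[OF assms(1)])
    show "((\<lambda>x. g (f x)) has_derivative (\<lambda>d. \<Sum>b\<in>Basis. (?f x d \<bullet> b) *\<^sub>R ?g (f x) b)) (at x)"
      if "x \<in> S" for x
    proof -
      have g: "(g has_derivative ?g (f x)) (at (f x))"
        using Ck_Suc_has_derivative[OF Suc.prems(3)] Suc.prems(1) that by blast
      have D: "((\<lambda>x. g (f x)) has_derivative (\<lambda>d. ?g (f x) (?f x d))) (at x)"
        using diff_chain_at[OF Ck_Suc_has_derivative[OF Suc.prems(2) that] g] by (simp add: o_def)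
      have e: "?g (f x) y = (\<Sum>b\<in>Basis. (y \<bullet> b) *\<^sub>R ?g (f x) b)" for y
      proof -
        have l: "linear (?g (f x))" using g has_derivative_linear by blast
        have "?g (f x) y = ?g (f x) (\<Sum>b\<in>Basis. (y \<bullet> b) *\<^sub>R b)"
          by (simp only: euclidean_representation)
        also have "\<dots> = (\<Sum>b\<in>Basis. (y \<bullet> b) *\<^sub>R ?g (f x) b)"
          by (simp only: linear_sum[OF l] linear_cmul[OF l])
        finally show ?thesis .
      qed
      show ?thesis by (rule has_derivative_eq_rhs[OF D ext[OF e]])
    qed
    show "Ck k S (\<lambda>x. \<Sum>b\<in>Basis. (?f x d \<bullet> b) *\<^sub>R ?g (f x) b)" for d
    proof (rule Ck_sum[OF assms(1)], simp)
      fix b :: 'b assume "b \<in> Basis"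
      have "Ck k S (\<lambda>x. ?f x d \<bullet> b)"
        using Suc.prems(2) by (intro Ck_bounded_linear[OF bounded_linear_inner_left assms(1)]) simp
      moreover have "Ck k S (\<lambda>x. ?g (f x) b)"
        using Suc.prems Ck_SucD[OF Suc.prems(2)] by (intro Suc.IH) auto
      ultimately show "Ck k S (\<lambda>x. (?f x d \<bullet> b) *\<^sub>R ?g (f x) b)"
        by (rule Ck_bilinear[OF bounded_bilinear_scaleR assms(1)])
    qed
  qed
qed

lemma Ck_Pair:
  assumes "open S" "Ck k S f" "Ck k S g"
  shows "Ck k S (\<lambda>x. (f x, g x))"
proof -
  have "Ck k S (\<lambda>x. (f x, 0) + (0, g x))"
    using assms by (intro Ck_add Ck_bounded_linear[where h = "\<lambda>y. (y, 0)"]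
        Ck_bounded_linear[where h = "\<lambda>y. (0, y)"])
      (auto intro!: bounded_linear_Pair bounded_linear_zero bounded_linear_ident)
  then show ?thesis by simp
qed

lemma Ck_real_SucI:
  fixes g :: "real \<Rightarrow> real"
  assumes "open S" "\<And>x. x \<in> S \<Longrightarrow> (g has_real_derivative g' x) (at x)" "Ck k S g'"
  shows "Ck (Suc k) S g"
proof (rule Ck_SucI[OF assms(1)])
  show "(g has_derivative (\<lambda>d. g' x * d)) (at x)" if "x \<in> S" for x
    using assms(2)[OF that] by (simp add: has_field_derivative_def)
  show "Ck k S (\<lambda>x. g' x * d)" for d
    using Ck_bounded_linear[OF bounded_linear_mult_left assms(1,3)] .
qed

lemma smooth_onI: "(\<And>k. Ck k S f) \<Longrightarrow> smooth_on S f"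
  by (simp add: smooth_on_def)

lemma smooth_onD: "smooth_on S f \<Longrightarrow> Ck k S f"
  by (simp add: smooth_on_def)

lemma smooth_on_cong: "open S \<Longrightarrow> (\<And>x. x \<in> S \<Longrightarrow> f x = g x) \<Longrightarrow> smooth_on S f \<Longrightarrow> smooth_on S g"
  using Ck_cong unfolding smooth_on_def by blast

lemma smooth_on_subset: "smooth_on S f \<Longrightarrow> T \<subseteq> S \<Longrightarrow> smooth_on T f"
  using Ck_subset unfolding smooth_on_def by blast

lemma smooth_on_has_derivative:
  "smooth_on S f \<Longrightarrow> x \<in> S \<Longrightarrow> (f has_derivative frechet_derivative f (at x)) (at x)"
  using Ck_Suc_has_derivative smooth_onD by blast

lemma smooth_on_differentiable: "smooth_on S f \<Longrightarrow> x \<in> S \<Longrightarrow> f differentiable (at x)"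
  using smooth_on_has_derivative differentiable_def by blast

lemma smooth_on_continuous: "smooth_on S f \<Longrightarrow> continuous_on S f"
  using Ck_imp_continuous smooth_onD by blast

lemma smooth_on_frechet: "smooth_on S f \<Longrightarrow> smooth_on S (\<lambda>x. frechet_derivative f (at x) d)"
  unfolding smooth_on_def
proof
  show "Ck k S (\<lambda>x. frechet_derivative f (at x) d)" if "\<forall>k. Ck k S f" for k
    using spec[OF that, of "Suc k"] by simp
qed

lemma smooth_on_const: "smooth_on S (\<lambda>x. c)"
  by (simp add: smooth_on_def Ck_const)

lemma smooth_on_id: "smooth_on S (\<lambda>x. x)"
  by (simp add: smooth_on_def Ck_id)

lemma smooth_on_bounded_linear:
  "bounded_linear h \<Longrightarrow> open S \<Longrightarrow> smooth_on S f \<Longrightarrow> smooth_on S (\<lambda>x. h (f x))"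
  by (simp add: smooth_on_def Ck_bounded_linear)

lemma smooth_on_bilinear:
  "bounded_bilinear h \<Longrightarrow> open S \<Longrightarrow> smooth_on S f \<Longrightarrow> smooth_on S g \<Longrightarrow> smooth_on S (\<lambda>x. h (f x) (g x))"
  by (simp add: smooth_on_def Ck_bilinear)

lemma smooth_on_add:
  "open S \<Longrightarrow> smooth_on S f \<Longrightarrow> smooth_on S g \<Longrightarrow> smooth_on S (\<lambda>x. f x + g x)"
  by (simp add: smooth_on_def Ck_add)

lemma smooth_on_minus: "open S \<Longrightarrow> smooth_on S f \<Longrightarrow> smooth_on S (\<lambda>x. - f x)"
  by (rule smooth_on_bounded_linear[OF bounded_linear_minus[OF bounded_linear_ident]])

lemma smooth_on_diff:
  "open S \<Longrightarrow> smooth_on S f \<Longrightarrow> smooth_on S g \<Longrightarrow> smooth_on S (\<lambda>x. f x - g x)"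
  using smooth_on_add[OF _ _ smooth_on_minus] by fastforce

lemma smooth_on_mult:
  fixes f g :: "'a::real_normed_vector \<Rightarrow> real"
  shows "open S \<Longrightarrow> smooth_on S f \<Longrightarrow> smooth_on S g \<Longrightarrow> smooth_on S (\<lambda>x. f x * g x)"
  by (rule smooth_on_bilinear[OF bounded_bilinear_mult])

lemma smooth_on_power2:
  fixes f :: "'a::real_normed_vector \<Rightarrow> real"
  shows "open S \<Longrightarrow> smooth_on S f \<Longrightarrow> smooth_on S (\<lambda>x. (f x)\<^sup>2)"
  by (simp add: power2_eq_square smooth_on_mult)

lemma smooth_on_Pair:
  "open S \<Longrightarrow> smooth_on S f \<Longrightarrow> smooth_on S g \<Longrightarrow> smooth_on S (\<lambda>x. (f x, g x))"
  by (simp add: smooth_on_def Ck_Pair)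

lemma smooth_on_fst: "open S \<Longrightarrow> smooth_on S f \<Longrightarrow> smooth_on S (\<lambda>x. fst (f x))"
  by (rule smooth_on_bounded_linear[OF bounded_linear_fst])

lemma smooth_on_snd: "open S \<Longrightarrow> smooth_on S f \<Longrightarrow> smooth_on S (\<lambda>x. snd (f x))"
  by (rule smooth_on_bounded_linear[OF bounded_linear_snd])

lemma smooth_on_nth: "open S \<Longrightarrow> smooth_on S f \<Longrightarrow> smooth_on S (\<lambda>x. f x $ i)"
  by (rule smooth_on_bounded_linear[OF bounded_linear_vec_nth])

lemma smooth_on_compose:
  fixes f :: "'a::real_normed_vector \<Rightarrow> 'b::euclidean_space"
  shows "open S \<Longrightarrow> open T \<Longrightarrow> (\<And>x. x \<in> S \<Longrightarrow> f x \<in> T) \<Longrightarrow> smooth_on S f \<Longrightarrow> smooth_on T g \<Longrightarrow>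
    smooth_on S (\<lambda>x. g (f x))"
  unfolding smooth_on_def using Ck_compose[of S T f] by blast

lemma open_nonzero_reals: "open {x::real. x \<noteq> 0}"
  using open_delete[OF open_UNIV, of "0::real"] by (simp add: Collect_neg_eq Compl_eq_Diff_UNIV)

lemma open_pos_reals: "open {x::real. x > 0}"
  by (simp add: open_Collect_less continuous_intros)

text \<open>The derivative is a polynomial in \<open>inverse\<close> itself, so each induction step
  gains one order.\<close>

lemma smooth_on_real_inverse: "smooth_on {x::real. x \<noteq> 0} inverse"
proof (rule smooth_onI)
  show "Ck k {x::real. x \<noteq> 0} inverse" for k
  proof (induction k)
    case 0
    show ?case by (simp add: continuous_on_inverse)
  next
    case (Suc k)
    have "Ck k {x::real. x \<noteq> 0} (\<lambda>x. - (inverse x * inverse x))"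
      by (intro Ck_bounded_linear[OF bounded_linear_minus[OF bounded_linear_ident]]
          Ck_bilinear[OF bounded_bilinear_mult] Suc open_nonzero_reals)
    then show ?case
      using DERIV_inverse[where 'a = real]
      by (intro Ck_real_SucI[OF open_nonzero_reals, where g' = "\<lambda>x. - (inverse x * inverse x)"])
        (simp_all add: power2_eq_square)
  qed
qed

lemma smooth_on_real_exp: "smooth_on UNIV (exp :: real \<Rightarrow> real)"
proof (rule smooth_onI)
  show "Ck k UNIV (exp :: real \<Rightarrow> real)" for k
  proof (induction k)
    case (Suc k)
    then show ?case
      by (intro Ck_real_SucI[OF open_UNIV, where g' = exp]) (simp_all add: DERIV_exp)
  qed (simp add: continuous_on_exp)
qed

lemma smooth_on_real_ln: "smooth_on {x::real. x > 0} ln"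
proof (rule smooth_onI)
  fix k
  have "Ck (Suc k) {x::real. x > 0} ln"
  proof (rule Ck_real_SucI[OF open_pos_reals])
    show "Ck k {x::real. x > 0} inverse"
      by (rule Ck_subset[OF smooth_onD[OF smooth_on_real_inverse]]) auto
  qed (auto simp: DERIV_ln)
  then show "Ck k {x::real. x > 0} ln" by (rule Ck_SucD)
qed

lemma smooth_on_inverse:
  fixes f :: "'a::real_normed_vector \<Rightarrow> real"
  shows "open S \<Longrightarrow> smooth_on S f \<Longrightarrow> (\<And>x. x \<in> S \<Longrightarrow> f x \<noteq> 0) \<Longrightarrow> smooth_on S (\<lambda>x. inverse (f x))"
  by (rule smooth_on_compose[OF _ open_nonzero_reals _ _ smooth_on_real_inverse]) simp_all

lemma smooth_on_divide:
  fixes f g :: "'a::real_normed_vector \<Rightarrow> real"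
  shows "open S \<Longrightarrow> smooth_on S f \<Longrightarrow> smooth_on S g \<Longrightarrow> (\<And>x. x \<in> S \<Longrightarrow> g x \<noteq> 0) \<Longrightarrow>
    smooth_on S (\<lambda>x. f x / g x)"
  by (simp add: divide_inverse smooth_on_mult smooth_on_inverse)

lemma smooth_on_exp:
  fixes f :: "'a::real_normed_vector \<Rightarrow> real"
  shows "open S \<Longrightarrow> smooth_on S f \<Longrightarrow> smooth_on S (\<lambda>x. exp (f x))"
  by (rule smooth_on_compose[OF _ open_UNIV _ _ smooth_on_real_exp]) simp_all

lemma smooth_on_ln:
  fixes f :: "'a::real_normed_vector \<Rightarrow> real"
  shows "open S \<Longrightarrow> smooth_on S f \<Longrightarrow> (\<And>x. x \<in> S \<Longrightarrow> f x > 0) \<Longrightarrow> smooth_on S (\<lambda>x. ln (f x))"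
  by (rule smooth_on_compose[OF _ open_pos_reals _ _ smooth_on_real_ln]) simp_all

lemma smooth_on_sqrt:
  fixes f :: "'a::real_normed_vector \<Rightarrow> real"
  assumes "open S" "smooth_on S f" "\<And>x. x \<in> S \<Longrightarrow> f x > 0"
  shows "smooth_on S (\<lambda>x. sqrt (f x))"
proof (rule smooth_on_cong[OF assms(1)])
  show "exp (ln (f x) * (1 / 2)) = sqrt (f x)" if "x \<in> S" for x
    using assms(3)[OF that] by (simp add: powr_half_sqrt[symmetric] powr_def)
  show "smooth_on S (\<lambda>x. exp (ln (f x) * (1 / 2)))"
    by (intro smooth_on_exp smooth_on_mult smooth_on_ln smooth_on_const assms)
qed

subsection \<open>Functions of two real variables\<close>

lemma differentiable_partials:
  assumes "(g has_derivative g') (at (u, v))"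
  shows "((\<lambda>t. g (t, v)) has_vector_derivative g' (1, 0)) (at u)"
    and "((\<lambda>s. g (u, s)) has_vector_derivative g' (0, 1)) (at v)"
    and "pd_u g (u, v) = g' (1, 0)" "pd_v g (u, v) = g' (0, 1)"
    and "g' (h, k) = h *\<^sub>R pd_u g (u, v) + k *\<^sub>R pd_v g (u, v)"
proof -
  interpret g': bounded_linear g' using assms by (rule has_derivative_bounded_linear)
  have "((\<lambda>t. (t, v)) has_derivative (\<lambda>t. (t, 0))) (at u)"
    by (auto intro!: derivative_eq_intros)
  from diff_chain_at[OF this assms] have a: "((\<lambda>t. g (t, v)) has_derivative (\<lambda>t. g' (t, 0))) (at u)"
    by (simp add: o_def)
  have a': "g' (t, 0) = t *\<^sub>R g' (1, 0)" for t using g'.scaleR[of t "(1, 0)"] by simp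
  show 1: "((\<lambda>t. g (t, v)) has_vector_derivative g' (1, 0)) (at u)"
    unfolding has_vector_derivative_def by (rule has_derivative_eq_rhs[OF a ext[OF a']])
  have "((\<lambda>s. (u, s)) has_derivative (\<lambda>s. (0, s))) (at v)"
    by (auto intro!: derivative_eq_intros)
  from diff_chain_at[OF this assms] have b: "((\<lambda>s. g (u, s)) has_derivative (\<lambda>s. g' (0, s))) (at v)"
    by (simp add: o_def)
  have b': "g' (0, t) = t *\<^sub>R g' (0, 1)" for t using g'.scaleR[of t "(0, 1)"] by simp
  show 2: "((\<lambda>s. g (u, s)) has_vector_derivative g' (0, 1)) (at v)"
    unfolding has_vector_derivative_def by (rule has_derivative_eq_rhs[OF b ext[OF b']])
  show 3: "pd_u g (u, v) = g' (1, 0)" "pd_v g (u, v) = g' (0, 1)"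
    using 1 2 by (simp_all add: pd_u_def pd_v_def vector_derivative_at)
  show "g' (h, k) = h *\<^sub>R pd_u g (u, v) + k *\<^sub>R pd_v g (u, v)"
    using g'.add[of "(h, 0)" "(0, k)"] g'.scaleR[of h "(1, 0)"] g'.scaleR[of k "(0, 1)"] by (simp add: 3)
qed

text \<open>The bridge between \<open>smooth_on\<close>, which uses total derivatives, and the
  fundamental forms, which use derivatives along coordinate lines.\<close>

lemma frechet_eq_pd:
  assumes "g differentiable (at q)"
  shows "pd_u g q = frechet_derivative g (at q) (1, 0)" "pd_v g q = frechet_derivative g (at q) (0, 1)"
    and "frechet_derivative g (at q) d = fst d *\<^sub>R pd_u g q + snd d *\<^sub>R pd_v g q"
  using differentiable_partials(3-5)[of g "frechet_derivative g (at q)" "fst q" "snd q"]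
    assms[unfolded frechet_derivative_works] by (metis prod.collapse)+

lemma has_derivative_pd:
  assumes "g differentiable (at q)"
  shows "(g has_derivative (\<lambda>d. fst d *\<^sub>R pd_u g q + snd d *\<^sub>R pd_v g q)) (at q)"
  by (rule has_derivative_eq_rhs[OF assms[unfolded frechet_derivative_works] ext[OF frechet_eq_pd(3)[OF assms]]])

lemma has_vector_derivative_pd:
  assumes "g differentiable (at (u, v))"
  shows "((\<lambda>t. g (t, v)) has_vector_derivative pd_u g (u, v)) (at u)"
    and "((\<lambda>s. g (u, s)) has_vector_derivative pd_v g (u, v)) (at v)"
  using differentiable_partials[OF has_derivative_pd[OF assms]] by auto

lemma pd_cong:
  assumes "open S" "q \<in> S" "\<And>x. x \<in> S \<Longrightarrow> f x = g x" "f differentiable (at q)"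
  shows "pd_u f q = pd_u g q" "pd_v f q = pd_v g q"
proof -
  have "g differentiable (at q)"
    using assms(4) has_derivative_transform_within_open[of f _ q UNIV S g, OF _ assms(1-3)]
    unfolding differentiable_def by blast
  moreover have "frechet_derivative f (at q) = frechet_derivative g (at q)"
    by (rule frechet_derivative_transform_within_open[OF assms(4,1,2,3)])
  ultimately show "pd_u f q = pd_u g q" "pd_v f q = pd_v g q"
    using assms(4) by (simp_all only: frechet_eq_pd(1,2))
qed

lemma smooth_on_pd:
  assumes "open S" "smooth_on S g"
  shows "smooth_on S (pd_u g)" "smooth_on S (pd_v g)"
  using smooth_on_cong[OF assms(1) _ smooth_on_frechet[OF assms(2)]]
    frechet_eq_pd[OF smooth_on_differentiable[OF assms(2)]] by metis+

lemma Ck_pd: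
  assumes "open S" "Ck (Suc k) S g"
  shows "Ck k S (pd_u g)" "Ck k S (pd_v g)"
proof -
  have c: "Ck k S (\<lambda>x. frechet_derivative g (at x) d)" for d
    using assms(2) unfolding differentiable_times_on.simps by blast
  have d: "g differentiable (at x)" if "x \<in> S" for x using that assms by simp
  show "Ck k S (pd_u g)"
    by (rule Ck_cong[OF assms(1) frechet_eq_pd(1)[symmetric, OF d] c])
  show "Ck k S (pd_v g)"
    by (rule Ck_cong[OF assms(1) frechet_eq_pd(2)[symmetric, OF d] c])
qed

text \<open>Serves functions defined by integrals or differential equations, whose derivatives are
  computed one variable at a time: continuous partial derivatives give a total derivative, and this
  is a linear combination of them with constant coefficients.\<close>

lemma Ck_partialsI:
  assumes "open S"
    and u: "\<And>u v. (u, v) \<in> S \<Longrightarrow> ((\<lambda>t. g (t, v)) has_vector_derivative gu (u, v)) (at u)"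
    and v: "\<And>u v. (u, v) \<in> S \<Longrightarrow> ((\<lambda>s. g (u, s)) has_vector_derivative gv (u, v)) (at v)"
    and Ck: "Ck k S gu" "Ck k S gv"
  shows "Ck (Suc k) S g"
proof (rule Ck_SucI[OF assms(1)])
  fix q assume q: "q \<in> S"
  obtain u0 v0 where uv: "q = (u0, v0)" by force
  obtain A B where AB: "open A" "open B" "u0 \<in> A" "v0 \<in> B" "A \<times> B \<subseteq> S"
    using open_prod_elim[OF assms(1) q] uv by (metis mem_Sigma_iff)
  \<comment> \<open>\<open>has_derivative_partialsI\<close> needs a convex set in the second
    variable, hence a ball inside \<open>B\<close>.\<close>
  obtain e where e: "e > 0" "ball v0 e \<subseteq> B" using AB open_contains_ball by blast
  have "((\<lambda>(x, y). g (x, y)) has_derivative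
      (\<lambda>(tx, ty). tx *\<^sub>R gu (u0, v0) + blinfun_apply (blinfun_scaleR_left (gv (u0, v0))) ty))
      (at (u0, v0) within A \<times> ball v0 e)"
  proof (rule has_derivative_partialsI)
    show "((\<lambda>x. g (x, v0)) has_derivative (\<lambda>tx. tx *\<^sub>R gu (u0, v0))) (at u0 within A)"
      using u q uv by (auto simp: has_vector_derivative_def intro: has_derivative_at_withinI)
    show "((\<lambda>y. g (x, y)) has_derivative blinfun_apply (blinfun_scaleR_left (gv (x, y))))
        (at y within ball v0 e)" if "x \<in> A" "y \<in> ball v0 e" for x y
    proof -
      have "(x, y) \<in> S" using that AB e by blast
      from v[OF this] show ?thesis
        by (simp add: has_vector_derivative_def has_derivative_at_withinI)
    qed
    have "continuous_on (A \<times> ball v0 e) gv"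
      using Ck_imp_continuous[OF Ck(2)] AB e by (blast intro: continuous_on_subset)
    then have "continuous_on (A \<times> ball v0 e) (\<lambda>x. blinfun_scaleR_left (gv x))"
      by (auto intro!: continuous_intros)
    then show "continuous (at (u0, v0) within A \<times> ball v0 e)
        (\<lambda>(x, y). blinfun_scaleR_left (gv (x, y)))"
      using AB e by (auto simp: continuous_on_eq_continuous_within case_prod_beta')
  qed (use e in auto)
  moreover have "at (u0, v0) within A \<times> ball v0 e = at (u0, v0)"
    using AB e by (intro at_within_open) (auto intro: open_Times)
  ultimately show "(g has_derivative (\<lambda>d. fst d *\<^sub>R gu q + snd d *\<^sub>R gv q)) (at q)"
    by (simp add: uv case_prod_beta')
next
  show "Ck k S (\<lambda>x. fst d *\<^sub>R gu x + snd d *\<^sub>R gv x)" for d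
    using Ck by (intro Ck_add[OF assms(1)] Ck_bounded_linear[OF bounded_linear_scaleR_right assms(1)])
qed

lemma pd_compose:
  fixes \<Phi> :: "real \<times> real \<Rightarrow> real \<times> real"
  assumes "\<Phi> differentiable (at q)" "g differentiable (at (\<Phi> q))"
  shows "pd_u (\<lambda>q. g (\<Phi> q)) q = fst (pd_u \<Phi> q) *\<^sub>R pd_u g (\<Phi> q) + snd (pd_u \<Phi> q) *\<^sub>R pd_v g (\<Phi> q)"
    and "pd_v (\<lambda>q. g (\<Phi> q)) q = fst (pd_v \<Phi> q) *\<^sub>R pd_u g (\<Phi> q) + snd (pd_v \<Phi> q) *\<^sub>R pd_v g (\<Phi> q)"
proof -
  have "((\<lambda>q. g (\<Phi> q)) has_derivative (\<lambda>d. fst (fst d *\<^sub>R pd_u \<Phi> q + snd d *\<^sub>R pd_v \<Phi> q) *\<^sub>R pd_u g (\<Phi> q)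
      + snd (fst d *\<^sub>R pd_u \<Phi> q + snd d *\<^sub>R pd_v \<Phi> q) *\<^sub>R pd_v g (\<Phi> q))) (at q)"
    using diff_chain_at[OF has_derivative_pd[OF assms(1)] has_derivative_pd[OF assms(2)]]
    by (simp add: o_def)
  from differentiable_partials(3,4)[of _ _ "fst q" "snd q", simplified, OF this]
  show "pd_u (\<lambda>q. g (\<Phi> q)) q = fst (pd_u \<Phi> q) *\<^sub>R pd_u g (\<Phi> q) + snd (pd_u \<Phi> q) *\<^sub>R pd_v g (\<Phi> q)"
    and "pd_v (\<lambda>q. g (\<Phi> q)) q = fst (pd_v \<Phi> q) *\<^sub>R pd_u g (\<Phi> q) + snd (pd_v \<Phi> q) *\<^sub>R pd_v g (\<Phi> q)"
    by auto
qed

lemma smooth_on_has_pd: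
  assumes "smooth_on S g" "(u, v) \<in> S"
  shows "((\<lambda>t. g (t, v)) has_vector_derivative pd_u g (u, v)) (at u within X)"
    and "((\<lambda>s. g (u, s)) has_vector_derivative pd_v g (u, v)) (at v within X)"
  using has_vector_derivative_pd[OF smooth_on_differentiable[OF assms]]
  by (auto intro: has_vector_derivative_at_within)

text \<open>Schwarz's theorem by integration: near the point, \<open>g (x, y) - g (x, ?a)\<close> is
  the integral of \<open>pd_v g (x, s)\<close> over \<open>s\<close>. Differentiating under the
  integral in \<open>x\<close> and then at the upper limit \<open>y\<close> yields one mixed
  derivative; differentiating the difference directly yields the other.\<close>

lemma pd_commute:
  fixes g :: "real \<times> real \<Rightarrow> 'b::banach"
  assumes "open S" "smooth_on S g" "(u, v) \<in> S"
  shows "pd_v (pd_u g) (u, v) = pd_u (pd_v g) (u, v)"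
proof -
  obtain A B where AB: "open A" "open B" "u \<in> A" "v \<in> B" "A \<times> B \<subseteq> S"
    using open_prod_elim[OF assms(1,3)] by (metis mem_Sigma_iff)
  obtain d where d: "d > 0" "ball u d \<subseteq> A" using AB open_contains_ball by blast
  obtain e where e: "e > 0" "cball v e \<subseteq> B" using AB open_contains_cball by blast
  let ?a = "v - e" and ?b = "v + e"
  have S: "(x, y) \<in> S" if "x \<in> ball u d" "y \<in> {?a..?b}" for x y
  proof -
    have "x \<in> A" "y \<in> B" using that d e by (auto simp: cball_eq_atLeastAtMost)
    then show ?thesis using AB by blast
  qed
  note sv = smooth_on_pd(2)[OF assms(1,2)]
  note suv = smooth_on_pd(1)[OF assms(1) sv]
  have cont: "continuous_on (ball u d \<times> {?a..?b}) (pd_u (pd_v g))" "continuous_on (ball u d \<times> {?a..?b}) (pd_v g)"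
    using smooth_on_continuous[OF suv] smooth_on_continuous[OF sv] S by (auto intro: continuous_on_subset)
  have FTC: "((\<lambda>s. pd_v g (x, s)) has_integral g (x, y) - g (x, ?a)) {?a..y}"
    if "x \<in> ball u d" "y \<in> {?a..?b}" for x y
  proof (rule fundamental_theorem_of_calculus)
    show "((\<lambda>y. g (x, y)) has_vector_derivative pd_v g (x, s)) (at s within {?a..y})"
      if "s \<in> {?a..y}" for s
    proof -
      have "(x, s) \<in> S" using that \<open>y \<in> _\<close> \<open>x \<in> _\<close> by (intro S) auto
      then show ?thesis by (rule smooth_on_has_pd(2)[OF assms(2)])
    qed
  qed (use that in auto)
  have int: "pd_u g (u, y) - pd_u g (u, ?a) = integral {?a..y} (\<lambda>s. pd_u (pd_v g) (u, s))"
    if y: "y \<in> {?a..?b}" for y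
  proof -
    have "((\<lambda>x. integral (cbox ?a y) (\<lambda>s. pd_v g (x, s))) has_vector_derivative
        integral (cbox ?a y) (\<lambda>s. pd_u (pd_v g) (u, s))) (at u within ball u d)"
    proof (rule leibniz_rule_vector_derivative)
      show "((\<lambda>x. pd_v g (x, t)) has_vector_derivative pd_u (pd_v g) (x, t)) (at x within ball u d)"
        if "x \<in> ball u d" "t \<in> cbox ?a y" for x t
      proof -
        have "(x, t) \<in> S" using that y by (intro S) auto
        then show ?thesis by (rule smooth_on_has_pd(1)[OF sv])
      qed
      show "(\<lambda>s. pd_v g (x, s)) integrable_on cbox ?a y" if "x \<in> ball u d" for x
        using has_integral_integrable[OF FTC[OF that y]] by simp
      show "continuous_on (ball u d \<times> cbox ?a y) (\<lambda>(x, t). pd_u (pd_v g) (x, t))"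
        unfolding case_prod_beta' prod.collapse
        by (rule continuous_on_subset[OF cont(1)]) (use y in auto)
    qed (use d in auto)
    then have "((\<lambda>x. integral (cbox ?a y) (\<lambda>s. pd_v g (x, s))) has_vector_derivative
        integral (cbox ?a y) (\<lambda>s. pd_u (pd_v g) (u, s))) (at u)"
      using d by (simp only: at_within_open[OF _ open_ball] centre_in_ball)
    then have "((\<lambda>x. integral {?a..y} (\<lambda>s. pd_v g (x, s))) has_vector_derivative
        integral {?a..y} (\<lambda>s. pd_u (pd_v g) (u, s))) (at u)"
      by (simp only: cbox_interval)
    then have "((\<lambda>x. g (x, y) - g (x, ?a)) has_vector_derivative
        integral {?a..y} (\<lambda>s. pd_u (pd_v g) (u, s))) (at u)"
      by (rule has_vector_derivative_transform_within_open[OF _ open_ball[of u d]])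
        (use d FTC y in \<open>auto simp: integral_unique\<close>)
    moreover have "((\<lambda>x. g (x, y) - g (x, ?a)) has_vector_derivative pd_u g (u, y) - pd_u g (u, ?a)) (at u)"
    proof -
      have "(u, y) \<in> S" "(u, ?a) \<in> S" using y d e by (auto intro!: S)
      then show ?thesis
        by (intro has_vector_derivative_diff smooth_on_has_pd(1)[OF assms(2)])
    qed
    ultimately show ?thesis by (rule vector_derivative_unique_at[symmetric])
  qed
  have "((\<lambda>y. integral {?a..y} (\<lambda>s. pd_u (pd_v g) (u, s))) has_vector_derivative pd_u (pd_v g) (u, v))
      (at v within {?a..?b})"
  proof (rule integral_has_vector_derivative)
    show "continuous_on {?a..?b} (\<lambda>s. pd_u (pd_v g) (u, s))"
      by (rule continuous_on_compose2[OF cont(1), where f = "Pair u"])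
        (use d in \<open>auto intro!: continuous_intros\<close>)
  qed (use e in auto)
  then have "((\<lambda>y. integral {?a..y} (\<lambda>s. pd_u (pd_v g) (u, s))) has_vector_derivative pd_u (pd_v g) (u, v)) (at v)"
    using e at_within_interior[of v "{?a..?b}"] by simp
  then have "((\<lambda>y. pd_u g (u, y) - pd_u g (u, ?a)) has_vector_derivative pd_u (pd_v g) (u, v)) (at v)"
    by (rule has_vector_derivative_transform_within_open[OF _ open_greaterThanLessThan[of ?a ?b]])
      (use e int in auto)
  moreover have "((\<lambda>y. pd_u g (u, y) - pd_u g (u, ?a)) has_vector_derivative pd_v (pd_u g) (u, v)) (at v)"
    using has_vector_derivative_diff[OF smooth_on_has_pd(2)[OF smooth_on_pd(1)[OF assms(1,2)] assms(3)]
        has_vector_derivative_const[of "pd_u g (u, ?a)"]] by simp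
  ultimately show ?thesis by (rule vector_derivative_unique_at[symmetric])
qed

subsection \<open>Local inverses of smooth maps of the plane\<close>

definition jac :: "(real \<times> real \<Rightarrow> real \<times> real) \<Rightarrow> real \<times> real \<Rightarrow> real" where
  "jac \<Psi> q = fst (pd_u \<Psi> q) * snd (pd_v \<Psi> q) - snd (pd_u \<Psi> q) * fst (pd_v \<Psi> q)"

lemma smooth_on_jac: "open U \<Longrightarrow> smooth_on U \<Psi> \<Longrightarrow> smooth_on U (jac \<Psi>)"
  unfolding jac_def[abs_def]
  by (intro smooth_on_diff smooth_on_mult smooth_on_fst smooth_on_snd smooth_on_pd)

lemma open_smooth_preimage:
  fixes f :: "'a::real_normed_vector \<Rightarrow> 'b::real_normed_vector"
  assumes "open U" "smooth_on U f" "open T"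
  shows "open {q \<in> U. f q \<in> T}"
proof -
  have "{q \<in> U. f q \<in> T} = U \<inter> f -` T" by auto
  then show ?thesis
    using continuous_open_preimage[OF smooth_on_continuous[OF assms(2)] assms(1,3)] by simp
qed

text \<open>Cramer's rule for the matrix with columns \<open>(a, c)\<close> and
  \<open>(b, d)\<close>. As an equivalence it serves both to solve the system and to show that the
  solution is unique.\<close>

lemma cramer_2:
  fixes a b c d x y :: real
  assumes "a * d - c * b \<noteq> 0"
  shows "x *\<^sub>R (a, c) + y *\<^sub>R (b, d) = (h, k) \<longleftrightarrow>
    (x, y) = ((h * d - b * k) / (a * d - c * b), (a * k - c * h) / (a * d - c * b))"
proof
  assume "x *\<^sub>R (a, c) + y *\<^sub>R (b, d) = (h, k)"
  then have "h = x * a + y * b" "k = x * c + y * d" by auto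
  then show "(x, y) = ((h * d - b * k) / (a * d - c * b), (a * k - c * h) / (a * d - c * b))"
    using assms by (auto simp: eq_divide_eq) (auto simp: algebra_simps)
next
  assume "(x, y) = ((h * d - b * k) / (a * d - c * b), (a * k - c * h) / (a * d - c * b))"
  then have xy: "x * (a * d - c * b) = h * d - b * k" "y * (a * d - c * b) = a * k - c * h"
    using assms by auto
  have "(x * a + y * b - h) * (a * d - c * b) = 0" "(x * c + y * d - k) * (a * d - c * b) = 0"
    using xy by algebra+
  then show "x *\<^sub>R (a, c) + y *\<^sub>R (b, d) = (h, k)"
    using assms by auto
qed

text \<open>The inverse function theorem gives a differentiable inverse whose derivative at
  \<open>y\<close> is the inverse matrix at \<open>\<Phi> y\<close>. By Cramer's rule its entries
  are smooth functions of the point, so if \<open>\<Phi>\<close> is \<open>C^k\<close>, its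
  derivative is \<open>C^k\<close> too, and the regularity climbs.\<close>

proposition smooth_local_inverse:
  fixes \<Psi> :: "real \<times> real \<Rightarrow> real \<times> real"
  assumes "open U" "smooth_on U \<Psi>" "q0 \<in> U" "jac \<Psi> q0 \<noteq> 0"
  obtains U' V \<Phi> where "open U'" "U' \<subseteq> U" "q0 \<in> U'" "open V" "\<Psi> q0 \<in> V"
    "homeomorphism U' V \<Psi> \<Phi>" "smooth_on V \<Phi>" "\<And>q. q \<in> U' \<Longrightarrow> jac \<Psi> q \<noteq> 0"
proof -
  define U1 where "U1 = {q \<in> U. jac \<Psi> q \<in> {x. x \<noteq> 0}}"
  have U1: "open U1" "q0 \<in> U1" "U1 \<subseteq> U" and jac: "\<And>q. q \<in> U1 \<Longrightarrow> jac \<Psi> q \<noteq> 0"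
    unfolding U1_def using assms open_smooth_preimage[OF assms(1) smooth_on_jac[OF assms(1,2)] open_nonzero_reals]
    by auto
  define a b c d where "a q = fst (pd_u \<Psi> q)" and "b q = fst (pd_v \<Psi> q)"
    and "c q = snd (pd_u \<Psi> q)" and "d q = snd (pd_v \<Psi> q)" for q
  have jac_eq: "jac \<Psi> q = a q * d q - c q * b q" for q
    by (simp add: jac_def a_def b_def c_def d_def)
  define D where "D q w = fst w *\<^sub>R pd_u \<Psi> q + snd w *\<^sub>R pd_v \<Psi> q" for q w
  define W where "W q w = ((fst w * d q - b q * snd w) / jac \<Psi> q, (a q * snd w - c q * fst w) / jac \<Psi> q)" for q w
  have DW: "D q x = w \<longleftrightarrow> x = W q w" if "q \<in> U1" for q x w
    using cramer_2[of "a q" "d q" "c q" "b q" "fst x" "snd x" "fst w" "snd w"] jac[OF that]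
    unfolding jac_eq D_def W_def by (simp add: a_def b_def c_def d_def)
  \<comment> \<open>The same derivative as \<open>D\<close>, packaged as a bounded linear function
    so that its continuity in \<open>q\<close> can be stated.\<close>
  define f' where "f' q = (blinfun_scaleR_left (pd_u \<Psi> q) o\<^sub>L fst_blinfun) + (blinfun_scaleR_left (pd_v \<Psi> q) o\<^sub>L snd_blinfun)" for q
  have f': "blinfun_apply (f' q) = D q" for q
    by (rule ext) (simp add: f'_def D_def blinfun.add_left)
  have linW: "bounded_linear (W q)" for q
    unfolding W_def by (intro linear_conv_bounded_linear[THEN iffD1] linearI)
      (auto simp: add_divide_distrib diff_divide_distrib algebra_simps)
  obtain U' V \<Phi> g' where I: "open U'" "U' \<subseteq> U1" "q0 \<in> U'" "open V" "\<Psi> q0 \<in> V" "homeomorphism U' V \<Psi> \<Phi>"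
    "\<And>y. y \<in> V \<Longrightarrow> (\<Phi> has_derivative (g' y)) (at y)"
    "\<And>y. y \<in> V \<Longrightarrow> g' y = inv (blinfun_apply (f' (\<Phi> y)))"
  proof (rule inverse_function_theorem[OF U1(1), of \<Psi> f' q0 "Blinfun (W q0)"])
    show "(\<Psi> has_derivative blinfun_apply (f' x)) (at x)" if "x \<in> U1" for x
      using has_derivative_pd[OF smooth_on_differentiable[OF assms(2) subsetD[OF U1(3) that]]]
      unfolding f' D_def .
    show "continuous_on U1 f'"
      unfolding f'_def[abs_def]
      using smooth_on_continuous[OF smooth_on_subset[OF smooth_on_pd(1)[OF assms(1,2)] U1(3)]]
        smooth_on_continuous[OF smooth_on_subset[OF smooth_on_pd(2)[OF assms(1,2)] U1(3)]]
      by (auto intro!: continuous_intros)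
    show "Blinfun (W q0) o\<^sub>L f' q0 = id_blinfun"
      by (rule blinfun_eqI) (simp add: bounded_linear_Blinfun_apply[OF linW] f' DW[OF U1(2), THEN iffD1, OF refl, symmetric])
  qed (use U1 in auto)
  have \<Phi>U: "\<Phi> y \<in> U1" if "y \<in> V" for y
    using I(2,6) that by (auto simp: homeomorphism_def)
  have g': "g' y = W (\<Phi> y)" if "y \<in> V" for y
    unfolding I(8)[OF that] f' by (rule inv_equality)
      (simp_all only: DW[OF \<Phi>U[OF that], THEN iffD1, OF refl, symmetric] DW[OF \<Phi>U[OF that]])
  have smW: "smooth_on U1 (\<lambda>q. W q w)" for w
    unfolding W_def a_def b_def c_def d_def
    by (intro smooth_on_Pair smooth_on_divide smooth_on_diff smooth_on_mult smooth_on_const U1 jac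
        smooth_on_fst smooth_on_snd smooth_on_subset[OF smooth_on_pd(1)[OF assms(1,2)] U1(3)]
        smooth_on_subset[OF smooth_on_pd(2)[OF assms(1,2)] U1(3)]
        smooth_on_subset[OF smooth_on_jac[OF assms(1,2)] U1(3)])
  have "Ck k V \<Phi>" for k
  proof (induction k)
    case 0
    then show ?case using I(6) by (simp add: homeomorphism_def)
  next
    case (Suc k)
    show ?case
    proof (rule Ck_SucI[OF I(4)])
      show "(\<Phi> has_derivative W (\<Phi> y)) (at y)" if "y \<in> V" for y
        using I(7) g' that by metis
      show "Ck k V (\<lambda>y. W (\<Phi> y) w)" for w
        by (rule Ck_compose[OF I(4) U1(1) _ Suc smooth_onD[OF smW]]) (use \<Phi>U in auto)
    qed
  qed
  then have "smooth_on V \<Phi>" by (rule smooth_onI)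
  moreover have "U' \<subseteq> U" "\<And>q. q \<in> U' \<Longrightarrow> jac \<Psi> q \<noteq> 0" using I(2) U1(3) jac by auto
  ultimately show thesis using that[OF I(1) _ I(3-6)] by simp
qed

subsection \<open>Smooth dependence of scalar differential equations on the initial value\<close>

text \<open>The substitution \<open>s = t * \<theta>\<close> writes the integral of \<open>h\<close>
  from 0 to \<open>t\<close> over the fixed interval \<open>{0..1}\<close>. This covers negative
  \<open>t\<close> without oriented integrals and lets theorems on parameter integrals
  apply.\<close>

lemma scaled_integral_has_derivative:
  fixes h :: "real \<Rightarrow> real"
  assumes "continuous_on {-r<..<r} h" "t \<in> {-r<..<r}"
  shows "((\<lambda>t. t * integral {0..1} (\<lambda>\<theta>. h (t * \<theta>))) has_real_derivative h t) (at t)"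
proof -
  have "\<bar>t\<bar> < r" using assms(2) by auto
  then obtain R where R: "\<bar>t\<bar> < R" "R < r" using dense by blast
  define P where "P x = integral {-R..x} h" for x
  have c: "continuous_on {-R..R} h"
    by (rule continuous_on_subset[OF assms(1)]) (use R in auto)
  have P: "(P has_real_derivative h x) (at x)" if "\<bar>x\<bar> < R" for x
  proof -
    have "(P has_real_derivative h x) (at x within {-R..R})"
      unfolding P_def has_real_derivative_iff_has_vector_derivative
      using that by (intro integral_has_vector_derivative[OF c]) auto
    then show ?thesis using that at_within_interior[of x "{-R..R}"] by (simp add: abs_less_iff)
  qed
  have eq: "s * integral {0..1} (\<lambda>\<theta>. h (s * \<theta>)) = P s - P 0" if "\<bar>s\<bar> < R" for s
  proof -
    have "((\<lambda>\<theta>. s * h (s * \<theta>)) has_integral P (s * 1) - P (s * 0)) {0..1}"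
    proof (rule fundamental_theorem_of_calculus)
      fix \<theta> :: real assume \<theta>: "\<theta> \<in> {0..1}"
      have "\<bar>s * \<theta>\<bar> < R"
        using \<theta> that mult_left_le[of \<theta> "\<bar>s\<bar>"] by (simp add: abs_mult)
      have "((\<lambda>\<theta>. P (s * \<theta>)) has_real_derivative h (s * \<theta>) * s) (at \<theta>)"
        using P[OF \<open>\<bar>s * \<theta>\<bar> < R\<close>] DERIV_cmult[OF DERIV_ident, of s \<theta> UNIV]
        by (intro DERIV_chain'[where f = "\<lambda>\<theta>. s * \<theta>" and g = P]) simp_all
      then have "((\<lambda>\<theta>. P (s * \<theta>)) has_real_derivative s * h (s * \<theta>)) (at \<theta>)"
        by (simp only: mult.commute)
      then show "((\<lambda>\<theta>. P (s * \<theta>)) has_vector_derivative s * h (s * \<theta>)) (at \<theta> within {0..1})"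
        using has_field_derivative_at_within has_real_derivative_iff_has_vector_derivative by blast
    qed simp
    then show ?thesis by (simp add: integral_unique flip: integral_mult_right)
  qed
  have "((\<lambda>s. P s - P 0) has_real_derivative h t) (at t)"
    using DERIV_diff[OF P[OF R(1)] DERIV_const[of "P 0"]] by simp
  then show ?thesis
    by (rule has_field_derivative_transform_within_open[where S = "{-R<..<R}"]) (use R eq in auto)
qed

text \<open>The rescaled integral equation of the Picard iteration is solved with the initial value as
  a parameter, so that the solution is jointly continuous at once.\<close>

lemma picard_parametric:
  fixes Q :: "real \<times> real \<Rightarrow> real"
  assumes Q: "continuous_on UNIV Q" "\<And>q. \<bar>Q q\<bar> \<le> M"
    and Lip: "\<And>x y t. \<bar>Q (x, t) - Q (y, t)\<bar> \<le> K * \<bar>x - y\<bar>"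
    and \<delta>: "\<delta> > 0" "\<delta> * K \<le> 1 / 2"
  obtains w where "continuous_on UNIV w" "\<And>c t. \<bar>w (c, t)\<bar> \<le> \<delta> * M"
    "\<And>c t. \<bar>t\<bar> \<le> \<delta> \<Longrightarrow> w (c, t) = t * integral {0..1} (\<lambda>\<theta>. Q (c + w (c, t * \<theta>), t * \<theta>))"
proof -
  \<comment> \<open>Clamping the time lets the integral operator act on bounded continuous functions
    on the whole plane, a complete space, and changes nothing for times up to
    \<open>\<delta>\<close>. The unknown is the displacement from the initial value, since the
    solution itself is unbounded in \<open>c\<close>.\<close>
  define cl where "cl t = max (-\<delta>) (min \<delta> t)" for t :: real
  have cl: "\<bar>cl t\<bar> \<le> \<delta>" "\<bar>t\<bar> \<le> \<delta> \<Longrightarrow> cl t = t" for t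
    using \<delta> by (auto simp: cl_def)
  have K: "K \<ge> 0" using Lip[of 0 0 1] abs_ge_zero[of "Q (0, 0) - Q (1, 0)"] by simp
  have M: "M \<ge> 0" using Q(2)[of 0] by linarith
  define J where "J f p = integral {0..1} (\<lambda>\<theta>. Q (fst p + f (fst p, cl (snd p) * \<theta>), cl (snd p) * \<theta>))"
    for f :: "real \<times> real \<Rightarrow> real" and p
  define T where "T f p = cl (snd p) * J f p" for f :: "real \<times> real \<Rightarrow> real" and p
  have contint: "continuous_on UNIV (\<lambda>x. Q (fst (fst x) + f (fst (fst x), cl (snd (fst x)) * snd x), cl (snd (fst x)) * snd x))"
    if "continuous_on UNIV f" for f :: "real \<times> real \<Rightarrow> real"
    unfolding cl_def
    by (rule continuous_on_compose2[OF Q(1)])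
      (auto intro!: continuous_intros continuous_on_compose2[OF that])
  have contint1: "continuous_on {0..1} (\<lambda>\<theta>. Q (fst p + f (fst p, cl (snd p) * \<theta>), cl (snd p) * \<theta>))"
    if "continuous_on UNIV f" for f :: "real \<times> real \<Rightarrow> real" and p
    using continuous_on_compose2[OF contint[OF that], of "{0..1}" "\<lambda>\<theta>. (p, \<theta>)"]
      continuous_on_Pair[OF continuous_on_const continuous_on_id, of "{0..1}" p] by simp
  have integrable: "(\<lambda>\<theta>. Q (fst p + f (fst p, cl (snd p) * \<theta>), cl (snd p) * \<theta>)) integrable_on {0..1}"
    if "continuous_on UNIV f" for f :: "real \<times> real \<Rightarrow> real" and p
    using contint1[OF that] by (rule integrable_continuous_interval)
  have contJ: "continuous_on UNIV (J f)" if "continuous_on UNIV f" for f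
  proof -
    have "continuous_on UNIV (\<lambda>p. integral (cbox 0 1) (\<lambda>\<theta>. Q (fst p + f (fst p, cl (snd p) * \<theta>), cl (snd p) * \<theta>)))"
      by (rule integral_continuous_on_param)
        (use continuous_on_subset[OF contint[OF that]] in \<open>auto simp: case_prod_beta'\<close>)
    then show ?thesis by (simp add: J_def[abs_def])
  qed
  have contT: "continuous_on UNIV (T f)" if "continuous_on UNIV f" for f
    using contJ[OF that] unfolding T_def[abs_def] cl_def by (auto intro!: continuous_intros)
  have bJ: "\<bar>J f p\<bar> \<le> M" if "continuous_on UNIV f" for f p
    using integral_bound[of 0 1 "\<lambda>\<theta>. Q (fst p + f (fst p, cl (snd p) * \<theta>), cl (snd p) * \<theta>)" M]
      contint1[OF that] Q(2) by (simp add: J_def)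
  have bT: "\<bar>T f p\<bar> \<le> \<delta> * M" if "continuous_on UNIV f" for f p
    using bJ[OF that] cl(1) \<delta> unfolding T_def abs_mult by (intro mult_mono) auto
  have Tb: "T f \<in> bcontfun" if "continuous_on UNIV f" for f
    unfolding bcontfun_def using contT[OF that] bT[OF that] by (auto simp: bounded_iff)
  define TB where "TB f = Bcontfun (T (apply_bcontfun f))" for f
  have TB: "apply_bcontfun (TB f) = T (apply_bcontfun f)" for f
    unfolding TB_def by (rule Bcontfun_inverse[OF Tb]) simp
  have "\<exists>!f. TB f = f"
  \<comment> \<open>The factor \<open>cl (snd p)\<close> in front of the integral is at most
    \<open>\<delta>\<close> in absolute value, so the contraction constant is
    \<open>\<delta> * K\<close>.\<close>
  proof (rule banach_fix_type[of "1 / 2"])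
    show "\<forall>f g. dist (TB f) (TB g) \<le> 1 / 2 * dist f g"
    proof (intro allI dist_bound)
      fix f g :: "(real \<times> real) \<Rightarrow>\<^sub>C real" and p
      let ?I = "\<lambda>f \<theta>. Q (fst p + apply_bcontfun f (fst p, cl (snd p) * \<theta>), cl (snd p) * \<theta>)"
      have "\<bar>?I f \<theta> - ?I g \<theta>\<bar> \<le> K * dist f g" for \<theta>
      proof -
        have "\<bar>?I f \<theta> - ?I g \<theta>\<bar> \<le> K * \<bar>f (fst p, cl (snd p) * \<theta>) - g (fst p, cl (snd p) * \<theta>)\<bar>"
          by (rule order_trans[OF Lip]) simp
        also have "\<dots> \<le> K * dist f g"
          using dist_bounded[of f "(fst p, cl (snd p) * \<theta>)" g] K by (intro mult_left_mono) (auto simp: dist_real_def)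
        finally show ?thesis .
      qed
      then have "\<bar>integral {0..1} (\<lambda>\<theta>. ?I f \<theta> - ?I g \<theta>)\<bar> \<le> K * dist f g * (1 - 0)"
        unfolding real_norm_def[symmetric]
        by (intro integral_bound) (auto intro!: continuous_on_diff contint1)
      then have "\<bar>J f p - J g p\<bar> \<le> K * dist f g"
        unfolding J_def by (subst Henstock_Kurzweil_Integration.integral_diff[symmetric]) (auto intro!: integrable)
      then have "\<bar>cl (snd p)\<bar> * \<bar>J f p - J g p\<bar> \<le> \<delta> * (K * dist f g)"
        using cl(1) \<delta> by (intro mult_mono) auto
      also have "\<dots> = (\<delta> * K) * dist f g" by simp
      also have "\<dots> \<le> 1 / 2 * dist f g" using \<delta> by (intro mult_right_mono) auto
      finally show "dist (apply_bcontfun (TB f) p) (apply_bcontfun (TB g) p) \<le> 1 / 2 * dist f g"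
        by (simp add: TB T_def dist_real_def abs_mult[symmetric] right_diff_distrib)
    qed
  qed auto
  then obtain f where "TB f = f" by blast
  then have f: "T (apply_bcontfun f) = apply_bcontfun f" using TB by metis
  show thesis
  proof (rule that[of "apply_bcontfun f"])
    show "\<bar>f (c, t)\<bar> \<le> \<delta> * M" for c t
      using bT[of "apply_bcontfun f" "(c, t)"] f by simp
    show "f (c, t) = t * integral {0..1} (\<lambda>\<theta>. Q (c + f (c, t * \<theta>), t * \<theta>))" if "\<bar>t\<bar> \<le> \<delta>" for c t
      using fun_cong[OF f, of "(c, t)"] cl(2)[OF that] by (simp add: T_def J_def)
  qed simp
qed

text \<open>Differentiation in the second variable brings down a factor \<open>\<theta>\<close>; the
  weight \<open>\<theta> ^ m\<close> with arbitrary \<open>m\<close> makes the induction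
  close.\<close>

lemma Ck_integral_scaled:
  fixes g :: "real \<times> real \<Rightarrow> real"
  assumes "Ck k ({-\<rho><..<\<rho>} \<times> {-\<delta><..<\<delta>}) g"
  shows "Ck k ({-\<rho><..<\<rho>} \<times> {-\<delta><..<\<delta>}) (\<lambda>p. integral {0..1} (\<lambda>\<theta>. \<theta> ^ m * g (fst p, snd p * \<theta>)))"
  using assms
proof (induction k arbitrary: m g)
  let ?I = "{-\<rho><..<\<rho>}" and ?J = "{-\<delta><..<\<delta>}"
  have scale: "t * \<theta> \<in> ?J" if "t \<in> ?J" "\<theta> \<in> {0..1}" for t \<theta>
    using that mult_left_le[of \<theta> "\<bar>t\<bar>"] abs_mult[of t \<theta>] by auto
  have cont: "continuous_on ((?I \<times> ?J) \<times> {0..1}) (\<lambda>x. snd x ^ m * g (fst (fst x), snd (fst x) * snd x))"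
    if "continuous_on (?I \<times> ?J) g" for m and g :: "real \<times> real \<Rightarrow> real"
    by (intro continuous_intros continuous_on_compose2[OF that]) (use scale in force)
  {
    case 0
    have "continuous_on (?I \<times> ?J) (\<lambda>p. integral (cbox 0 1) (\<lambda>\<theta>. \<theta> ^ m * g (fst p, snd p * \<theta>)))"
      by (rule integral_continuous_on_param) (use cont 0 in \<open>simp add: case_prod_beta'\<close>)
    then show ?case by simp
  next
    case (Suc k)
    have o: "open (?I \<times> ?J)" by (simp add: open_Times)
    have diff: "g differentiable (at p)" if "p \<in> ?I \<times> ?J" for p
      using Suc.prems that unfolding differentiable_times_on.simps by blast
    have cg: "continuous_on (?I \<times> ?J) g" "continuous_on (?I \<times> ?J) (pd_u g)" "continuous_on (?I \<times> ?J) (pd_v g)"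
      using Suc.prems Ck_pd[OF o Suc.prems] Ck_imp_continuous by blast+
    have integrable: "(\<lambda>\<theta>. \<theta> ^ m * g (u, v * \<theta>)) integrable_on cbox 0 1" if "(u, v) \<in> ?I \<times> ?J" for u v
      unfolding cbox_interval using that scale
      by (intro integrable_continuous_interval continuous_intros continuous_on_compose2[OF cg(1)]) auto
    show ?case
    proof (rule Ck_partialsI[OF o])
      show "Ck k (?I \<times> ?J) (\<lambda>p. integral {0..1} (\<lambda>\<theta>. \<theta> ^ m * pd_u g (fst p, snd p * \<theta>)))"
        "Ck k (?I \<times> ?J) (\<lambda>p. integral {0..1} (\<lambda>\<theta>. \<theta> ^ Suc m * pd_v g (fst p, snd p * \<theta>)))"
        by (intro Suc.IH Ck_pd[OF o Suc.prems])+
      fix u v assume uv: "(u, v) \<in> ?I \<times> ?J"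
      have "((\<lambda>u. integral (cbox 0 1) (\<lambda>\<theta>. \<theta> ^ m * g (u, v * \<theta>))) has_real_derivative
          integral (cbox 0 1) (\<lambda>\<theta>. \<theta> ^ m * pd_u g (u, v * \<theta>))) (at u within ?I)"
      proof (rule leibniz_rule_field_derivative)
        show "((\<lambda>u. \<theta> ^ m * g (u, v * \<theta>)) has_real_derivative \<theta> ^ m * pd_u g (x, v * \<theta>)) (at x within ?I)"
          if "x \<in> ?I" "\<theta> \<in> cbox 0 1" for x \<theta>
        proof -
          have "(x, v * \<theta>) \<in> ?I \<times> ?J" using that uv scale by auto
          from has_vector_derivative_pd(1)[OF diff[OF this]]
          have "((\<lambda>u. g (u, v * \<theta>)) has_real_derivative pd_u g (x, v * \<theta>)) (at x)"
            by (simp add: has_real_derivative_iff_has_vector_derivative)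
          from DERIV_cmult[OF this, of "\<theta> ^ m"] show ?thesis
            by (rule has_field_derivative_at_within)
        qed
        show "continuous_on (?I \<times> cbox 0 1) (\<lambda>(u, \<theta>). \<theta> ^ m * pd_u g (u, v * \<theta>))"
          unfolding case_prod_beta' using uv scale
          by (intro continuous_intros continuous_on_compose2[OF cg(2)]) auto
      qed (use uv integrable in auto)
      then show "((\<lambda>t. integral {0..1} (\<lambda>\<theta>. \<theta> ^ m * g (fst (t, v), snd (t, v) * \<theta>))) has_vector_derivative
          integral {0..1} (\<lambda>\<theta>. \<theta> ^ m * pd_u g (fst (u, v), snd (u, v) * \<theta>))) (at u)"
        using uv at_within_open[OF _ open_greaterThanLessThan[of "-\<rho>" \<rho>], of u]
          at_within_open[OF _ open_greaterThanLessThan[of "-\<delta>" \<delta>], of v]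
        by (simp add: has_real_derivative_iff_has_vector_derivative)
      have "((\<lambda>v. integral (cbox 0 1) (\<lambda>\<theta>. \<theta> ^ m * g (u, v * \<theta>))) has_real_derivative
          integral (cbox 0 1) (\<lambda>\<theta>. \<theta> ^ Suc m * pd_v g (u, v * \<theta>))) (at v within ?J)"
      proof (rule leibniz_rule_field_derivative)
        show "((\<lambda>v. \<theta> ^ m * g (u, v * \<theta>)) has_real_derivative \<theta> ^ Suc m * pd_v g (u, x * \<theta>)) (at x within ?J)"
          if "x \<in> ?J" "\<theta> \<in> cbox 0 1" for x \<theta>
        proof -
          have "(u, x * \<theta>) \<in> ?I \<times> ?J" using that uv scale by auto
          from has_vector_derivative_pd(2)[OF diff[OF this]]
          have "((\<lambda>s. g (u, s)) has_real_derivative pd_v g (u, x * \<theta>)) (at (x * \<theta>))"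
            by (simp add: has_real_derivative_iff_has_vector_derivative)
          then have "((\<lambda>v. g (u, v * \<theta>)) has_real_derivative pd_v g (u, x * \<theta>) * \<theta>) (at x)"
            using DERIV_cmult_right[OF DERIV_ident, of \<theta> x UNIV]
            by (intro DERIV_chain'[where f = "\<lambda>v. v * \<theta>" and g = "\<lambda>s. g (u, s)"]) simp_all
          from DERIV_cmult[OF this, of "\<theta> ^ m"]
          have "((\<lambda>v. \<theta> ^ m * g (u, v * \<theta>)) has_real_derivative \<theta> ^ Suc m * pd_v g (u, x * \<theta>)) (at x)"
            by (simp add: mult_ac)
          then show ?thesis by (rule has_field_derivative_at_within)
        qed
        show "continuous_on (?J \<times> cbox 0 1) (\<lambda>(v, \<theta>). \<theta> ^ Suc m * pd_v g (u, v * \<theta>))"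
          unfolding case_prod_beta' using uv scale
          by (intro continuous_intros continuous_on_compose2[OF cg(3)]) auto
      qed (use uv integrable in auto)
      then show "((\<lambda>s. integral {0..1} (\<lambda>\<theta>. \<theta> ^ m * g (fst (u, s), snd (u, s) * \<theta>))) has_vector_derivative
          integral {0..1} (\<lambda>\<theta>. \<theta> ^ Suc m * pd_v g (fst (u, v), snd (u, v) * \<theta>))) (at v)"
        using uv at_within_open[OF _ open_greaterThanLessThan[of "-\<rho>" \<rho>], of u]
          at_within_open[OF _ open_greaterThanLessThan[of "-\<delta>" \<delta>], of v]
        by (simp add: has_real_derivative_iff_has_vector_derivative)
    qed
  }
qed

text \<open>Differentiability of the flow in the initial value: the difference of two solutions solves a
  linear equation whose coefficient is the mean value of \<open>q\<^sub>s\<close> between them, so the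
  difference quotient is an exponential depending continuously on the second solution.\<close>

lemma flow_has_derivative_initial:
  fixes q \<sigma> :: "real \<times> real \<Rightarrow> real"
  assumes W: "open W" "smooth_on W q" and RW: "{-R<..<R} \<times> {-\<delta><..<\<delta>} \<subseteq> W"
    and cont: "continuous_on ({-\<rho><..<\<rho>} \<times> {-\<delta><..<\<delta>}) \<sigma>"
    and range: "\<And>c t. c \<in> {-\<rho><..<\<rho>} \<Longrightarrow> t \<in> {-\<delta><..<\<delta>} \<Longrightarrow> \<sigma> (c, t) \<in> {-R<..<R}"
    and init: "\<And>c. \<sigma> (c, 0) = c"
    and ode: "\<And>c t. c \<in> {-\<rho><..<\<rho>} \<Longrightarrow> t \<in> {-\<delta><..<\<delta>} \<Longrightarrow>
      ((\<lambda>t. \<sigma> (c, t)) has_real_derivative q (\<sigma> (c, t), t)) (at t)"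
    and ct: "c \<in> {-\<rho><..<\<rho>}" "t \<in> {-\<delta><..<\<delta>}"
  shows "((\<lambda>c. \<sigma> (c, t)) has_real_derivative
    exp (t * integral {0..1} (\<lambda>\<theta>. pd_u q (\<sigma> (c, t * \<theta>), t * \<theta>)))) (at c)"
proof -
  let ?I = "{-\<rho><..<\<rho>}" and ?J = "{-\<delta><..<\<delta>}" and ?K = "{-R<..<R}"
  have cq: "continuous_on (?K \<times> ?J) (pd_u q)"
    using smooth_on_continuous[OF smooth_on_pd(1)[OF W]] RW by (rule continuous_on_subset)
  have scale: "t * \<theta> \<in> ?J" if "t \<in> ?J" "\<theta> \<in> {0..1}" for t \<theta>
    using that mult_left_le[of \<theta> "\<bar>t\<bar>"] abs_mult[of t \<theta>] by auto
  have seg: "x + l * (y - x) \<in> ?K" if "x \<in> ?K" "y \<in> ?K" "l \<in> {0..1}" for x y l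
  proof -
    have "(1 - l) *\<^sub>R x + l *\<^sub>R y \<in> ?K"
      using that by (intro convexD) auto
    then show ?thesis by (simp add: algebra_simps)
  qed
  \<comment> \<open>Hadamard's quotient: the mean of \<open>pd_u q\<close> over the segment between
    two states at the same time. Unlike the difference quotient of \<open>q\<close> it is continuous
    also where the two states coincide, and there it equals \<open>pd_u q\<close>.\<close>
  define b where "b z = integral {0..1} (\<lambda>l. pd_u q (fst z + l * (fst (snd z) - fst z), snd (snd z)))"
    for z :: "real \<times> real \<times> real"
  have contb: "continuous_on (?K \<times> ?K \<times> ?J) b"
  proof -
    have "continuous_on (?K \<times> ?K \<times> ?J) (\<lambda>z. integral (cbox 0 1)
        (\<lambda>l. pd_u q (fst z + l * (fst (snd z) - fst z), snd (snd z))))"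
    proof (rule integral_continuous_on_param)
      have "(fst (fst x) + snd x * (fst (snd (fst x)) - fst (fst x)), snd (snd (fst x))) \<in> ?K \<times> ?J"
        if "x \<in> (?K \<times> ?K \<times> ?J) \<times> {0..1}" for x
        using that seg by (auto simp del: greaterThanLessThan_iff)
      then show "continuous_on ((?K \<times> ?K \<times> ?J) \<times> cbox 0 1)
          (\<lambda>(z, l). pd_u q (fst z + l * (fst (snd z) - fst z), snd (snd z)))"
        unfolding case_prod_beta' cbox_interval
        by (intro continuous_on_compose2[OF cq] continuous_intros) auto
    qed
    then show ?thesis by (simp add: b_def[abs_def])
  qed
  have qb: "q (y, s) - q (x, s) = (y - x) * b (x, y, s)" if "x \<in> ?K" "y \<in> ?K" "s \<in> ?J" for x y s
  proof -
    have "((\<lambda>l. (y - x) * pd_u q (x + l * (y - x), s)) has_integral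
        q (x + 1 * (y - x), s) - q (x + 0 * (y - x), s)) {0..1}"
    proof (rule fundamental_theorem_of_calculus)
      fix l :: real assume "l \<in> {0..1}"
      then have "(x + l * (y - x), s) \<in> W" using seg[OF that(1,2)] that(3) RW by blast
      from smooth_on_has_pd(1)[OF W(2) this, of UNIV]
      have "((\<lambda>x. q (x, s)) has_real_derivative pd_u q (x + l * (y - x), s)) (at (x + l * (y - x)))"
        by (simp add: has_real_derivative_iff_has_vector_derivative)
      moreover have "((\<lambda>l. x + l * (y - x)) has_real_derivative y - x) (at l)"
        by (auto intro!: derivative_eq_intros)
      ultimately have "((\<lambda>l. q (x + l * (y - x), s)) has_real_derivative
          pd_u q (x + l * (y - x), s) * (y - x)) (at l)"
        by (intro DERIV_chain'[where f = "\<lambda>l. x + l * (y - x)" and g = "\<lambda>x. q (x, s)"])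
      then have "((\<lambda>l. q (x + l * (y - x), s)) has_real_derivative
          (y - x) * pd_u q (x + l * (y - x), s)) (at l)"
        by (simp only: mult.commute)
      then show "((\<lambda>l. q (x + l * (y - x), s)) has_vector_derivative
          (y - x) * pd_u q (x + l * (y - x), s)) (at l within {0..1})"
        using has_field_derivative_at_within has_real_derivative_iff_has_vector_derivative by blast
    qed simp
    then show ?thesis by (simp add: b_def integral_unique flip: integral_mult_right)
  qed
  define B where "B c' s = s * integral {0..1} (\<lambda>\<theta>. b (\<sigma> (c, s * \<theta>), \<sigma> (c', s * \<theta>), s * \<theta>))" for c' s
  have cont\<sigma>: "continuous_on ?J (\<lambda>s. \<sigma> (c', s))" if "c' \<in> ?I" for c'
    by (rule continuous_on_compose2[OF cont]) (use that in \<open>auto intro!: continuous_intros\<close>)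
  have B: "(B c' has_real_derivative b (\<sigma> (c, s), \<sigma> (c', s), s)) (at s)" if "c' \<in> ?I" "s \<in> ?J" for c' s
    unfolding B_def
  proof (rule scaled_integral_has_derivative[OF _ that(2)])
    show "continuous_on ?J (\<lambda>s. b (\<sigma> (c, s), \<sigma> (c', s), s))"
      using range that ct
      by (intro continuous_on_compose2[OF contb] continuous_on_Pair cont\<sigma> continuous_on_id)
        (auto simp del: greaterThanLessThan_iff)
  qed
  have diff: "\<sigma> (c', t) - \<sigma> (c, t) = (c' - c) * exp (B c' t)" if c': "c' \<in> ?I" for c'
  proof -
    \<comment> \<open>The difference of the two solutions solves a linear equation with coefficient
      the derivative of \<open>B c'\<close>; multiplying by the integrating factor makes it constant
      in time.\<close>
    define D where "D s = (\<sigma> (c', s) - \<sigma> (c, s)) * exp (- B c' s)" for s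
    have "\<exists>k. \<forall>s\<in>?J. D s = k"
    proof (rule has_field_derivative_zero_constant)
      fix s assume s: "s \<in> ?J"
      have e: "q (\<sigma> (c', s), s) - q (\<sigma> (c, s), s) = (\<sigma> (c', s) - \<sigma> (c, s)) * b (\<sigma> (c, s), \<sigma> (c', s), s)"
        using qb range[OF ct(1) s] range[OF c' s] s by blast
      have "(D has_real_derivative (q (\<sigma> (c', s), s) - q (\<sigma> (c, s), s)) * exp (- B c' s) +
          exp (- B c' s) * (- b (\<sigma> (c, s), \<sigma> (c', s), s)) * (\<sigma> (c', s) - \<sigma> (c, s))) (at s)"
        unfolding D_def
        by (intro DERIV_mult DERIV_diff ode[OF c' s] ode[OF ct(1) s]
            DERIV_chain2[OF DERIV_exp] DERIV_minus B[OF c' s])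
      then have "(D has_real_derivative 0) (at s)"
        unfolding e by (simp add: algebra_simps)
      then show "(D has_real_derivative 0) (at s within ?J)" by (rule has_field_derivative_at_within)
    qed simp
    then have "D t = D 0" using ct by force
    moreover have "B c' 0 = 0" by (simp add: B_def)
    ultimately show ?thesis by (simp add: D_def init exp_minus field_simps)
  qed
  have contB: "continuous_on ?I (\<lambda>c'. B c' t)"
  proof -
    have "continuous_on ?I (\<lambda>c'. integral (cbox 0 1) (\<lambda>\<theta>. b (\<sigma> (c, t * \<theta>), \<sigma> (c', t * \<theta>), t * \<theta>)))"
    proof (rule integral_continuous_on_param)
      have m: "(c, t * snd x) \<in> ?I \<times> ?J" "(fst x, t * snd x) \<in> ?I \<times> ?J" "t * snd x \<in> ?J"
        if "x \<in> ?I \<times> {0..1}" for x :: "real \<times> real"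
        using that ct scale[OF ct(2), of "snd x"] by auto
      show "continuous_on (?I \<times> cbox 0 1) (\<lambda>(c', \<theta>). b (\<sigma> (c, t * \<theta>), \<sigma> (c', t * \<theta>), t * \<theta>))"
        unfolding case_prod_beta' cbox_interval
      proof (rule continuous_on_compose2[OF contb])
        show "continuous_on (?I \<times> {0..1}) (\<lambda>x. (\<sigma> (c, t * snd x), \<sigma> (fst x, t * snd x), t * snd x))"
          using m by (intro continuous_on_Pair continuous_on_compose2[OF cont] continuous_intros)
            (simp_all add: image_subset_iff del: greaterThanLessThan_iff mem_Sigma_iff)
        show "(\<lambda>x. (\<sigma> (c, t * snd x), \<sigma> (fst x, t * snd x), t * snd x)) ` (?I \<times> {0..1}) \<subseteq> ?K \<times> ?K \<times> ?J"
          using m range by (force simp del: greaterThanLessThan_iff)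
      qed
    qed
    then show ?thesis unfolding B_def by (intro continuous_intros) (simp add: cbox_interval)
  qed
  have "b (\<sigma> (c, t * \<theta>), \<sigma> (c, t * \<theta>), t * \<theta>) = pd_u q (\<sigma> (c, t * \<theta>), t * \<theta>)" for \<theta>
    by (simp add: b_def)
  then have Bc: "B c t = t * integral {0..1} (\<lambda>\<theta>. pd_u q (\<sigma> (c, t * \<theta>), t * \<theta>))"
    by (simp add: B_def)
  have "isCont (\<lambda>c'. B c' t) c"
    using contB ct by (simp add: continuous_on_eq_continuous_at)
  then have "isCont (\<lambda>c'. exp (B c' t)) c" by (rule continuous_exp)
  then have "((\<lambda>c'. exp (B c' t)) \<longlongrightarrow> exp (B c t)) (at c)"
    by (simp add: isCont_def)
  then have "((\<lambda>c'. (\<sigma> (c', t) - \<sigma> (c, t)) / (c' - c)) \<longlongrightarrow> exp (B c t)) (at c)"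
  proof (rule Lim_transform_within_open)
    show "open ?I" "c \<in> ?I" using ct by auto
    show "exp (B c' t) = (\<sigma> (c', t) - \<sigma> (c, t)) / (c' - c)" if "c' \<in> ?I" "c' \<noteq> c" for c'
      using diff[OF that(1)] that(2) by simp
  qed
  then show ?thesis by (simp add: has_field_derivative_iff Bc)
qed

text \<open>Bootstrapping: the time derivative is \<open>q\<close> evaluated along
  \<open>\<sigma>\<close>, and the derivative in the initial value is an exponential of an integral
  along \<open>\<sigma>\<close>. Both are \<open>C^k\<close> as soon as \<open>\<sigma>\<close> is,
  which makes \<open>\<sigma>\<close> of class \<open>C^(k+1)\<close>.\<close>

lemma flow_smooth:
  fixes q \<sigma> :: "real \<times> real \<Rightarrow> real"
  assumes W: "open W" "smooth_on W q" and RW: "{-R<..<R} \<times> {-\<delta><..<\<delta>} \<subseteq> W"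
    and cont: "continuous_on ({-\<rho><..<\<rho>} \<times> {-\<delta><..<\<delta>}) \<sigma>"
    and range: "\<And>c t. c \<in> {-\<rho><..<\<rho>} \<Longrightarrow> t \<in> {-\<delta><..<\<delta>} \<Longrightarrow> \<sigma> (c, t) \<in> {-R<..<R}"
    and init: "\<And>c. \<sigma> (c, 0) = c"
    and ode: "\<And>c t. c \<in> {-\<rho><..<\<rho>} \<Longrightarrow> t \<in> {-\<delta><..<\<delta>} \<Longrightarrow>
      ((\<lambda>t. \<sigma> (c, t)) has_real_derivative q (\<sigma> (c, t), t)) (at t)"
  shows "smooth_on ({-\<rho><..<\<rho>} \<times> {-\<delta><..<\<delta>}) \<sigma>"
proof (rule smooth_onI)
  let ?B = "{-\<rho><..<\<rho>} \<times> {-\<delta><..<\<delta>}"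
  have o: "open ?B" by (simp add: open_Times)
  show "Ck k ?B \<sigma>" for k
  proof (induction k)
    case 0
    then show ?case using cont by simp
  next
    case (Suc k)
    have P: "Ck k ?B (\<lambda>p. (\<sigma> p, snd p))"
      by (intro Ck_Pair o Suc Ck_bounded_linear[OF bounded_linear_snd] Ck_id)
    have PW: "(\<lambda>p. (\<sigma> p, snd p)) ` ?B \<subseteq> W"
      using RW range by (force simp del: greaterThanLessThan_iff)
    have 1: "Ck k ?B (\<lambda>p. q (\<sigma> p, snd p))"
      by (rule Ck_compose[OF o W(1) PW P smooth_onD[OF W(2)]])
    have "Ck k ?B (\<lambda>p. pd_u q (\<sigma> p, snd p))"
      by (rule Ck_compose[OF o W(1) PW P smooth_onD[OF smooth_on_pd(1)[OF W]]])
    from Ck_integral_scaled[OF this, of 0]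
    have "Ck k ?B (\<lambda>p. snd p * integral {0..1} (\<lambda>\<theta>. pd_u q (\<sigma> (fst p, snd p * \<theta>), snd p * \<theta>)))"
      by (intro Ck_bilinear[OF bounded_bilinear_mult o] Ck_bounded_linear[OF bounded_linear_snd o] Ck_id) simp
    from Ck_compose[OF o open_UNIV _ this smooth_onD[OF smooth_on_real_exp]]
    have 2: "Ck k ?B (\<lambda>p. exp (snd p * integral {0..1} (\<lambda>\<theta>. pd_u q (\<sigma> (fst p, snd p * \<theta>), snd p * \<theta>))))"
      by simp
    show ?case
    proof (rule Ck_partialsI[OF o _ _ 2 1])
      fix c t assume "(c, t) \<in> ?B"
      then have ct: "c \<in> {-\<rho><..<\<rho>}" "t \<in> {-\<delta><..<\<delta>}" by auto
      show "((\<lambda>c. \<sigma> (c, t)) has_vector_derivative exp (snd (c, t) * integral {0..1}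
          (\<lambda>\<theta>. pd_u q (\<sigma> (fst (c, t), snd (c, t) * \<theta>), snd (c, t) * \<theta>)))) (at c)"
        using flow_has_derivative_initial[OF assms ct]
        by (simp add: has_real_derivative_iff_has_vector_derivative)
      show "((\<lambda>t. \<sigma> (c, t)) has_vector_derivative q (\<sigma> (c, t), snd (c, t))) (at t)"
        using ode[OF ct] by (simp add: has_real_derivative_iff_has_vector_derivative)
    qed
  qed
qed

text \<open>The fixed point argument wants a globally bounded and Lipschitz right-hand side. It is
  applied to an extension of \<open>q\<close> from a small square, and over short times the
  solutions stay in the region where the extension agrees with \<open>q\<close>.\<close>

proposition smooth_flow:
  fixes q :: "real \<times> real \<Rightarrow> real"
  assumes W: "open W" "0 \<in> W" "smooth_on W q"
  obtains \<delta> \<sigma> where "\<delta> > 0" "smooth_on ({-\<delta><..<\<delta>} \<times> {-\<delta><..<\<delta>}) \<sigma>"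
    "\<And>c t. c \<in> {-\<delta><..<\<delta>} \<Longrightarrow> t \<in> {-\<delta><..<\<delta>} \<Longrightarrow> (\<sigma> (c, t), t) \<in> W"
    "\<And>c. \<sigma> (c, 0) = c"
    "\<And>c t. c \<in> {-\<delta><..<\<delta>} \<Longrightarrow> t \<in> {-\<delta><..<\<delta>} \<Longrightarrow>
      ((\<lambda>t. \<sigma> (c, t)) has_real_derivative q (\<sigma> (c, t), t)) (at t)"
    "\<And>c t. c \<in> {-\<delta><..<\<delta>} \<Longrightarrow> t \<in> {-\<delta><..<\<delta>} \<Longrightarrow> pd_u \<sigma> (c, t) > 0"
proof -
  obtain A B where AB: "open A" "open B" "0 \<in> A" "0 \<in> B" "A \<times> B \<subseteq> W"
    using open_prod_elim[OF W(1,2)] by (metis mem_Sigma_iff zero_prod_def)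
  obtain r1 r2 where r12: "r1 > 0" "cball 0 r1 \<subseteq> A" "r2 > 0" "cball 0 r2 \<subseteq> B"
    using AB open_contains_cball by metis
  define R where "R = min r1 r2"
  have R: "R > 0" using r12 by (simp add: R_def)
  let ?C = "{-R..R} \<times> {-R..R}"
  have CW: "?C \<subseteq> W"
  proof
    fix p assume "p \<in> ?C"
    then have "fst p \<in> cball 0 r1" "snd p \<in> cball 0 r2" by (auto simp: R_def dist_real_def)
    then have "(fst p, snd p) \<in> A \<times> B" using r12 by blast
    then show "p \<in> W" using AB by auto
  qed
  have comp: "compact ?C" by (intro compact_Times compact_Icc)
  have bound: "\<exists>M. \<forall>p\<in>?C. \<bar>f p\<bar> \<le> M" if "smooth_on W f" for f :: "real \<times> real \<Rightarrow> real"
  proof -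
    have "bounded (f ` ?C)"
      using continuous_on_subset[OF smooth_on_continuous[OF that] CW] comp
      by (intro compact_imp_bounded compact_continuous_image)
    then show ?thesis by (auto simp: bounded_iff)
  qed
  obtain M where M: "\<And>p. p \<in> ?C \<Longrightarrow> \<bar>q p\<bar> \<le> M" using bound[OF W(3)] by blast
  obtain K where K: "\<And>p. p \<in> ?C \<Longrightarrow> \<bar>pd_u q p\<bar> \<le> K" using bound[OF smooth_on_pd(1)[OF W(1,3)]] by blast
  have z: "(0, 0) \<in> ?C" using R by auto
  have MK: "M \<ge> 0" "K \<ge> 0" using M[OF z] K[OF z] by linarith+
  \<comment> \<open>Clamping to the square is 1-Lipschitz, so the composed function \<open>Q\<close>
    inherits the bound \<open>M\<close> and the Lipschitz constant \<open>K\<close> on the whole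
    plane.\<close>
  define cl where "cl x = max (-R) (min R x)" for x :: real
  have cl: "cl x \<in> {-R..R}" "\<bar>x\<bar> \<le> R \<Longrightarrow> cl x = x" "\<bar>cl x - cl y\<bar> \<le> \<bar>x - y\<bar>" for x y
    using R by (auto simp: cl_def)
  define Q where "Q p = q (cl (fst p), cl (snd p))" for p
  \<comment> \<open>The first bound keeps initial values within \<open>R / 2\<close>, the second
    makes the iteration a contraction, the third limits the displacement to \<open>R / 4\<close>;
    together the solution stays inside the square. Adding 1 to \<open>K\<close> and \<open>M\<close>
    avoids division by zero.\<close>
  define \<delta> where "\<delta> = min (R / 2) (min (1 / (2 * (K + 1))) (R / (2 * (M + 1)) / 2))"
  have d1: "1 / (2 * (K + 1)) * K \<le> 1 / 2" "R / (2 * (M + 1)) / 2 * M \<le> R / 4"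
    using MK R by (auto simp: field_simps)
  have \<delta>: "\<delta> > 0" using R MK by (simp add: \<delta>_def)
  have \<delta>R: "\<delta> \<le> R / 2" unfolding \<delta>_def by (rule min.cobounded1)
  have "\<delta> \<le> 1 / (2 * (K + 1))" "\<delta> \<le> R / (2 * (M + 1)) / 2"
    unfolding \<delta>_def by (meson min.cobounded1 min.cobounded2 order_trans)+
  then have "\<delta> * K \<le> 1 / (2 * (K + 1)) * K" "\<delta> * M \<le> R / (2 * (M + 1)) / 2 * M"
    using MK by (intro mult_right_mono; simp)+
  then have \<delta>': "\<delta> * K \<le> 1 / 2" "\<delta> * M \<le> R / 4" using d1 by linarith+
  have Qc: "continuous_on UNIV Q"
    unfolding Q_def[abs_def]
  proof (rule continuous_on_compose2[OF continuous_on_subset[OF smooth_on_continuous[OF W(3)] CW]])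
    show "continuous_on UNIV (\<lambda>x. (cl (fst x), cl (snd x)))"
      unfolding cl_def by (intro continuous_intros)
  qed (use cl in auto)
  have Qb: "\<bar>Q p\<bar> \<le> M" for p unfolding Q_def by (intro M) (use cl(1) in auto)
  have QL: "\<bar>Q (x, t) - Q (y, t)\<bar> \<le> K * \<bar>x - y\<bar>" for x y t
  proof -
    have "norm (q (cl x, cl t) - q (cl y, cl t)) \<le> K * norm (cl x - cl y)"
    proof (rule field_differentiable_bound[where S = "{-R..R}" and f' = "\<lambda>x. pd_u q (x, cl t)"])
      show "((\<lambda>x. q (x, cl t)) has_real_derivative pd_u q (s, cl t)) (at s within {-R..R})"
        if "s \<in> {-R..R}" for s
        unfolding has_real_derivative_iff_has_vector_derivative
        using that cl(1)[of t] CW by (intro smooth_on_has_pd[OF W(3)]) blast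
      show "norm (pd_u q (s, cl t)) \<le> K" if "s \<in> {-R..R}" for s
        using K[of "(s, cl t)"] that cl(1)[of t] by simp
    qed (use cl(1) in auto)
    also have "\<dots> \<le> K * \<bar>x - y\<bar>" using cl(3) MK by (auto intro: mult_left_mono)
    finally show ?thesis by (simp add: Q_def)
  qed
  obtain w where w: "continuous_on UNIV w" "\<And>c t. \<bar>w (c, t)\<bar> \<le> \<delta> * M"
    "\<And>c t. \<bar>t\<bar> \<le> \<delta> \<Longrightarrow> w (c, t) = t * integral {0..1} (\<lambda>\<theta>. Q (c + w (c, t * \<theta>), t * \<theta>))"
    using picard_parametric[OF Qc Qb QL \<delta> \<delta>'(1)] by blast
  define \<sigma> where "\<sigma> p = fst p + w p" for p
  have range: "\<bar>\<sigma> (c, t)\<bar> < R" if "c \<in> {-\<delta><..<\<delta>}" for c t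
    using w(2)[of c t] that \<delta> \<delta>R \<delta>' R by (auto simp: \<sigma>_def)
  have init: "\<sigma> (c, 0) = c" for c using w(3)[of 0 c] \<delta> by (simp add: \<sigma>_def)
  have ode: "((\<lambda>t. \<sigma> (c, t)) has_real_derivative q (\<sigma> (c, t), t)) (at t)"
    if "c \<in> {-\<delta><..<\<delta>}" "t \<in> {-\<delta><..<\<delta>}" for c t
  proof -
    have "((\<lambda>t. t * integral {0..1} (\<lambda>\<theta>. Q (c + w (c, t * \<theta>), t * \<theta>))) has_real_derivative
        Q (c + w (c, t), t)) (at t)"
    proof (rule scaled_integral_has_derivative[where h = "\<lambda>t. Q (c + w (c, t), t)"])
      show "continuous_on {-\<delta><..<\<delta>} (\<lambda>t. Q (c + w (c, t), t))"
        by (intro continuous_on_compose2[OF Qc] continuous_intros continuous_on_compose2[OF w(1)]) auto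
    qed (use that in auto)
    then have "((\<lambda>t. w (c, t)) has_real_derivative Q (c + w (c, t), t)) (at t)"
      by (rule has_field_derivative_transform_within_open[OF _ open_greaterThanLessThan[of "-\<delta>" \<delta>]])
        (use that w(3) in auto)
    from DERIV_add[OF DERIV_const[of c] this]
    have "((\<lambda>t. \<sigma> (c, t)) has_real_derivative Q (\<sigma> (c, t), t)) (at t)"
      by (simp add: \<sigma>_def)
    moreover have "\<bar>t\<bar> \<le> R" using that \<delta> \<delta>R by auto
    moreover have "\<bar>\<sigma> (c, t)\<bar> \<le> R" using range[OF that(1), of t] by simp
    ultimately show ?thesis by (simp add: Q_def cl(2))
  qed
  have RW: "{-R<..<R} \<times> {-\<delta><..<\<delta>} \<subseteq> W"
    by (rule subset_trans[OF _ CW]) (use \<delta> \<delta>R in auto)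
  have cont: "continuous_on ({-\<delta><..<\<delta>} \<times> {-\<delta><..<\<delta>}) \<sigma>"
    unfolding \<sigma>_def using continuous_on_subset[OF w(1)] by (auto intro!: continuous_intros)
  have range': "\<sigma> (c, t) \<in> {-R<..<R}" if "c \<in> {-\<delta><..<\<delta>}" for c t
    using range[OF that, of t] by auto
  have sm: "smooth_on ({-\<delta><..<\<delta>} \<times> {-\<delta><..<\<delta>}) \<sigma>"
    by (rule flow_smooth[OF W(1,3) RW cont range' init ode])
  show thesis
  proof (rule that[OF \<delta> sm _ init ode])
    fix c t assume ct: "c \<in> {-\<delta><..<\<delta>}" "t \<in> {-\<delta><..<\<delta>}"
    show "(\<sigma> (c, t), t) \<in> W" using range'[OF ct(1)] ct RW by blast
    \<comment> \<open>Uniqueness of derivatives identifies \<open>pd_u \<sigma>\<close> with an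
      exponential, which is positive.\<close>
    have "((\<lambda>c. \<sigma> (c, t)) has_real_derivative pd_u \<sigma> (c, t)) (at c)"
      using smooth_on_has_pd(1)[OF sm, of c t UNIV] ct
      by (simp add: has_real_derivative_iff_has_vector_derivative)
    from DERIV_unique[OF this flow_has_derivative_initial[OF W(1,3) RW cont range' init ode ct]]
    show "pd_u \<sigma> (c, t) > 0" by simp
  qed
qed

section \<open>Rules for partial derivatives\<close>

lemma pd_bounded_linear:
  assumes "bounded_linear h" "g differentiable (at q)"
  shows "pd_u (\<lambda>q. h (g q)) q = h (pd_u g q)" "pd_v (\<lambda>q. h (g q)) q = h (pd_v g q)"
  using differentiable_partials(3,4)[of _ _ "fst q" "snd q", simplified,
      OF bounded_linear.has_derivative[OF assms(1) has_derivative_pd[OF assms(2)]]]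
  by simp_all

lemma pd_add:
  assumes "f differentiable (at q)" "g differentiable (at q)"
  shows "pd_u (\<lambda>q. f q + g q) q = pd_u f q + pd_u g q" "pd_v (\<lambda>q. f q + g q) q = pd_v f q + pd_v g q"
  using differentiable_partials(3,4)[of _ _ "fst q" "snd q", simplified,
      OF has_derivative_add[OF assms[THEN has_derivative_pd]]]
  by simp_all

lemma pd_scaleR:
  assumes "f differentiable (at q)" "g differentiable (at q)"
  shows "pd_u (\<lambda>q. f q *\<^sub>R g q) q = f q *\<^sub>R pd_u g q + pd_u f q *\<^sub>R g q"
    and "pd_v (\<lambda>q. f q *\<^sub>R g q) q = f q *\<^sub>R pd_v g q + pd_v f q *\<^sub>R g q"
  using differentiable_partials(3,4)[of _ _ "fst q" "snd q", simplified,
      OF has_derivative_scaleR[OF assms[THEN has_derivative_pd]]]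
  by simp_all

lemma pd_linear:
  assumes "bounded_linear h"
  shows "pd_u h q = h (1, 0)" "pd_v h q = h (0, 1)"
  using differentiable_partials(3,4)[of _ _ "fst q" "snd q", simplified,
      OF bounded_linear_imp_has_derivative[OF assms]]
  by simp_all

subsection \<open>Straightening of two direction fields\<close>

text \<open>The map \<open>(c, t) \<mapsto> (\<sigma> (c, t), t)\<close> carries vertical lines to
  solution curves of \<open>ds/dt = q\<close>. The first component of its local inverse returns the
  initial value, so it is constant along solutions, which is the stated relation between its partial
  derivatives.\<close>

lemma first_integral:
  fixes q :: "real \<times> real \<Rightarrow> real"
  assumes "open W" "0 \<in> W" "smooth_on W q"
  obtains V u where "open V" "0 \<in> V" "V \<subseteq> W" "smooth_on V u" "u 0 = 0"
    "\<And>x. x \<in> V \<Longrightarrow> pd_u u x \<noteq> 0" "\<And>x. x \<in> V \<Longrightarrow> pd_v u x = - q x * pd_u u x"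
proof -
  obtain \<delta> \<sigma> where \<sigma>: "\<delta> > 0" "smooth_on ({-\<delta><..<\<delta>} \<times> {-\<delta><..<\<delta>}) \<sigma>"
    "\<And>c t. c \<in> {-\<delta><..<\<delta>} \<Longrightarrow> t \<in> {-\<delta><..<\<delta>} \<Longrightarrow> (\<sigma> (c, t), t) \<in> W"
    "\<And>c. \<sigma> (c, 0) = c"
    "\<And>c t. c \<in> {-\<delta><..<\<delta>} \<Longrightarrow> t \<in> {-\<delta><..<\<delta>} \<Longrightarrow>
      ((\<lambda>t. \<sigma> (c, t)) has_real_derivative q (\<sigma> (c, t), t)) (at t)"
    "\<And>c t. c \<in> {-\<delta><..<\<delta>} \<Longrightarrow> t \<in> {-\<delta><..<\<delta>} \<Longrightarrow> pd_u \<sigma> (c, t) > 0"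
    using smooth_flow[OF assms] by blast
  let ?B = "{-\<delta><..<\<delta>} \<times> {-\<delta><..<\<delta>}"
  have o: "open ?B" by (simp add: open_Times)
  have z: "0 \<in> ?B" using \<sigma>(1) by (simp add: zero_prod_def)
  define A where "A p = (\<sigma> p, snd p)" for p
  have smA: "smooth_on ?B A"
    unfolding A_def[abs_def] by (intro smooth_on_Pair o \<sigma>(2) smooth_on_snd smooth_on_id)
  have pd1: "fst (pd_u A p) = pd_u \<sigma> p" "fst (pd_v A p) = q (A p)" if p: "p \<in> ?B" for p
  proof -
    have "(\<lambda>p. fst (A p)) = \<sigma>" by (simp add: A_def)
    then have "fst (pd_u A p) = pd_u \<sigma> p" "fst (pd_v A p) = pd_v \<sigma> p"
      using pd_bounded_linear[OF bounded_linear_fst smooth_on_differentiable[OF smA p]] by (simp_all only:)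
    note 1 = this
    obtain c t where ct: "p = (c, t)" by force
    have "((\<lambda>t. \<sigma> (c, t)) has_vector_derivative q (\<sigma> (c, t), t)) (at t)"
      using \<sigma>(5)[of c t] p ct by (simp add: has_real_derivative_iff_has_vector_derivative)
    moreover have "((\<lambda>t. \<sigma> (c, t)) has_vector_derivative pd_v \<sigma> (c, t)) (at t)"
      using smooth_on_has_pd(2)[OF \<sigma>(2)] p ct by blast
    ultimately have "q (\<sigma> (c, t), t) = pd_v \<sigma> (c, t)" by (rule vector_derivative_unique_at)
    then have "pd_v \<sigma> p = q (A p)" by (simp add: A_def ct)
    with 1 show "fst (pd_u A p) = pd_u \<sigma> p" "fst (pd_v A p) = q (A p)" by simp_all
  qed
  have pd2: "snd (pd_u A p) = 0" "snd (pd_v A p) = 1" if p: "p \<in> ?B" for p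
  proof -
    have "(\<lambda>p. snd (A p)) = snd" by (simp add: A_def)
    then show "snd (pd_u A p) = 0" "snd (pd_v A p) = 1"
      using pd_bounded_linear[OF bounded_linear_snd smooth_on_differentiable[OF smA p]]
        pd_linear[OF bounded_linear_snd] by simp_all
  qed
  have "jac A 0 \<noteq> 0"
    using \<sigma>(6)[of 0 0] \<sigma>(1) by (simp add: jac_def pd1[OF z] pd2[OF z] flip: zero_prod_def)
  then obtain U' V \<Phi> where I: "open U'" "U' \<subseteq> ?B" "0 \<in> U'" "open V" "A 0 \<in> V"
    "homeomorphism U' V A \<Phi>" "smooth_on V \<Phi>" "\<And>q. q \<in> U' \<Longrightarrow> jac A q \<noteq> 0"
    using smooth_local_inverse[OF o smA z] by blast
  have A0: "A 0 = 0" using \<sigma>(4)[of 0] by (simp add: A_def zero_prod_def)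
  have AW: "A p \<in> W" if "p \<in> ?B" for p using \<sigma>(3)[of "fst p" "snd p"] that by (auto simp: A_def)
  define u where "u x = fst (\<Phi> x)" for x
  have smu: "smooth_on V u" unfolding u_def[abs_def] by (intro smooth_on_fst I)
  have \<Phi>: "\<Phi> x \<in> U'" "A (\<Phi> x) = x" if "x \<in> V" for x
    using I(6) that by (auto simp: homeomorphism_def)
  have uA: "u (A p) = fst p" if "p \<in> U'" for p using I(6) that by (auto simp: homeomorphism_def u_def)
  have du: "pd_u \<sigma> (\<Phi> x) * pd_u u x = 1" "q x * pd_u u x + pd_v u x = 0" if x: "x \<in> V" for x
  proof -
    let ?c = "\<Phi> x"
    have c: "?c \<in> U'" "?c \<in> ?B" "A ?c = x" using \<Phi>[OF x] I(2) by auto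
    have dA: "A differentiable (at ?c)" "u differentiable (at (A ?c))"
      using smooth_on_differentiable[OF smA c(2)] smooth_on_differentiable[OF smu x] c(3) by simp_all
    \<comment> \<open>Both relations come from differentiating the identity
      \<open>u (A p) = fst p\<close>.\<close>
    have "pd_u (\<lambda>p. u (A p)) ?c = pd_u fst ?c" "pd_v (\<lambda>p. u (A p)) ?c = pd_v fst ?c"
      by (rule pd_cong[OF I(1) c(1), symmetric]; use uA in
        \<open>auto intro: bounded_linear_imp_differentiable bounded_linear_fst\<close>)+
    then show "pd_u \<sigma> (\<Phi> x) * pd_u u x = 1" "q x * pd_u u x + pd_v u x = 0"
      using pd_compose[OF dA] pd1[OF c(2)] pd2[OF c(2)] c(3) pd_linear[OF bounded_linear_fst]
      by simp_all
  qed
  show thesis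
  proof (rule that[OF I(4) _ _ smu])
    show "V \<subseteq> W" using \<Phi> AW I(2) by (metis subsetD subsetI)
    show "0 \<in> V" using I(5) A0 by simp
    show "u 0 = 0" using uA[OF I(3)] A0 by simp
    show "pd_u u x \<noteq> 0" "pd_v u x = - q x * pd_u u x" if "x \<in> V" for x
      using du[OF that] by auto
  qed
qed

text \<open>Let \<open>u\<close> be a first integral of the field \<open>(q, 1)\<close> and
  \<open>v\<close> one of the field \<open>(1, p)\<close>. In the parameters \<open>(u, v)\<close>
  the curves \<open>v = const\<close> follow \<open>(1, p)\<close> and the curves
  \<open>u = const\<close> follow \<open>(q, 1)\<close>, so the sought map is the inverse of
  \<open>(u, v)\<close>. The fields are independent exactly when \<open>1 - p * q\<close>, their
  determinant, does not vanish.\<close>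

lemma straighten_direction_fields:
  fixes p q :: "real \<times> real \<Rightarrow> real"
  assumes W: "open W" "0 \<in> W" and p: "smooth_on W p" and q: "smooth_on W q" and pq: "p 0 * q 0 \<noteq> 1"
  obtains D \<Phi> where "open D" "0 \<in> D" "\<Phi> 0 = 0" "smooth_on D \<Phi>" "\<Phi> ` D \<subseteq> W" "inj_on \<Phi> D"
    "\<And>x. x \<in> D \<Longrightarrow> jac \<Phi> x \<noteq> 0"
    "\<And>x. x \<in> D \<Longrightarrow> snd (pd_u \<Phi> x) = p (\<Phi> x) * fst (pd_u \<Phi> x)"
    "\<And>x. x \<in> D \<Longrightarrow> fst (pd_v \<Phi> x) = q (\<Phi> x) * snd (pd_v \<Phi> x)"
proof -
  obtain V1 u where u: "open V1" "0 \<in> V1" "V1 \<subseteq> W" "smooth_on V1 u" "u 0 = 0"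
    "\<And>x. x \<in> V1 \<Longrightarrow> pd_u u x \<noteq> 0" "\<And>x. x \<in> V1 \<Longrightarrow> pd_v u x = - q x * pd_u u x"
    using first_integral[OF W q] by blast
  have sw: "bounded_linear (prod.swap :: real \<times> real \<Rightarrow> real \<times> real)"
    unfolding prod.swap_def by (intro bounded_linear_Pair bounded_linear_fst bounded_linear_snd)
  have smsw: "smooth_on X (prod.swap :: real \<times> real \<Rightarrow> real \<times> real)" if "open X" for X
    by (rule smooth_on_bounded_linear[OF sw that smooth_on_id])
  have diffsw: "prod.swap differentiable (at x)" for x :: "real \<times> real"
    using sw by (rule bounded_linear_imp_differentiable)
  \<comment> \<open>Interchanging the coordinates turns the equation \<open>dt/ds = p\<close> into
    the form treated by \<open>first_integral\<close>.\<close>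
  define W' where "W' = prod.swap -` W"
  have W': "open W'" "0 \<in> W'"
    using W unfolding W'_def by (auto intro!: open_vimage continuous_on_swap simp: zero_prod_def)
  have "smooth_on W' (\<lambda>x. p (prod.swap x))"
    by (rule smooth_on_compose[OF W'(1) W(1) _ smsw[OF W'(1)] p]) (simp add: W'_def)
  note p' = this
  obtain V2 v' where v': "open V2" "0 \<in> V2" "V2 \<subseteq> W'" "smooth_on V2 v'" "v' 0 = 0"
    "\<And>x. x \<in> V2 \<Longrightarrow> pd_u v' x \<noteq> 0" "\<And>x. x \<in> V2 \<Longrightarrow> pd_v v' x = - p (prod.swap x) * pd_u v' x"
    using first_integral[OF W' p'] by blast
  define V where "V = V1 \<inter> prod.swap -` V2"
  have V: "open V" "0 \<in> V" "V \<subseteq> V1" "V \<subseteq> W"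
    using u v' unfolding V_def by (auto intro!: open_Int open_vimage continuous_on_swap simp: zero_prod_def)
  define v where "v x = v' (prod.swap x)" for x
  have smv: "smooth_on V v"
    unfolding v_def[abs_def] by (rule smooth_on_compose[OF V(1) v'(1) _ smsw[OF V(1)] v'(4)]) (simp add: V_def)
  have dv: "pd_v v x \<noteq> 0" "pd_u v x = - p x * pd_v v x" if "x \<in> V" for x
  proof -
    have x: "prod.swap x \<in> V2" using that by (simp add: V_def)
    have "pd_v v x = pd_u v' (prod.swap x)" "pd_u v x = pd_v v' (prod.swap x)"
      unfolding v_def using pd_compose[OF diffsw smooth_on_differentiable[OF v'(4) x]]
      by (simp_all add: pd_linear[OF sw])
    then show "pd_v v x \<noteq> 0" "pd_u v x = - p x * pd_v v x" using v'(6,7)[OF x] by simp_all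
  qed
  have smu: "smooth_on V u" by (rule smooth_on_subset[OF u(4) V(3)])
  define \<Psi> where "\<Psi> x = (u x, v x)" for x
  have sm\<Psi>: "smooth_on V \<Psi>" unfolding \<Psi>_def[abs_def] by (intro smooth_on_Pair V smu smv)
  have pd\<Psi>: "pd_u \<Psi> x = (pd_u u x, pd_u v x)" "pd_v \<Psi> x = (pd_v u x, pd_v v x)" if "x \<in> V" for x
    using pd_bounded_linear[OF bounded_linear_fst smooth_on_differentiable[OF sm\<Psi> that]]
      pd_bounded_linear[OF bounded_linear_snd smooth_on_differentiable[OF sm\<Psi> that]]
    by (simp_all add: \<Psi>_def prod_eq_iff)
  have "jac \<Psi> 0 = pd_u u 0 * pd_v v 0 * (1 - p 0 * q 0)"
    using u(7)[OF u(2)] dv(2)[OF V(2)] by (simp add: jac_def pd\<Psi>[OF V(2)] algebra_simps)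
  then have j: "jac \<Psi> 0 \<noteq> 0" using u(6)[OF u(2)] dv(1)[OF V(2)] pq by simp
  obtain U' D \<Phi> where I: "open U'" "U' \<subseteq> V" "0 \<in> U'" "open D" "\<Psi> 0 \<in> D"
    "homeomorphism U' D \<Psi> \<Phi>" "smooth_on D \<Phi>" "\<And>q. q \<in> U' \<Longrightarrow> jac \<Psi> q \<noteq> 0"
    using smooth_local_inverse[OF V(1) sm\<Psi> V(2) j] by blast
  have \<Psi>0: "\<Psi> 0 = 0" using u(5) v'(5) by (simp add: \<Psi>_def v_def zero_prod_def)
  have \<Phi>: "\<Phi> x \<in> U'" "\<Phi> x \<in> V" "\<Psi> (\<Phi> x) = x" if "x \<in> D" for x
    using I(2,6) that by (auto simp: homeomorphism_def)
  have inj: "inj_on \<Phi> D" using \<Phi>(3) by (metis inj_on_inverseI)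
  \<comment> \<open>The four entries of the matrix identity \<open>\<Psi>' \<Phi>' = 1\<close>, with
    the partial derivatives of \<open>u\<close> and \<open>v\<close> that the first integrals
    determine inserted.\<close>
  have main: "pd_u u (\<Phi> x) * (fst (pd_u \<Phi> x) - q (\<Phi> x) * snd (pd_u \<Phi> x)) = 1"
    "pd_v v (\<Phi> x) * (snd (pd_u \<Phi> x) - p (\<Phi> x) * fst (pd_u \<Phi> x)) = 0"
    "pd_u u (\<Phi> x) * (fst (pd_v \<Phi> x) - q (\<Phi> x) * snd (pd_v \<Phi> x)) = 0"
    "pd_v v (\<Phi> x) * (snd (pd_v \<Phi> x) - p (\<Phi> x) * fst (pd_v \<Phi> x)) = 1" if x: "x \<in> D" for x
  proof -
    have d\<Phi>: "\<Phi> differentiable (at x)" using smooth_on_differentiable[OF I(7) x] .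
    note y = \<Phi>[OF x]
    have du: "u differentiable (at (\<Phi> x))" "v differentiable (at (\<Phi> x))"
      using smooth_on_differentiable[OF smu y(2)] smooth_on_differentiable[OF smv y(2)] .
    have e: "fst y = u (\<Phi> y)" "snd y = v (\<Phi> y)" if "y \<in> D" for y
      using \<Phi>(3)[OF that] unfolding \<Psi>_def by (metis fst_conv, metis snd_conv)
    have "pd_u fst x = pd_u (\<lambda>x. u (\<Phi> x)) x" "pd_v fst x = pd_v (\<lambda>x. u (\<Phi> x)) x"
      "pd_u snd x = pd_u (\<lambda>x. v (\<Phi> x)) x" "pd_v snd x = pd_v (\<lambda>x. v (\<Phi> x)) x"
      using e by (intro pd_cong[OF I(4) x] bounded_linear_imp_differentiable bounded_linear_fst
          bounded_linear_snd; blast)+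
    then have "1 = fst (pd_u \<Phi> x) * pd_u u (\<Phi> x) + snd (pd_u \<Phi> x) * pd_v u (\<Phi> x)"
      "0 = fst (pd_v \<Phi> x) * pd_u u (\<Phi> x) + snd (pd_v \<Phi> x) * pd_v u (\<Phi> x)"
      "0 = fst (pd_u \<Phi> x) * pd_u v (\<Phi> x) + snd (pd_u \<Phi> x) * pd_v v (\<Phi> x)"
      "1 = fst (pd_v \<Phi> x) * pd_u v (\<Phi> x) + snd (pd_v \<Phi> x) * pd_v v (\<Phi> x)"
      using pd_compose[OF d\<Phi> du(1)] pd_compose[OF d\<Phi> du(2)]
      by (simp_all add: pd_linear[OF bounded_linear_fst] pd_linear[OF bounded_linear_snd])
    moreover have "pd_v u (\<Phi> x) = - q (\<Phi> x) * pd_u u (\<Phi> x)" "pd_u v (\<Phi> x) = - p (\<Phi> x) * pd_v v (\<Phi> x)"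
      using u(7)[OF subsetD[OF V(3) y(2)]] dv(2)[OF y(2)] .
    ultimately show "pd_u u (\<Phi> x) * (fst (pd_u \<Phi> x) - q (\<Phi> x) * snd (pd_u \<Phi> x)) = 1"
      "pd_v v (\<Phi> x) * (snd (pd_u \<Phi> x) - p (\<Phi> x) * fst (pd_u \<Phi> x)) = 0"
      "pd_u u (\<Phi> x) * (fst (pd_v \<Phi> x) - q (\<Phi> x) * snd (pd_v \<Phi> x)) = 0"
      "pd_v v (\<Phi> x) * (snd (pd_v \<Phi> x) - p (\<Phi> x) * fst (pd_v \<Phi> x)) = 1"
      by (simp_all add: algebra_simps; auto)+
  qed
  have fields: "snd (pd_u \<Phi> x) = p (\<Phi> x) * fst (pd_u \<Phi> x)" "fst (pd_v \<Phi> x) = q (\<Phi> x) * snd (pd_v \<Phi> x)"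
    if "x \<in> D" for x
    using main[OF that] dv(1)[OF \<Phi>(2)[OF that]] u(6)[of "\<Phi> x"] \<Phi>(2)[OF that] V(3) by auto
  show thesis
  proof (rule that[OF I(4) _ _ I(7) _ inj _ fields])
    show "0 \<in> D" "\<Phi> 0 = 0" using I(3,5,6) \<Psi>0 by (auto simp: homeomorphism_def)
    show "\<Phi> ` D \<subseteq> W" using \<Phi>(2) V(4) by blast
    show "jac \<Phi> x \<noteq> 0" if x: "x \<in> D" for x
    proof
      \<comment> \<open>With the slopes inserted, the Jacobian is a product of three factors; the
        first and last identities of \<open>main\<close> show that none of them is zero.\<close>
      assume "jac \<Phi> x = 0"
      then have "fst (pd_u \<Phi> x) * snd (pd_v \<Phi> x) * (1 - p (\<Phi> x) * q (\<Phi> x)) = 0"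
        unfolding jac_def fields[OF x] by (simp add: algebra_simps)
      moreover have "pd_u u (\<Phi> x) * fst (pd_u \<Phi> x) * (1 - p (\<Phi> x) * q (\<Phi> x)) = 1"
        "pd_v v (\<Phi> x) * snd (pd_v \<Phi> x) * (1 - p (\<Phi> x) * q (\<Phi> x)) = 1"
        using main(1,4)[OF x] unfolding fields[OF x] by (simp_all add: algebra_simps)
      ultimately show False by (metis mult_eq_0_iff zero_neq_one)
    qed
  qed
qed

subsection \<open>Change of parameters\<close>

lemma inj_frechet_if_jac:
  assumes "\<Phi> differentiable (at q)" "jac \<Phi> q \<noteq> 0"
  shows "inj (frechet_derivative \<Phi> (at q))"
proof (rule injI)
  let ?a = "fst (pd_u \<Phi> q)" and ?b = "fst (pd_v \<Phi> q)" and ?c = "snd (pd_u \<Phi> q)" and ?d = "snd (pd_v \<Phi> q)"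
  fix x y assume eq: "frechet_derivative \<Phi> (at q) x = frechet_derivative \<Phi> (at q) y"
  have "frechet_derivative \<Phi> (at q) w = fst w *\<^sub>R (?a, ?c) + snd w *\<^sub>R (?b, ?d)" for w
    using frechet_eq_pd(3)[OF assms(1)] by simp
  then show "x = y"
    using eq cramer_2[of ?a ?d ?c ?b "fst x" "snd x" "fst (frechet_derivative \<Phi> (at q) y)"
        "snd (frechet_derivative \<Phi> (at q) y)"]
      cramer_2[of ?a ?d ?c ?b "fst y" "snd y" "fst (frechet_derivative \<Phi> (at q) y)"
        "snd (frechet_derivative \<Phi> (at q) y)"] assms(2)
    unfolding jac_def by (metis prod.collapse)
qed

text \<open>Invariance of domain turns the injective continuous \<open>\<Phi>\<close> into a
  homeomorphism onto an open set, which settles the topological conditions; the rank condition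
  follows from the chain rule and the Jacobian.\<close>

lemma local_parametrization_compose:
  assumes x: "local_parametrization S U x" and "open D" "smooth_on D \<Phi>" "\<Phi> ` D \<subseteq> U" "inj_on \<Phi> D"
    and jac: "\<And>q. q \<in> D \<Longrightarrow> jac \<Phi> q \<noteq> 0"
  shows "local_parametrization S D (\<lambda>q. x (\<Phi> q))"
proof -
  have U: "open U" "smooth_on U x" "\<And>q. q \<in> U \<Longrightarrow> inj (frechet_derivative x (at q))"
    "openin (top_of_set S) (x ` U)" using x by (auto simp: local_parametrization_def)
  obtain w where w: "homeomorphism U (x ` U) x w" using x by (auto simp: local_parametrization_def)
  have "continuous_on D \<Phi>" using assms(3) by (rule smooth_on_continuous)
  then obtain g where g: "homeomorphism D (\<Phi> ` D) \<Phi> g" and o: "open (\<Phi> ` D)"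
    using assms by (metis invariance_of_domain_homeomorphism invariance_of_domain order_refl)
  have "inj (frechet_derivative (\<lambda>q. x (\<Phi> q)) (at q))" if "q \<in> D" for q
  proof -
    have d: "\<Phi> differentiable (at q)" "x differentiable (at (\<Phi> q))"
      using smooth_on_differentiable[OF assms(3) that] smooth_on_differentiable[OF U(2) subsetD[OF assms(4) imageI[OF that]]] .
    have "frechet_derivative (\<lambda>q. x (\<Phi> q)) (at q) = frechet_derivative x (at (\<Phi> q)) \<circ> frechet_derivative \<Phi> (at q)"
      using frechet_derivative_compose[OF d] by (simp add: o_def)
    then show ?thesis
      using inj_frechet_if_jac[OF d(1) jac[OF that]] U(3)[of "\<Phi> q"] assms(4) that by (auto intro: inj_compose)
  qed
  moreover have "smooth_on D (\<lambda>q. x (\<Phi> q))"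
    by (rule smooth_on_compose[OF assms(2) U(1) _ assms(3) U(2)]) (use assms(4) in auto)
  moreover have im: "(\<lambda>q. x (\<Phi> q)) ` D = x ` \<Phi> ` D" by auto
  moreover have "openin (top_of_set S) (x ` \<Phi> ` D)"
    using homeomorphism_imp_open_map[OF w] o assms(4) U(4)
    by (metis open_openin_trans openin_trans U(1))
  moreover have "homeomorphism D (x ` \<Phi> ` D) (x \<circ> \<Phi>) (g \<circ> w)"
    by (rule homeomorphism_compose[OF g homeomorphism_of_subsets[OF w assms(4)]])
      (use assms(4) in auto)
  ultimately show ?thesis using assms(2) unfolding local_parametrization_def im by (auto simp: o_def)
qed

lemma local_parametrization_subset:
  assumes "local_parametrization S U x" "open D" "D \<subseteq> U"
  shows "local_parametrization S D x"
proof -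
  have "jac (\<lambda>q. q) q = 1" for q
    by (simp add: jac_def pd_linear[OF bounded_linear_ident])
  then show ?thesis
    using local_parametrization_compose[OF assms(1,2) smooth_on_id] assms(3) by auto
qed

text \<open>The tangential coefficients \<open>k\<close> and \<open>l\<close> are left unspecified
  because the triple product with \<open>z_u\<close>, \<open>z_v\<close> annihilates them; only the
  coefficients of the second partials enter the second fundamental form.\<close>

lemma second_partials_compose:
  fixes x :: "real \<times> real \<Rightarrow> real ^ 3"
  assumes U: "open U" "smooth_on U x" and D: "open D" "smooth_on D \<Phi>" "\<And>q. q \<in> D \<Longrightarrow> \<Phi> q \<in> U" and q: "q \<in> D"
  defines "z \<equiv> \<lambda>q. x (\<Phi> q)"
  shows "pd_u z q = fst (pd_u \<Phi> q) *\<^sub>R pd_u x (\<Phi> q) + snd (pd_u \<Phi> q) *\<^sub>R pd_v x (\<Phi> q)"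
    and "pd_v z q = fst (pd_v \<Phi> q) *\<^sub>R pd_u x (\<Phi> q) + snd (pd_v \<Phi> q) *\<^sub>R pd_v x (\<Phi> q)"
    and "\<exists>k l. pd_u (pd_u z) q = k *\<^sub>R pd_u x (\<Phi> q) + l *\<^sub>R pd_v x (\<Phi> q) +
      (fst (pd_u \<Phi> q))\<^sup>2 *\<^sub>R pd_u (pd_u x) (\<Phi> q) +
      (2 * fst (pd_u \<Phi> q) * snd (pd_u \<Phi> q)) *\<^sub>R pd_v (pd_u x) (\<Phi> q) +
      (snd (pd_u \<Phi> q))\<^sup>2 *\<^sub>R pd_v (pd_v x) (\<Phi> q)"
    and "\<exists>k l. pd_v (pd_v z) q = k *\<^sub>R pd_u x (\<Phi> q) + l *\<^sub>R pd_v x (\<Phi> q) +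
      (fst (pd_v \<Phi> q))\<^sup>2 *\<^sub>R pd_u (pd_u x) (\<Phi> q) +
      (2 * fst (pd_v \<Phi> q) * snd (pd_v \<Phi> q)) *\<^sub>R pd_v (pd_u x) (\<Phi> q) +
      (snd (pd_v \<Phi> q))\<^sup>2 *\<^sub>R pd_v (pd_v x) (\<Phi> q)"
    and "\<exists>k l. pd_v (pd_u z) q = k *\<^sub>R pd_u x (\<Phi> q) + l *\<^sub>R pd_v x (\<Phi> q) +
      (fst (pd_u \<Phi> q) * fst (pd_v \<Phi> q)) *\<^sub>R pd_u (pd_u x) (\<Phi> q) +
      (fst (pd_u \<Phi> q) * snd (pd_v \<Phi> q) + snd (pd_u \<Phi> q) * fst (pd_v \<Phi> q)) *\<^sub>R pd_v (pd_u x) (\<Phi> q) +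
      (snd (pd_u \<Phi> q) * snd (pd_v \<Phi> q)) *\<^sub>R pd_v (pd_v x) (\<Phi> q)"
proof -
  note sx = smooth_on_pd[OF U] and s\<Phi> = smooth_on_pd[OF D(1,2)]
  have first: "pd_u z y = fst (pd_u \<Phi> y) *\<^sub>R pd_u x (\<Phi> y) + snd (pd_u \<Phi> y) *\<^sub>R pd_v x (\<Phi> y)"
    "pd_v z y = fst (pd_v \<Phi> y) *\<^sub>R pd_u x (\<Phi> y) + snd (pd_v \<Phi> y) *\<^sub>R pd_v x (\<Phi> y)" if "y \<in> D" for y
    unfolding z_def
    using pd_compose[OF smooth_on_differentiable[OF D(2) that] smooth_on_differentiable[OF U(2) D(3)[OF that]]]
    by auto
  then show "pd_u z q = fst (pd_u \<Phi> q) *\<^sub>R pd_u x (\<Phi> q) + snd (pd_u \<Phi> q) *\<^sub>R pd_v x (\<Phi> q)"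
    "pd_v z q = fst (pd_v \<Phi> q) *\<^sub>R pd_u x (\<Phi> q) + snd (pd_v \<Phi> q) *\<^sub>R pd_v x (\<Phi> q)"
    using q by auto
  have comm: "pd_u (pd_v x) (\<Phi> q) = pd_v (pd_u x) (\<Phi> q)"
    using pd_commute[OF U, of "fst (\<Phi> q)" "snd (\<Phi> q)"] D(3)[OF q] by simp
  have d\<Phi>: "\<Phi> differentiable (at q)" using smooth_on_differentiable[OF D(2) q] .
  have dx: "pd_u x differentiable (at (\<Phi> q))" "pd_v x differentiable (at (\<Phi> q))"
    using smooth_on_differentiable[OF sx(1) D(3)[OF q]] smooth_on_differentiable[OF sx(2) D(3)[OF q]] .
  have scx: "smooth_on D (\<lambda>y. pd_u x (\<Phi> y))" "smooth_on D (\<lambda>y. pd_v x (\<Phi> y))"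
    by (rule smooth_on_compose[OF D(1) U(1) D(3) D(2) sx(1)], assumption,
        rule smooth_on_compose[OF D(1) U(1) D(3) D(2) sx(2)])
  note diff = smooth_on_differentiable[OF _ q]
  have sdiff: "(\<lambda>y. fst (pd_u \<Phi> y)) differentiable (at q)" "(\<lambda>y. snd (pd_u \<Phi> y)) differentiable (at q)"
    "(\<lambda>y. fst (pd_v \<Phi> y)) differentiable (at q)" "(\<lambda>y. snd (pd_v \<Phi> y)) differentiable (at q)"
    by (intro diff smooth_on_fst smooth_on_snd D s\<Phi>)+
  have gen: "\<exists>k l. pd_u (\<lambda>y. f y *\<^sub>R pd_u x (\<Phi> y) + g y *\<^sub>R pd_v x (\<Phi> y)) q =
      k *\<^sub>R pd_u x (\<Phi> q) + l *\<^sub>R pd_v x (\<Phi> q) + (f q * fst (pd_u \<Phi> q)) *\<^sub>R pd_u (pd_u x) (\<Phi> q) +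
      (f q * snd (pd_u \<Phi> q) + g q * fst (pd_u \<Phi> q)) *\<^sub>R pd_v (pd_u x) (\<Phi> q) +
      (g q * snd (pd_u \<Phi> q)) *\<^sub>R pd_v (pd_v x) (\<Phi> q)"
    "\<exists>k l. pd_v (\<lambda>y. f y *\<^sub>R pd_u x (\<Phi> y) + g y *\<^sub>R pd_v x (\<Phi> y)) q =
      k *\<^sub>R pd_u x (\<Phi> q) + l *\<^sub>R pd_v x (\<Phi> q) + (f q * fst (pd_v \<Phi> q)) *\<^sub>R pd_u (pd_u x) (\<Phi> q) +
      (f q * snd (pd_v \<Phi> q) + g q * fst (pd_v \<Phi> q)) *\<^sub>R pd_v (pd_u x) (\<Phi> q) +
      (g q * snd (pd_v \<Phi> q)) *\<^sub>R pd_v (pd_v x) (\<Phi> q)"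
    if fg: "f differentiable (at q)" "g differentiable (at q)" for f g :: "real \<times> real \<Rightarrow> real"
  proof -
    note s = pd_scaleR[OF fg(1) diff[OF scx(1)]] pd_scaleR[OF fg(2) diff[OF scx(2)]]
      pd_add[OF differentiable_scaleR[OF fg(1) diff[OF scx(1)]] differentiable_scaleR[OF fg(2) diff[OF scx(2)]]]
      pd_compose[OF d\<Phi> dx(1)] pd_compose[OF d\<Phi> dx(2)] comm
    show "\<exists>k l. pd_u (\<lambda>y. f y *\<^sub>R pd_u x (\<Phi> y) + g y *\<^sub>R pd_v x (\<Phi> y)) q =
      k *\<^sub>R pd_u x (\<Phi> q) + l *\<^sub>R pd_v x (\<Phi> q) + (f q * fst (pd_u \<Phi> q)) *\<^sub>R pd_u (pd_u x) (\<Phi> q) +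
      (f q * snd (pd_u \<Phi> q) + g q * fst (pd_u \<Phi> q)) *\<^sub>R pd_v (pd_u x) (\<Phi> q) +
      (g q * snd (pd_u \<Phi> q)) *\<^sub>R pd_v (pd_v x) (\<Phi> q)"
      by (rule exI[of _ "pd_u f q"], rule exI[of _ "pd_u g q"]) (simp only: s, simp add: algebra_simps)
    show "\<exists>k l. pd_v (\<lambda>y. f y *\<^sub>R pd_u x (\<Phi> y) + g y *\<^sub>R pd_v x (\<Phi> y)) q =
      k *\<^sub>R pd_u x (\<Phi> q) + l *\<^sub>R pd_v x (\<Phi> q) + (f q * fst (pd_v \<Phi> q)) *\<^sub>R pd_u (pd_u x) (\<Phi> q) +
      (f q * snd (pd_v \<Phi> q) + g q * fst (pd_v \<Phi> q)) *\<^sub>R pd_v (pd_u x) (\<Phi> q) +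
      (g q * snd (pd_v \<Phi> q)) *\<^sub>R pd_v (pd_v x) (\<Phi> q)"
      by (rule exI[of _ "pd_v f q"], rule exI[of _ "pd_v g q"]) (simp only: s, simp add: algebra_simps)
  qed
  have "smooth_on D z"
    unfolding z_def by (rule smooth_on_compose[OF D(1) U(1) D(3) D(2) U(2)])
  note zd = smooth_on_pd[OF D(1) this, THEN diff]
  have "pd_u (pd_u z) q = pd_u (\<lambda>y. fst (pd_u \<Phi> y) *\<^sub>R pd_u x (\<Phi> y) + snd (pd_u \<Phi> y) *\<^sub>R pd_v x (\<Phi> y)) q"
    "pd_v (pd_u z) q = pd_v (\<lambda>y. fst (pd_u \<Phi> y) *\<^sub>R pd_u x (\<Phi> y) + snd (pd_u \<Phi> y) *\<^sub>R pd_v x (\<Phi> y)) q"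
    "pd_v (pd_v z) q = pd_v (\<lambda>y. fst (pd_v \<Phi> y) *\<^sub>R pd_u x (\<Phi> y) + snd (pd_v \<Phi> y) *\<^sub>R pd_v x (\<Phi> y)) q"
    by (rule pd_cong[OF D(1) q first(1) zd(1)] pd_cong[OF D(1) q first(2) zd(2)], assumption)+
  then show "\<exists>k l. pd_u (pd_u z) q = k *\<^sub>R pd_u x (\<Phi> q) + l *\<^sub>R pd_v x (\<Phi> q) +
      (fst (pd_u \<Phi> q))\<^sup>2 *\<^sub>R pd_u (pd_u x) (\<Phi> q) +
      (2 * fst (pd_u \<Phi> q) * snd (pd_u \<Phi> q)) *\<^sub>R pd_v (pd_u x) (\<Phi> q) +
      (snd (pd_u \<Phi> q))\<^sup>2 *\<^sub>R pd_v (pd_v x) (\<Phi> q)"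
    "\<exists>k l. pd_v (pd_v z) q = k *\<^sub>R pd_u x (\<Phi> q) + l *\<^sub>R pd_v x (\<Phi> q) +
      (fst (pd_v \<Phi> q))\<^sup>2 *\<^sub>R pd_u (pd_u x) (\<Phi> q) +
      (2 * fst (pd_v \<Phi> q) * snd (pd_v \<Phi> q)) *\<^sub>R pd_v (pd_u x) (\<Phi> q) +
      (snd (pd_v \<Phi> q))\<^sup>2 *\<^sub>R pd_v (pd_v x) (\<Phi> q)"
    "\<exists>k l. pd_v (pd_u z) q = k *\<^sub>R pd_u x (\<Phi> q) + l *\<^sub>R pd_v x (\<Phi> q) +
      (fst (pd_u \<Phi> q) * fst (pd_v \<Phi> q)) *\<^sub>R pd_u (pd_u x) (\<Phi> q) +
      (fst (pd_u \<Phi> q) * snd (pd_v \<Phi> q) + snd (pd_u \<Phi> q) * fst (pd_v \<Phi> q)) *\<^sub>R pd_v (pd_u x) (\<Phi> q) +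
      (snd (pd_u \<Phi> q) * snd (pd_v \<Phi> q)) *\<^sub>R pd_v (pd_v x) (\<Phi> q)"
    using gen(1)[OF sdiff(1,2)] gen(2)[OF sdiff(3,4)] gen(2)[OF sdiff(1,2)]
    by (simp_all add: power2_eq_square mult_ac)
qed

subsection \<open>The fundamental forms\<close>

definition trip :: "real ^ 3 \<Rightarrow> real ^ 3 \<Rightarrow> real ^ 3 \<Rightarrow> real" where
  "trip a b c = det (vector [a, b, c] :: real ^ 3 ^ 3)"

text \<open>The Lorentzian cross product: the third coordinate has the opposite of the Euclidean
  sign, so that its scalar product with \<open>w\<close> is the determinant of \<open>a\<close>,
  \<open>b\<close>, \<open>w\<close>.\<close>

definition lcross :: "real ^ 3 \<Rightarrow> real ^ 3 \<Rightarrow> real ^ 3" where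
  "lcross a b = vector [a $ 2 * b $ 3 - a $ 3 * b $ 2, a $ 3 * b $ 1 - a $ 1 * b $ 3, a $ 2 * b $ 1 - a $ 1 * b $ 2]"

text \<open>The negative of the Gram determinant, so that it is positive on time-like
  planes.\<close>

definition gram :: "real ^ 3 \<Rightarrow> real ^ 3 \<Rightarrow> real" where
  "gram a b = (lorentz a b)\<^sup>2 - lorentz a a * lorentz b b"

lemma trip_expand:
  "trip a b c = c $ 1 * (a $ 2 * b $ 3 - a $ 3 * b $ 2) + c $ 2 * (a $ 3 * b $ 1 - a $ 1 * b $ 3) +
    c $ 3 * (a $ 1 * b $ 2 - a $ 2 * b $ 1)"
  by (simp add: trip_def det_3 algebra_simps)

lemma lorentz_lcross: "lorentz (lcross a b) w = trip a b w"
  by (simp add: lorentz_def lcross_def trip_expand algebra_simps)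

lemma lorentz_lcross_self: "lorentz (lcross a b) (lcross a b) = gram a b"
  by (simp add: lorentz_def lcross_def gram_def power2_eq_square algebra_simps)

lemma lorentz_sym: "lorentz a b = lorentz b a"
  by (simp add: lorentz_def mult.commute)

lemma lorentz_linear:
  "lorentz (a + b) c = lorentz a c + lorentz b c" "lorentz c (a + b) = lorentz c a + lorentz c b"
  "lorentz (k *\<^sub>R a) c = k * lorentz a c" "lorentz c (k *\<^sub>R a) = k * lorentz c a"
  by (simp_all add: lorentz_def algebra_simps)

lemma trip_linear:
  "trip (a + a') b c = trip a b c + trip a' b c" "trip a (b + b') c = trip a b c + trip a b' c"
  "trip a b (c + c') = trip a b c + trip a b c'"
  "trip (k *\<^sub>R a) b c = k * trip a b c" "trip a (k *\<^sub>R b) c = k * trip a b c" "trip a b (k *\<^sub>R c) = k * trip a b c"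
  by (simp_all add: trip_expand algebra_simps)

lemma trip_degenerate: "trip a a c = 0" "trip a b a = 0" "trip a b b = 0"
  by (simp_all add: trip_expand algebra_simps)

lemma trip_swap: "trip b a c = - trip a b c" "trip a c b = - trip a b c" "trip c b a = - trip a b c"
  by (simp_all add: trip_expand algebra_simps)

text \<open>Expansion of \<open>w\<close> along \<open>a\<close>, \<open>b\<close> and their normal,
  multiplied by \<open>gram a b\<close> so that it is a polynomial identity, valid also for
  dependent \<open>a\<close> and \<open>b\<close>.\<close>

lemma gram_decomposition:
  "gram a b *\<^sub>R w = trip a b w *\<^sub>R lcross a b +
    (lorentz a b * lorentz w b - lorentz b b * lorentz w a) *\<^sub>R a +
    (lorentz a b * lorentz w a - lorentz a a * lorentz w b) *\<^sub>R b"
  unfolding vec_eq_iff forall_3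
  by (simp add: trip_expand lcross_def gram_def lorentz_def power2_eq_square) algebra

lemma coplanar_decomposition:
  assumes "gram a b \<noteq> 0" "trip a b w = 0"
  obtains k l where "w = k *\<^sub>R a + l *\<^sub>R b"
proof
  let ?k = "(lorentz a b * lorentz w b - lorentz b b * lorentz w a) / gram a b"
    and ?l = "(lorentz a b * lorentz w a - lorentz a a * lorentz w b) / gram a b"
  have "w = (1 / gram a b) *\<^sub>R (gram a b *\<^sub>R w)" using assms by simp
  then show "w = ?k *\<^sub>R a + ?l *\<^sub>R b"
    unfolding gram_decomposition assms(2) by (simp add: scaleR_add_right)
qed

text \<open>These are the forms for the unnormalised normal \<open>lcross z_u z_v\<close>, whose
  Lorentz square is \<open>coef_W\<close>. Being polynomial in the derivatives of \<open>z\<close>,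
  they are smooth without further argument; division by the root of \<open>coef_W\<close> recovers
  \<open>L\<close>, \<open>M\<close>, \<open>N\<close>.\<close>

abbreviation "coef_W z q \<equiv> gram (pd_u z q) (pd_v z q)"
abbreviation "sL z q \<equiv> trip (pd_u z q) (pd_v z q) (pd_u (pd_u z) q)"
abbreviation "sM z q \<equiv> trip (pd_u z q) (pd_v z q) (pd_v (pd_u z) q)"
abbreviation "sN z q \<equiv> trip (pd_u z q) (pd_v z q) (pd_v (pd_v z) q)"

lemma coef_W: "coef_W z q = (coef_F z q)\<^sup>2 - coef_E z q * coef_G z q"
  by (simp add: gram_def coef_E_def coef_F_def coef_G_def)

lemma unit_normal_eq:
  assumes W: "coef_W z q > 0"
  shows "unit_normal z q = (1 / sqrt (coef_W z q)) *\<^sub>R lcross (pd_u z q) (pd_v z q)"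
  unfolding unit_normal_def
proof (rule the_equality)
  let ?a = "pd_u z q" and ?b = "pd_v z q" and ?W = "coef_W z q"
  let ?n = "(1 / sqrt ?W) *\<^sub>R lcross ?a ?b"
  have nn: "lorentz ?n ?n = 1"
    using W by (simp add: lorentz_linear lorentz_lcross_self)
  then have "?n \<noteq> 0" by (auto simp: lorentz_def)
  moreover have "trip ?a ?b (lcross ?a ?b) = ?W"
    by (metis lorentz_lcross lorentz_lcross_self)
  then have "trip ?a ?b ?n = ?W / sqrt ?W"
    by (simp add: trip_linear)
  ultimately show "normal_vector z q ?n \<and> lorentz ?n ?n = 1 \<and> det (vector [?a, ?b, ?n]) > 0"
    using W nn
    by (simp add: normal_vector_def lorentz_linear lorentz_lcross trip_degenerate trip_def[symmetric])
  fix n assume n: "normal_vector z q n \<and> lorentz n n = 1 \<and> det (vector [?a, ?b, n]) > 0"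
  \<comment> \<open>The decomposition makes every normal a multiple \<open>\<tau>\<close> of
    \<open>lcross\<close>; unit length determines \<open>\<tau>\<close> up to sign, and positive
    orientation determines the sign.\<close>
  define \<tau> where "\<tau> = trip ?a ?b n / ?W"
  have \<tau>: "\<tau> > 0" using n W by (simp add: \<tau>_def trip_def)
  have "?W *\<^sub>R n = trip ?a ?b n *\<^sub>R lcross ?a ?b"
    using n by (subst gram_decomposition) (simp add: normal_vector_def)
  then have "(1 / ?W) *\<^sub>R (?W *\<^sub>R n) = (1 / ?W) *\<^sub>R (trip ?a ?b n *\<^sub>R lcross ?a ?b)" by simp
  then have n\<tau>: "n = \<tau> *\<^sub>R lcross ?a ?b" using W by (simp add: \<tau>_def)
  then have "\<tau>\<^sup>2 * ?W = 1"
    using n by (simp add: lorentz_linear lorentz_lcross_self power2_eq_square)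
  then have "(\<tau> * sqrt ?W)\<^sup>2 = 1" using W by (simp add: power_mult_distrib)
  then have "\<tau> * sqrt ?W = 1"
    using \<tau> W by (simp add: power2_eq_1_iff) (smt (verit) mult_pos_pos real_sqrt_gt_zero)
  then show "n = ?n" using n\<tau> W by (simp add: field_simps)
qed

lemma second_form_eq:
  assumes "coef_W z q > 0"
  shows "coef_L z q = sL z q / sqrt (coef_W z q)" "coef_M z q = sM z q / sqrt (coef_W z q)"
    "coef_N z q = sN z q / sqrt (coef_W z q)"
  using unit_normal_eq[OF assms]
  by (simp_all add: coef_L_def coef_M_def coef_N_def lorentz_linear lorentz_lcross)

text \<open>Regularity makes \<open>lcross z_u z_v\<close> a nonzero normal, and its Lorentz square
  is \<open>coef_W\<close>, so the time-like condition applies to it directly.\<close>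

lemma coef_W_pos:
  assumes S: "time_like_surface S" and z: "local_parametrization S U z" and q: "q \<in> U"
  shows "coef_W z q > 0"
proof -
  let ?a = "pd_u z q" and ?b = "pd_v z q"
  have inj: "inj (frechet_derivative z (at q))" and sm: "smooth_on U z"
    using z q by (auto simp: local_parametrization_def)
  have fd: "frechet_derivative z (at q) d = fst d *\<^sub>R ?a + snd d *\<^sub>R ?b" for d
    by (rule frechet_eq_pd(3)[OF smooth_on_differentiable[OF sm q]])
  have zero: "d = 0" if "fst d *\<^sub>R ?a + snd d *\<^sub>R ?b = 0" for d
    using injD[OF inj, of d 0] that by (simp add: fd)
  have "lcross ?a ?b \<noteq> 0"
  proof
    assume c: "lcross ?a ?b = 0"
    have "?a $ 2 * ?b $ 3 - ?a $ 3 * ?b $ 2 = lcross ?a ?b $ 1"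
      "?a $ 3 * ?b $ 1 - ?a $ 1 * ?b $ 3 = lcross ?a ?b $ 2"
      "?a $ 2 * ?b $ 1 - ?a $ 1 * ?b $ 2 = lcross ?a ?b $ 3" by (simp_all add: lcross_def)
    then have m: "?a $ 2 * ?b $ 3 = ?a $ 3 * ?b $ 2" "?a $ 3 * ?b $ 1 = ?a $ 1 * ?b $ 3"
      "?a $ 2 * ?b $ 1 = ?a $ 1 * ?b $ 2" using c by simp_all
    have "?a $ i = 0" for i
    proof -
      \<comment> \<open>A vanishing cross product makes all 2 by 2 minors zero, which is this
        dependence for each \<open>i\<close>; independence of the partials then forces its
        coefficients to vanish.\<close>
      have "(?b $ i) *\<^sub>R ?a + (- ?a $ i) *\<^sub>R ?b = 0"
        unfolding vec_eq_iff forall_3 using m by (cases i rule: exhaust_3[THEN disjE]) (auto simp: algebra_simps)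
      from zero[of "(?b $ i, - ?a $ i)"] this show ?thesis by (simp add: zero_prod_def)
    qed
    then have "?a = 0" by (simp add: vec_eq_iff)
    with zero[of "(1, 0)"] show False by (simp add: zero_prod_def)
  qed
  then have "normal_vector z q (lcross ?a ?b)"
    by (simp add: normal_vector_def lorentz_lcross trip_degenerate)
  then have "lorentz (lcross ?a ?b) (lcross ?a ?b) > 0"
    using S z q by (auto simp: time_like_surface_def)
  then show ?thesis by (simp add: lorentz_lcross_self)
qed

lemma Gauss_curvature_eq:
  assumes "coef_W z q > 0"
  shows "Gauss_curvature z q = ((sM z q)\<^sup>2 - sL z q * sN z q) / (coef_W z q)\<^sup>2"
proof -
  have e: "coef_E z q * coef_G z q - (coef_F z q)\<^sup>2 = - coef_W z q" by (simp add: coef_W)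
  show ?thesis
    unfolding Gauss_curvature_def e second_form_eq[OF assms]
    using assms by (simp add: field_simps power2_eq_square)
qed

text \<open>When \<open>L = N = 0\<close>, with \<open>m = sM\<close> one has
  \<open>K = m^2 / W^2\<close> and \<open>H^2 = F^2 m^2 / W^3\<close>. Hence \<open>K > H^2\<close>
  says \<open>F^2 < W = F^2 - E G\<close>: one asymptotic direction is space-like and the other
  time-like.\<close>

lemma EG_negative:
  assumes W: "coef_W z q > 0" and LN: "sL z q = 0" "sN z q = 0"
    and KH: "Gauss_curvature z q - (mean_curvature z q)\<^sup>2 > 0"
  shows "coef_E z q * coef_G z q < 0"
proof -
  let ?W = "coef_W z q" and ?m = "sM z q" and ?F = "coef_F z q"
  have e: "coef_E z q * coef_G z q - (coef_F z q)\<^sup>2 = - ?W" by (simp add: coef_W)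
  have "mean_curvature z q = ?F * (?m / sqrt ?W) / ?W"
    unfolding mean_curvature_def e second_form_eq[OF W] LN by simp
  then have "(mean_curvature z q)\<^sup>2 = ?F\<^sup>2 * ?m\<^sup>2 / (?W * ?W\<^sup>2)"
    using W by (simp add: power_mult_distrib power_divide)
  moreover have "Gauss_curvature z q = ?m\<^sup>2 / ?W\<^sup>2"
    using Gauss_curvature_eq[OF W] LN by simp
  ultimately have "?F\<^sup>2 * ?m\<^sup>2 / (?W * ?W\<^sup>2) < ?m\<^sup>2 / ?W\<^sup>2" using KH by simp
  then have "?F\<^sup>2 * ?m\<^sup>2 / (?W * ?W\<^sup>2) * (?W * ?W\<^sup>2) < ?m\<^sup>2 / ?W\<^sup>2 * (?W * ?W\<^sup>2)"
    using W by (intro mult_strict_right_mono) simp_all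
  then have "?F\<^sup>2 * ?m\<^sup>2 < ?W * ?m\<^sup>2"
    using W by (simp add: mult.commute)
  then have "?F\<^sup>2 < ?W" by (simp add: mult_less_cancel_right)
  then show ?thesis by (simp add: coef_W)
qed

text \<open>The second form carries one extra factor \<open>a * d - c * b\<close> compared with the
  usual tensor rule, because the unnormalised normal is multiplied by the Jacobian as well.\<close>

lemma forms_compose:
  fixes x :: "real \<times> real \<Rightarrow> real ^ 3"
  assumes "open U" "smooth_on U x" "open D" "smooth_on D \<Phi>" "\<And>q. q \<in> D \<Longrightarrow> \<Phi> q \<in> U" and "q \<in> D"
  defines "z \<equiv> \<lambda>q. x (\<Phi> q)"
  assumes u: "pd_u \<Phi> q = (a, c)" and v: "pd_v \<Phi> q = (b, d)"
  shows "coef_E z q = a\<^sup>2 * coef_E x (\<Phi> q) + 2 * a * c * coef_F x (\<Phi> q) + c\<^sup>2 * coef_G x (\<Phi> q)"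
    and "coef_F z q = a * b * coef_E x (\<Phi> q) + (a * d + c * b) * coef_F x (\<Phi> q) + c * d * coef_G x (\<Phi> q)"
    and "coef_G z q = b\<^sup>2 * coef_E x (\<Phi> q) + 2 * b * d * coef_F x (\<Phi> q) + d\<^sup>2 * coef_G x (\<Phi> q)"
    and "coef_W z q = (a * d - c * b)\<^sup>2 * coef_W x (\<Phi> q)"
    and "sL z q = (a * d - c * b) * (a\<^sup>2 * sL x (\<Phi> q) + 2 * a * c * sM x (\<Phi> q) + c\<^sup>2 * sN x (\<Phi> q))"
    and "sM z q = (a * d - c * b) * (a * b * sL x (\<Phi> q) + (a * d + c * b) * sM x (\<Phi> q) + c * d * sN x (\<Phi> q))"
    and "sN z q = (a * d - c * b) * (b\<^sup>2 * sL x (\<Phi> q) + 2 * b * d * sM x (\<Phi> q) + d\<^sup>2 * sN x (\<Phi> q))"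
proof -
  let ?a = "pd_u x (\<Phi> q)" and ?b = "pd_v x (\<Phi> q)"
  note c2' = second_partials_compose[OF assms(1-6), unfolded u v fst_conv snd_conv]
  have z: "(\<lambda>q. x (\<Phi> q)) = z" by (simp add: z_def)
  note c2 = c2'[unfolded z]
  have zu: "pd_u z q = a *\<^sub>R ?a + c *\<^sub>R ?b" and zv: "pd_v z q = b *\<^sub>R ?a + d *\<^sub>R ?b"
    using c2(1,2) by (simp_all only:)
  have lin: "trip (a *\<^sub>R ?a + c *\<^sub>R ?b) (b *\<^sub>R ?a + d *\<^sub>R ?b) w = (a * d - c * b) * trip ?a ?b w" for w
    by (simp add: trip_linear trip_degenerate trip_swap(1)[of ?b] algebra_simps)
  show E: "coef_E z q = a\<^sup>2 * coef_E x (\<Phi> q) + 2 * a * c * coef_F x (\<Phi> q) + c\<^sup>2 * coef_G x (\<Phi> q)"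
    and F: "coef_F z q = a * b * coef_E x (\<Phi> q) + (a * d + c * b) * coef_F x (\<Phi> q) + c * d * coef_G x (\<Phi> q)"
    and G: "coef_G z q = b\<^sup>2 * coef_E x (\<Phi> q) + 2 * b * d * coef_F x (\<Phi> q) + d\<^sup>2 * coef_G x (\<Phi> q)"
    unfolding coef_E_def coef_F_def coef_G_def zu zv
    by (simp_all add: lorentz_linear lorentz_sym[of ?b ?a] power2_eq_square algebra_simps)
  show "coef_W z q = (a * d - c * b)\<^sup>2 * coef_W x (\<Phi> q)"
    unfolding coef_W E F G by algebra
  show "sL z q = (a * d - c * b) * (a\<^sup>2 * sL x (\<Phi> q) + 2 * a * c * sM x (\<Phi> q) + c\<^sup>2 * sN x (\<Phi> q))"
    using c2(3) unfolding zu zv lin by (auto simp: trip_linear trip_degenerate)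
  show "sN z q = (a * d - c * b) * (b\<^sup>2 * sL x (\<Phi> q) + 2 * b * d * sM x (\<Phi> q) + d\<^sup>2 * sN x (\<Phi> q))"
    using c2(4) unfolding zu zv lin by (auto simp: trip_linear trip_degenerate)
  show "sM z q = (a * d - c * b) * (a * b * sL x (\<Phi> q) + (a * d + c * b) * sM x (\<Phi> q) + c * d * sN x (\<Phi> q))"
    using c2(5) unfolding zu zv lin by (auto simp: trip_linear trip_degenerate)
qed

lemma smooth_on_lorentz:
  "open S \<Longrightarrow> smooth_on S f \<Longrightarrow> smooth_on S g \<Longrightarrow> smooth_on S (\<lambda>x. lorentz (f x) (g x))"
  unfolding lorentz_def by (intro smooth_on_add smooth_on_diff smooth_on_mult smooth_on_nth)

lemma smooth_on_trip:
  "open S \<Longrightarrow> smooth_on S f \<Longrightarrow> smooth_on S g \<Longrightarrow> smooth_on S h \<Longrightarrow> smooth_on S (\<lambda>x. trip (f x) (g x) (h x))"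
  unfolding trip_expand by (intro smooth_on_add smooth_on_diff smooth_on_mult smooth_on_nth)

lemma smooth_on_forms:
  assumes "open U" "smooth_on U z"
  shows "smooth_on U (coef_E z)" "smooth_on U (coef_F z)" "smooth_on U (coef_G z)"
    "smooth_on U (\<lambda>q. coef_W z q)" "smooth_on U (\<lambda>q. sL z q)" "smooth_on U (\<lambda>q. sM z q)" "smooth_on U (\<lambda>q. sN z q)"
proof -
  show E: "smooth_on U (coef_E z)" and F: "smooth_on U (coef_F z)" and G: "smooth_on U (coef_G z)"
    unfolding coef_E_def[abs_def] coef_F_def[abs_def] coef_G_def[abs_def]
    by (intro smooth_on_lorentz smooth_on_pd assms)+
  show "smooth_on U (\<lambda>q. coef_W z q)"
    unfolding coef_W by (intro smooth_on_diff smooth_on_mult smooth_on_power2 E F G assms)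
  show "smooth_on U (\<lambda>q. sL z q)" "smooth_on U (\<lambda>q. sM z q)" "smooth_on U (\<lambda>q. sN z q)"
    by (intro smooth_on_trip smooth_on_pd assms)+
qed

subsection \<open>Existence of asymptotic parameters\<close>

lemma indefinite_form_null_directions:
  fixes l m n :: real
  assumes "m\<^sup>2 - l * n > 0"
  obtains a b c d where "l * a\<^sup>2 + 2 * m * a * c + n * c\<^sup>2 = 0" "l * b\<^sup>2 + 2 * m * b * d + n * d\<^sup>2 = 0"
    "a * d - c * b \<noteq> 0"
proof (cases "l = 0")
  case True
  then show thesis
    \<comment> \<open>For \<open>l = 0\<close> the form factors as
      \<open>c * (2 * m * a + n * c)\<close>, which shows both null directions; their determinant is
      \<open>2 * m\<close>.\<close>
    using assms by (intro that[of 1 0 "- n" "2 * m"]) (auto simp: power2_eq_square)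
next
  case False
  define w where "w = sqrt (m\<^sup>2 - l * n)"
  have w: "w\<^sup>2 = m\<^sup>2 - l * n" "w > 0" using assms by (auto simp: w_def)
  show thesis
  proof (rule that[of "- m + w" l "- m - w" l])
    show "l * (- m + w)\<^sup>2 + 2 * m * (- m + w) * l + n * l\<^sup>2 = 0"
      "l * (- m - w)\<^sup>2 + 2 * m * (- m - w) * l + n * l\<^sup>2 = 0"
      using w(1) by algebra+
    have "(- m + w) * l - l * (- m - w) = 2 * (w * l)" by (simp add: algebra_simps)
    then show "(- m + w) * l - l * (- m - w) \<noteq> 0" using False w by simp
  qed
qed

text \<open>An affine change of parameters whose matrix columns are the two null directions of the
  second form makes the axes asymptotic at \<open>p\<close> alone. This is enough to start the
  equations for the slopes with value zero.\<close>

lemma asymptotic_at_point: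
  assumes S: "time_like_surface S"
    and K: "\<And>U z q. local_parametrization S U z \<Longrightarrow> q \<in> U \<Longrightarrow> Gauss_curvature z q > 0"
    and KH: "\<And>U z q. local_parametrization S U z \<Longrightarrow> q \<in> U \<Longrightarrow>
      Gauss_curvature z q - (mean_curvature z q)\<^sup>2 > 0"
    and "p \<in> S"
  obtains U x where "local_parametrization S U x" "0 \<in> U" "x 0 = p" "sL x 0 = 0" "sN x 0 = 0"
    "coef_E x 0 > 0" "coef_G x 0 < 0"
proof -
  obtain U0 x0 q0 where x0: "local_parametrization S U0 x0" "q0 \<in> U0" "x0 q0 = p"
    using S \<open>p \<in> S\<close> unfolding time_like_surface_def regular_surface_def image_iff by metis
  have U0: "open U0" "smooth_on U0 x0" using x0 by (auto simp: local_parametrization_def)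
  have W: "coef_W x0 q0 > 0" by (rule coef_W_pos[OF S x0(1,2)])
  have "(sM x0 q0)\<^sup>2 - sL x0 q0 * sN x0 q0 > 0"
    using K[OF x0(1,2)] W unfolding Gauss_curvature_eq[OF W] by (simp add: zero_less_divide_iff)
  then obtain a b c d where null: "sL x0 q0 * a\<^sup>2 + 2 * sM x0 q0 * a * c + sN x0 q0 * c\<^sup>2 = 0"
    "sL x0 q0 * b\<^sup>2 + 2 * sM x0 q0 * b * d + sN x0 q0 * d\<^sup>2 = 0" "a * d - c * b \<noteq> 0"
    by (rule indefinite_form_null_directions)
  \<comment> \<open>Stated for any pair of independent null directions, so that it can be used in
    both orders; one of the orders gives the required signs of \<open>E\<close> and
    \<open>G\<close>.\<close>
  have ex: "\<exists>U x. local_parametrization S U x \<and> 0 \<in> U \<and> x 0 = p \<and> sL x 0 = 0 \<and> sN x 0 = 0 \<and>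
      coef_E x 0 = a\<^sup>2 * coef_E x0 q0 + 2 * a * c * coef_F x0 q0 + c\<^sup>2 * coef_G x0 q0 \<and>
      coef_G x 0 = b\<^sup>2 * coef_E x0 q0 + 2 * b * d * coef_F x0 q0 + d\<^sup>2 * coef_G x0 q0"
    if null: "sL x0 q0 * a\<^sup>2 + 2 * sM x0 q0 * a * c + sN x0 q0 * c\<^sup>2 = 0"
    "sL x0 q0 * b\<^sup>2 + 2 * sM x0 q0 * b * d + sN x0 q0 * d\<^sup>2 = 0" "a * d - c * b \<noteq> 0" for a b c d
  proof -
    define \<Phi> where "\<Phi> y = q0 + (fst y *\<^sub>R (a, c) + snd y *\<^sub>R (b, d))" for y :: "real \<times> real"
    define D where "D = \<Phi> -` U0"
    have lin: "bounded_linear (\<lambda>y :: real \<times> real. fst y *\<^sub>R (a, c) + snd y *\<^sub>R (b, d))"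
      by (intro bounded_linear_add bounded_linear_compose[OF bounded_linear_scaleR_left]
          bounded_linear_fst bounded_linear_snd)
    have sm: "smooth_on X \<Phi>" if "open X" for X
      unfolding \<Phi>_def[abs_def]
      by (intro smooth_on_add smooth_on_const that smooth_on_bounded_linear[OF lin that smooth_on_id])
    have D: "open D" unfolding D_def
      by (intro open_vimage U0 smooth_on_continuous sm open_UNIV)
    have "(\<Phi> has_derivative (\<lambda>y. fst y *\<^sub>R (a, c) + snd y *\<^sub>R (b, d))) (at q)" for q
      unfolding \<Phi>_def[abs_def]
      using has_derivative_add[OF has_derivative_const bounded_linear_imp_has_derivative[OF lin]] by simp
    from differentiable_partials(3,4)[OF this]
    have pd: "pd_u \<Phi> q = (a, c)" "pd_v \<Phi> q = (b, d)" for q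
      by (cases q; simp)+
    have inj: "inj_on \<Phi> D"
    proof (rule inj_onI)
      fix x y assume "\<Phi> x = \<Phi> y"
      then have e: "fst x *\<^sub>R (a, c) + snd x *\<^sub>R (b, d) = fst y *\<^sub>R (a, c) + snd y *\<^sub>R (b, d)"
        by (simp only: \<Phi>_def add_left_cancel)
      obtain h k where hk: "fst y *\<^sub>R (a, c) + snd y *\<^sub>R (b, d) = (h, k)" by force
      from cramer_2[OF null(3), of "fst x" "snd x" h k] cramer_2[OF null(3), of "fst y" "snd y" h k] e hk
      show "x = y" by (metis prod.collapse)
    qed
    have z: "local_parametrization S D (\<lambda>q. x0 (\<Phi> q))"
      by (rule local_parametrization_compose[OF x0(1) D sm[OF D] _ inj])
        (use null(3) in \<open>auto simp: D_def jac_def pd\<close>)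
    have \<Phi>0: "\<Phi> 0 = q0" by (simp add: \<Phi>_def zero_prod_def)
    then have D0: "0 \<in> D" using x0 by (simp add: D_def)
    note fc = forms_compose[OF U0 D sm[OF D] _ D0 pd, unfolded \<Phi>0]
    show ?thesis
    proof (intro exI conjI)
      show "local_parametrization S D (\<lambda>q. x0 (\<Phi> q))" by (rule z)
    qed (use D0 \<Phi>0 x0(3) null fc in \<open>auto simp: D_def mult_ac\<close>)
  qed
  obtain U x where x: "local_parametrization S U x" "0 \<in> U" "x 0 = p" "sL x 0 = 0" "sN x 0 = 0"
      "coef_E x 0 = a\<^sup>2 * coef_E x0 q0 + 2 * a * c * coef_F x0 q0 + c\<^sup>2 * coef_G x0 q0"
      "coef_G x 0 = b\<^sup>2 * coef_E x0 q0 + 2 * b * d * coef_F x0 q0 + d\<^sup>2 * coef_G x0 q0"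
    using ex[OF null] by blast
  have "b * c - d * a \<noteq> 0" using null(3) by (simp add: mult.commute)
  then obtain U' x' where x': "local_parametrization S U' x'" "0 \<in> U'" "x' 0 = p" "sL x' 0 = 0" "sN x' 0 = 0"
      "coef_E x' 0 = b\<^sup>2 * coef_E x0 q0 + 2 * b * d * coef_F x0 q0 + d\<^sup>2 * coef_G x0 q0"
      "coef_G x' 0 = a\<^sup>2 * coef_E x0 q0 + 2 * a * c * coef_F x0 q0 + c\<^sup>2 * coef_G x0 q0"
    using ex[OF null(2,1)] by blast
  have "coef_E x 0 * coef_G x 0 < 0"
    by (rule EG_negative[OF coef_W_pos[OF S x(1,2)] x(4,5) KH[OF x(1,2)]])
  then consider "coef_E x 0 > 0" "coef_G x 0 < 0" | "coef_E x 0 < 0" "coef_G x 0 > 0"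
    by (auto simp: mult_less_0_iff)
  then show thesis
  proof cases
    case 1
    then show ?thesis using that[OF x(1-5)] by blast
  next
    case 2
    then have "coef_E x' 0 > 0" "coef_G x' 0 < 0" using x x' by simp_all
    then show ?thesis using that[OF x'(1-5)] by blast
  qed
qed

lemma asymptotic_parameters_exist:
  assumes S: "time_like_surface S"
    and K: "\<And>U z q. local_parametrization S U z \<Longrightarrow> q \<in> U \<Longrightarrow> Gauss_curvature z q > 0"
    and KH: "\<And>U z q. local_parametrization S U z \<Longrightarrow> q \<in> U \<Longrightarrow>
      Gauss_curvature z q - (mean_curvature z q)\<^sup>2 > 0"
    and "p \<in> S"
  obtains D z where "asymptotic_parameters S D z" "0 \<in> D" "z 0 = p"
proof -
  obtain U x where x: "local_parametrization S U x" "0 \<in> U" "x 0 = p" "sL x 0 = 0" "sN x 0 = 0"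
    "coef_E x 0 > 0" "coef_G x 0 < 0"
    by (rule asymptotic_at_point[OF assms])
  have U: "open U" "smooth_on U x" using x(1) by (auto simp: local_parametrization_def)
  note sm = smooth_on_forms[OF U]
  have disc: "(sM x q)\<^sup>2 - sL x q * sN x q > 0" if "q \<in> U" for q
    using K[OF x(1) that] coef_W_pos[OF S x(1) that]
    by (simp add: Gauss_curvature_eq zero_less_divide_iff)
  \<comment> \<open>With this sign, \<open>sM\<close> and \<open>\<epsilon> * w\<close> agree in
    sign on \<open>W\<close>, so their sum \<open>e\<close> has no zeros there.\<close>
  define \<epsilon> where "\<epsilon> = sgn (sM x 0)"
  have m0: "sM x 0 \<noteq> 0" using disc[OF x(2)] x(4,5) by auto
  then have \<epsilon>: "\<epsilon> * \<epsilon> = 1" "\<epsilon> * sM x 0 > 0" by (auto simp: \<epsilon>_def sgn_if)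
  define W where "W = {q \<in> U. \<epsilon> * sM x q \<in> {0<..}}"
  have W: "open W" "0 \<in> W" "W \<subseteq> U"
    unfolding W_def using \<epsilon> x(2) open_smooth_preimage[OF U(1) smooth_on_mult[OF U(1) smooth_on_const sm(6)] open_greaterThan]
    by auto
  define w where "w q = sqrt ((sM x q)\<^sup>2 - sL x q * sN x q)" for q
  define e where "e q = sM x q + \<epsilon> * w q" for q
  have w: "(w q)\<^sup>2 = (sM x q)\<^sup>2 - sL x q * sN x q" "w q > 0" if "q \<in> W" for q
    using disc[of q] that W by (auto simp: w_def)
  have e: "e q \<noteq> 0" if "q \<in> W" for q
  proof -
    have "\<epsilon> * e q = \<epsilon> * sM x q + (\<epsilon> * \<epsilon>) * w q" by (simp add: e_def algebra_simps)
    then have "\<epsilon> * e q > 0" using \<epsilon>(1) w(2)[OF that] that by (simp add: W_def)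
    then show ?thesis by auto
  qed
  have smW: "smooth_on W (\<lambda>q. sL x q)" "smooth_on W (\<lambda>q. sM x q)" "smooth_on W (\<lambda>q. sN x q)"
    using sm(5-7) W(3) by (auto intro: smooth_on_subset)
  have sme: "smooth_on W e"
    unfolding e_def[abs_def] w_def[abs_def]
    by (intro smooth_on_add smooth_on_mult smooth_on_const smooth_on_sqrt smooth_on_diff
        smooth_on_power2 smW W(1)) (use disc W(3) in auto)
  \<comment> \<open>Rationalised roots: \<open>(- sM + \<epsilon> * w) / sN\<close> equals
    \<open>- sL / e\<close> where \<open>sN\<close> is nonzero, and symmetrically for
    \<open>Q\<close>. This form stays smooth where \<open>sL\<close> or \<open>sN\<close> vanishes
    and is zero at the origin.\<close>
  define P Q where "P q = - sL x q / e q" and "Q q = - sN x q / e q" for q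
  have smPQ: "smooth_on W P" "smooth_on W Q"
    unfolding P_def[abs_def] Q_def[abs_def]
    by (intro smooth_on_divide smooth_on_minus smW sme W(1) e; assumption)+
  have root: "sL x q + 2 * P q * sM x q + (P q)\<^sup>2 * sN x q = 0"
    "sN x q + 2 * Q q * sM x q + (Q q)\<^sup>2 * sL x q = 0" if "q \<in> W" for q
  proof -
    have "(e q - sM x q)\<^sup>2 = (sM x q)\<^sup>2 - sL x q * sN x q"
      using \<epsilon>(1) w(1)[OF that] by (simp add: e_def power_mult_distrib power2_eq_square[of \<epsilon>])
    then have 1: "(e q)\<^sup>2 - 2 * e q * sM x q + sL x q * sN x q = 0" by algebra
    have "P q * e q = - sL x q" "Q q * e q = - sN x q" using e[OF that] by (simp_all add: P_def Q_def)
    then have "(e q)\<^sup>2 * (sL x q + 2 * P q * sM x q + (P q)\<^sup>2 * sN x q) = 0"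
      "(e q)\<^sup>2 * (sN x q + 2 * Q q * sM x q + (Q q)\<^sup>2 * sL x q) = 0"
      using 1 by algebra+
    then show "sL x q + 2 * P q * sM x q + (P q)\<^sup>2 * sN x q = 0"
      "sN x q + 2 * Q q * sM x q + (Q q)\<^sup>2 * sL x q = 0" using e[OF that] by simp_all
  qed
  have PQ0: "P 0 = 0" "Q 0 = 0" using x(4,5) by (simp_all add: P_def Q_def)
  then have "P 0 * Q 0 \<noteq> 1" by simp
  then obtain D \<Phi> where D: "open D" "0 \<in> D" "\<Phi> 0 = 0" "smooth_on D \<Phi>" "\<Phi> ` D \<subseteq> W" "inj_on \<Phi> D"
    "\<And>x. x \<in> D \<Longrightarrow> jac \<Phi> x \<noteq> 0"
    "\<And>x. x \<in> D \<Longrightarrow> snd (pd_u \<Phi> x) = P (\<Phi> x) * fst (pd_u \<Phi> x)"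
    "\<And>x. x \<in> D \<Longrightarrow> fst (pd_v \<Phi> x) = Q (\<Phi> x) * snd (pd_v \<Phi> x)"
    using straighten_direction_fields[OF W(1,2) smPQ] by blast
  define z where "z q = x (\<Phi> q)" for q
  have z: "local_parametrization S D z"
    unfolding z_def[abs_def]
    by (rule local_parametrization_compose[OF x(1) D(1,4) _ D(6,7)]) (use D(5) W(3) in auto)
  have smz: "smooth_on D z" using z by (simp add: local_parametrization_def)
  have fc: "sL z q = 0" "sN z q = 0"
    "coef_E z q = (fst (pd_u \<Phi> q))\<^sup>2 * (coef_E x (\<Phi> q) + 2 * P (\<Phi> q) * coef_F x (\<Phi> q) + (P (\<Phi> q))\<^sup>2 * coef_G x (\<Phi> q))"
    "coef_G z q = (snd (pd_v \<Phi> q))\<^sup>2 * (coef_G x (\<Phi> q) + 2 * Q (\<Phi> q) * coef_F x (\<Phi> q) + (Q (\<Phi> q))\<^sup>2 * coef_E x (\<Phi> q))"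
    if q: "q \<in> D" for q
  proof -
    have \<Phi>: "\<Phi> y \<in> U" if "y \<in> D" for y using that D(5) W(3) by auto
    have "pd_u \<Phi> q = (fst (pd_u \<Phi> q), P (\<Phi> q) * fst (pd_u \<Phi> q))"
      "pd_v \<Phi> q = (Q (\<Phi> q) * snd (pd_v \<Phi> q), snd (pd_v \<Phi> q))"
      using D(8,9)[OF q] by (metis prod.collapse)+
    note fc = forms_compose[OF U D(1,4) \<Phi> q this, folded z_def[abs_def], simplified]
    have "\<Phi> q \<in> W" using D(5) q by auto
    note r = root[OF this]
    show "coef_E z q = (fst (pd_u \<Phi> q))\<^sup>2 * (coef_E x (\<Phi> q) + 2 * P (\<Phi> q) * coef_F x (\<Phi> q) + (P (\<Phi> q))\<^sup>2 * coef_G x (\<Phi> q))"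
      "coef_G z q = (snd (pd_v \<Phi> q))\<^sup>2 * (coef_G x (\<Phi> q) + 2 * Q (\<Phi> q) * coef_F x (\<Phi> q) + (Q (\<Phi> q))\<^sup>2 * coef_E x (\<Phi> q))"
      unfolding fc by algebra+
    show "sL z q = 0" "sN z q = 0" unfolding fc using r by algebra+
  qed
  \<comment> \<open>The signs of \<open>E\<close> and \<open>G\<close> are known at 0 and persist
    nearby by continuity; the domain is cut down accordingly.\<close>
  define D' where "D' = {q \<in> D. coef_E z q \<in> {0<..}} \<inter> {q \<in> D. coef_G z q \<in> {..<0}}"
  have D': "open D'" "D' \<subseteq> D"
    unfolding D'_def using smooth_on_forms[OF D(1) smz]
    by (intro conjI open_Int open_smooth_preimage[OF D(1)]) auto
  have "fst (pd_u \<Phi> 0) \<noteq> 0" "snd (pd_v \<Phi> 0) \<noteq> 0"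
    using D(7-9)[OF D(2)] by (auto simp: jac_def)
  then have "coef_E z 0 > 0" "coef_G z 0 < 0"
    using fc(3,4)[OF D(2)] D(3) PQ0 x(6,7) by (simp_all add: mult_pos_neg)
  then have 0: "0 \<in> D'" using D(2) by (simp add: D'_def)
  have "asymptotic_parameters S D' z"
    unfolding asymptotic_parameters_def
  proof (intro conjI ballI)
    show "local_parametrization S D' z" by (rule local_parametrization_subset[OF z D'])
    fix q assume q: "q \<in> D'"
    then show "coef_E z q > 0" "coef_G z q < 0" by (auto simp: D'_def)
    have "q \<in> D" using q D' by auto
    then show "coef_L z q = 0" "coef_N z q = 0"
      using second_form_eq[OF coef_W_pos[OF S z]] fc by simp_all
  qed
  moreover have "z 0 = p" by (simp add: z_def D(3) x(3))
  ultimately show thesis using that 0 by blast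
qed

subsection \<open>The Codazzi equations in asymptotic parameters\<close>

lemma trip_has_derivative:
  assumes "(a has_vector_derivative a') (at t)" "(b has_vector_derivative b') (at t)"
    "(c has_vector_derivative c') (at t)"
  shows "((\<lambda>t. trip (a t) (b t) (c t)) has_real_derivative
    trip a' (b t) (c t) + trip (a t) b' (c t) + trip (a t) (b t) c') (at t)"
proof -
  have comp: "((\<lambda>t. f t $ i) has_real_derivative f' $ i) (at t)"
    if "(f has_vector_derivative f') (at t)" for f :: "real \<Rightarrow> real ^ 3" and f' i
    using bounded_linear.has_vector_derivative[OF bounded_linear_vec_nth that]
    by (simp add: has_real_derivative_iff_has_vector_derivative)
  note c = comp[OF assms(1)] comp[OF assms(2)] comp[OF assms(3)]
  show ?thesis
    unfolding trip_expand
    by (rule DERIV_cong, (rule DERIV_add DERIV_mult DERIV_diff c)+) (simp add: algebra_simps)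
qed

lemma lorentz_has_derivative:
  assumes "(a has_vector_derivative a') (at t)" "(b has_vector_derivative b') (at t)"
  shows "((\<lambda>t. lorentz (a t) (b t)) has_real_derivative lorentz a' (b t) + lorentz (a t) b') (at t)"
proof -
  have comp: "((\<lambda>t. f t $ i) has_real_derivative f' $ i) (at t)"
    if "(f has_vector_derivative f') (at t)" for f :: "real \<Rightarrow> real ^ 3" and f' i
    using bounded_linear.has_vector_derivative[OF bounded_linear_vec_nth that]
    by (simp add: has_real_derivative_iff_has_vector_derivative)
  note c = comp[OF assms(1)] comp[OF assms(2)]
  show ?thesis
    unfolding lorentz_def
    by (rule DERIV_cong, (rule DERIV_add DERIV_mult DERIV_diff c)+) (simp add: algebra_simps)
qed

lemma ln_sqrt_has_derivative:
  fixes f :: "real \<Rightarrow> real"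
  assumes "(f has_real_derivative f') (at x)" "f x > 0"
  shows "((\<lambda>x. ln (sqrt (f x))) has_real_derivative f' / (2 * f x)) (at x)"
proof -
  have "inverse r * (inverse r / 2 * f') = f' / (2 * (r * r))" for r :: real
    by (cases "r = 0") (simp_all add: field_simps)
  from this[of "sqrt (f x)"]
  have "inverse (sqrt (f x)) * (inverse (sqrt (f x)) / 2 * f') = f' / (2 * f x)"
    using assms(2) by simp
  moreover have "((\<lambda>x. ln (sqrt (f x))) has_real_derivative
      inverse (sqrt (f x)) * (inverse (sqrt (f x)) / 2 * f')) (at x)"
    using assms by (intro DERIV_chain2[OF DERIV_ln] DERIV_chain2[OF DERIV_real_sqrt]) simp_all
  ultimately show ?thesis by (simp only:)
qed

lemma gram_has_derivative:
  assumes "(a has_vector_derivative a') (at t)" "(b has_vector_derivative b') (at t)"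
  shows "((\<lambda>t. gram (a t) (b t)) has_real_derivative
    2 * lorentz (a t) (b t) * (lorentz a' (b t) + lorentz (a t) b')
    - 2 * lorentz a' (a t) * lorentz (b t) (b t) - 2 * lorentz (a t) (a t) * lorentz b' (b t)) (at t)"
  unfolding gram_def power2_eq_square
  by (rule DERIV_cong, (rule DERIV_mult DERIV_diff lorentz_has_derivative assms)+)
    (simp add: lorentz_sym[of _ a'] lorentz_sym[of _ b'] algebra_simps)

text \<open>The vectors stand for \<open>a = z\<^sub>u\<close>, \<open>b = z\<^sub>v\<close>, \<open>A = z\<^sub>u\<^sub>u\<close>, \<open>B = z\<^sub>u\<^sub>v\<close>, \<open>C = z\<^sub>v\<^sub>v\<close> and
  \<open>B' = z\<^sub>u\<^sub>u\<^sub>v\<close>; the third equation is the derivative of \<open>trip z\<^sub>u z\<^sub>v z\<^sub>u\<^sub>u = 0\<close> with respect to \<open>v\<close>.\<close>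

lemma codazzi_algebra:
  assumes W: "gram a b \<noteq> 0" and m: "trip a b B \<noteq> 0"
    and A: "trip a b A = 0" and C: "trip a b C = 0"
    and dL: "trip B b A + trip a C A + trip a b B' = 0"
  shows "((2 * lorentz a b * (lorentz A b + lorentz a B) - 2 * lorentz A a * lorentz b b
      - 2 * lorentz a a * lorentz B b) / gram a b
    - (trip A b B + trip a B B + trip a b B') / trip a b B) / 2
    = (lorentz a b * lorentz B a - lorentz a a * lorentz B b) / gram a b"
proof -
  \<comment> \<open>As \<open>L = N = 0\<close>, the vectors \<open>z_uu\<close> and
    \<open>z_vv\<close> are tangential. The coefficient \<open>k\<close> of \<open>z_uu\<close>
    along \<open>z_u\<close> enters the logarithmic derivatives of \<open>gram a b\<close> and of
    \<open>trip a b B\<close> equally, as \<open>2 * k\<close>, and cancels in their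
    difference.\<close>
  obtain k l where Akl: "A = k *\<^sub>R a + l *\<^sub>R b" using coplanar_decomposition[OF W A] .
  obtain k' l' where Ckl: "C = k' *\<^sub>R a + l' *\<^sub>R b" using coplanar_decomposition[OF W C] .
  have "trip B b A = - k * trip a b B" "trip a C A = 0" "trip A b B = k * trip a b B" "trip a B B = 0"
    unfolding Akl Ckl by (simp_all add: trip_expand algebra_simps)
  then have e1: "trip A b B + trip a B B + trip a b B' = 2 * k * trip a b B" using dL by simp
  have e2: "2 * lorentz a b * (lorentz A b + lorentz a B) - 2 * lorentz A a * lorentz b b
      - 2 * lorentz a a * lorentz B b
      = 2 * k * gram a b + 2 * (lorentz a b * lorentz B a - lorentz a a * lorentz B b)"
    unfolding Akl gram_def
    by (simp add: lorentz_linear lorentz_sym[of b a] lorentz_sym[of a B] power2_eq_square algebra_simps)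
  show ?thesis unfolding e1 e2 using W m by (simp add: field_simps)
qed

lemma pd_eqI:
  "((\<lambda>t. g (t, v)) has_real_derivative y) (at u) \<Longrightarrow> pd_u g (u, v) = y"
  "((\<lambda>s. g (u, s)) has_real_derivative y) (at v) \<Longrightarrow> pd_v g (u, v) = y"
  by (simp_all add: pd_u_def pd_v_def has_real_derivative_iff_has_vector_derivative vector_derivative_at)

lemma asymptotic_parametersD:
  assumes S: "time_like_surface S"
    and K: "\<forall>U z. local_parametrization S U z \<longrightarrow> (\<forall>q\<in>U. Gauss_curvature z q > 0)"
    and z: "asymptotic_parameters S D z"
  shows "open D" "smooth_on D z"
    and "\<And>q. q \<in> D \<Longrightarrow> coef_W z q > 0" "\<And>q. q \<in> D \<Longrightarrow> sL z q = 0" "\<And>q. q \<in> D \<Longrightarrow> sN z q = 0"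
      "\<And>q. q \<in> D \<Longrightarrow> sM z q \<noteq> 0" "\<And>q. q \<in> D \<Longrightarrow> coef_E z q > 0" "\<And>q. q \<in> D \<Longrightarrow> coef_G z q < 0"
proof -
  have lp: "local_parametrization S D z" using z by (simp add: asymptotic_parameters_def)
  then show "open D" "smooth_on D z" by (simp_all add: local_parametrization_def)
  fix q assume q: "q \<in> D"
  show W: "coef_W z q > 0" by (rule coef_W_pos[OF S lp q])
  show L: "sL z q = 0" "sN z q = 0"
    using z q second_form_eq(1,3)[OF W] W by (auto simp: asymptotic_parameters_def)
  show "sM z q \<noteq> 0"
  proof -
    have "Gauss_curvature z q > 0" using K lp q by blast
    then show ?thesis unfolding Gauss_curvature_eq[OF W] L by auto
  qed
  show "coef_E z q > 0" "coef_G z q < 0" using z q by (auto simp: asymptotic_parameters_def)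
qed

lemma ln_power2: "x \<noteq> 0 \<Longrightarrow> ln (x\<^sup>2) = 2 * ln \<bar>x\<bar>" for x :: real
  using ln_realpow[of "\<bar>x\<bar>" 2] by simp

text \<open>Here \<open>1 + a^2 = W / (- E G)\<close> and \<open>\<alpha>\<close> has the
  denominator \<open>sqrt (- E G)\<close> as well, so \<open>E\<close> and \<open>G\<close> cancel.
  What remains is minus the logarithm of the fourth root of \<open>K = sM^2 / W^2\<close>.\<close>

lemma asym_f_eq:
  assumes W: "coef_W z q > 0" and m: "sM z q \<noteq> 0" and E: "coef_E z q > 0" and G: "coef_G z q < 0"
  shows "asym_f z q = (ln (coef_W z q) - ln \<bar>sM z q\<bar>) / 2"
proof -
  let ?W = "coef_W z q" and ?E = "coef_E z q" and ?m = "sM z q"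
  define g where "g = - coef_G z q"
  have g: "g > 0" "coef_G z q = - g" using G by (simp_all add: g_def)
  have "1 + (asym_a z q)\<^sup>2 = ?W / (?E * g)"
    using E g by (simp add: asym_a_def power_divide power_mult_distrib coef_W field_simps)
  then have "ln (sqrt (1 + (asym_a z q)\<^sup>2)) = (ln ?W - (ln ?E + ln g)) / 2"
    using W E g by (simp add: ln_sqrt ln_div ln_mult)
  moreover have "\<bar>asym_alpha z q\<bar> = \<bar>?m\<bar> / sqrt ?W / (sqrt ?E * sqrt g)"
    using W E g by (simp add: asym_alpha_def second_form_eq abs_divide abs_mult)
  then have "ln \<bar>asym_alpha z q\<bar> = ln \<bar>?m\<bar> - ln ?W / 2 - (ln ?E / 2 + ln g / 2)"
    using W E g m by (simp add: ln_sqrt ln_div ln_mult)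
  ultimately show ?thesis unfolding asym_f_def by (simp add: field_simps)
qed

context
  fixes S :: "(real ^ 3) set" and D :: "(real \<times> real) set" and z :: "real \<times> real \<Rightarrow> real ^ 3"
  assumes S: "time_like_surface S"
    and K: "\<forall>U z. local_parametrization S U z \<longrightarrow> (\<forall>q\<in>U. Gauss_curvature z q > 0)"
    and z: "asymptotic_parameters S D z"
begin

lemmas asym = asymptotic_parametersD[OF S K z]

lemma smooth_on_asym_f: "smooth_on D (asym_f z)"
proof (rule smooth_on_cong[OF asym(1)])
  \<comment> \<open>Half the logarithm of the square replaces the logarithm of the absolute value,
    so that the closure rules for smooth functions apply.\<close>
  let ?h = "\<lambda>q. (ln (coef_W z q) - ln ((sM z q)\<^sup>2) / 2) / 2"
  show "?h q = asym_f z q" if "q \<in> D" for q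
    unfolding asym_f_eq[OF asym(3,6,7,8)[OF that]] ln_power2[OF asym(6)[OF that]] by simp
  show "smooth_on D ?h"
    by (intro smooth_on_divide smooth_on_diff smooth_on_ln smooth_on_power2 smooth_on_const
        smooth_on_forms asym(1,2)) (use asym(3,6) in auto)
qed

text \<open>The right-hand sides are Cramer's formulas for the components of \<open>z_uv\<close>
  along \<open>z_v\<close> and along \<open>z_u\<close>, obtained from its scalar products with
  both. The second identity is the first with the roles of the parameters exchanged.\<close>

lemma asym_f_partials:
  assumes uv: "(u, v) \<in> D"
  defines "a \<equiv> pd_u z (u, v)" and "b \<equiv> pd_v z (u, v)" and "B \<equiv> pd_v (pd_u z) (u, v)"
  shows "pd_u (asym_f z) (u, v) = (lorentz a b * lorentz B a - lorentz a a * lorentz B b) / gram a b"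
    and "pd_v (asym_f z) (u, v) = (lorentz a b * lorentz B b - lorentz b b * lorentz B a) / gram a b"
proof -
  note o = asym(1) and sm = asym(2)
  note s1 = smooth_on_pd[OF o sm]
  note s2 = smooth_on_pd[OF o s1(1)] smooth_on_pd[OF o s1(2)]
  define A C Bu Bv where "A = pd_u (pd_u z) (u, v)" and "C = pd_v (pd_v z) (u, v)"
    and "Bu = pd_u (pd_v (pd_u z)) (u, v)" and "Bv = pd_v (pd_v (pd_u z)) (u, v)"
  have comm: "pd_u (pd_v z) q = pd_v (pd_u z) q" if "q \<in> D" for q
    using pd_commute[OF o sm, of "fst q" "snd q"] that by simp
  have comm3: "pd_v (pd_u (pd_u z)) (u, v) = Bu"
    unfolding Bu_def by (rule pd_commute[OF o s1(1) uv])
  have "pd_u (pd_v (pd_v z)) (u, v) = pd_v (pd_u (pd_v z)) (u, v)"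
    by (rule pd_commute[OF o s1(2) uv, symmetric])
  also have "\<dots> = Bv" unfolding Bv_def
    by (rule pd_cong(2)[OF o uv comm smooth_on_differentiable[OF s2(3) uv]])
  finally have comm3': "pd_u (pd_v (pd_v z)) (u, v) = Bv" .
  note du = smooth_on_has_pd(1)[OF s1(1) uv, of UNIV, folded A_def]
    smooth_on_has_pd(1)[OF s1(2) uv, of UNIV, unfolded comm[OF uv], folded B_def]
    smooth_on_has_pd(1)[OF s2(2) uv, of UNIV, folded Bu_def]
    smooth_on_has_pd(1)[OF s2(4) uv, of UNIV, unfolded comm3']
  note dv = smooth_on_has_pd(2)[OF s1(1) uv, of UNIV, folded B_def]
    smooth_on_has_pd(2)[OF s1(2) uv, of UNIV, folded C_def]
    smooth_on_has_pd(2)[OF s2(2) uv, of UNIV, folded Bv_def]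
    smooth_on_has_pd(2)[OF s2(1) uv, of UNIV, unfolded comm3]
  have W: "gram a b > 0" and m: "trip a b B \<noteq> 0" and L: "trip a b A = 0" and N: "trip a b C = 0"
    using asym(3-6)[OF uv] by (simp_all add: a_def b_def A_def B_def C_def)
  \<comment> \<open>Since \<open>sL\<close> vanishes on all of \<open>D\<close>, so does its
    derivative in \<open>v\<close>; this is the Codazzi relation for \<open>z_uuv\<close>. The same
    is done below with \<open>sN\<close> and \<open>u\<close>.\<close>
  have "pd_v (\<lambda>q. sL z q) (u, v) = trip B b A + trip a C A + trip a b Bu"
    using pd_eqI(2)[OF trip_has_derivative[OF dv(1,2,4)]] by (simp add: a_def b_def A_def)
  moreover have "pd_v (\<lambda>q. sL z q) (u, v) = pd_v (\<lambda>q. 0) (u, v)"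
    using smooth_on_forms(5)[OF o sm] asym(4)
    by (intro pd_cong(2)[OF o uv]) (auto intro: smooth_on_differentiable uv)
  moreover have "pd_v (\<lambda>q. 0::real) (u, v) = 0" "pd_u (\<lambda>q. 0::real) (u, v) = 0"
    by (simp_all add: pd_linear[OF bounded_linear_zero])
  ultimately have dL: "trip B b A + trip a C A + trip a b Bu = 0" by simp
  have "pd_u (\<lambda>q. sN z q) (u, v) = trip A b C + trip a B C + trip a b Bv"
    using pd_eqI(1)[OF trip_has_derivative[OF du(1,2,4)]] by (simp add: a_def b_def C_def)
  moreover have "pd_u (\<lambda>q. sN z q) (u, v) = pd_u (\<lambda>q. 0) (u, v)"
    using smooth_on_forms(7)[OF o sm] asym(5)
    by (intro pd_cong(1)[OF o uv]) (auto intro: smooth_on_differentiable uv)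
  moreover have "pd_u (\<lambda>q. 0::real) (u, v) = 0"
    by (simp add: pd_linear[OF bounded_linear_zero])
  ultimately have dN: "trip A b C + trip a B C + trip a b Bv = 0" by simp
  let ?h = "\<lambda>q. (ln (coef_W z q) - ln ((sM z q)\<^sup>2) / 2) / 2"
  have h: "asym_f z q = ?h q" if "q \<in> D" for q
    unfolding asym_f_eq[OF asym(3,6,7,8)[OF that]] ln_power2[OF asym(6)[OF that]] by simp
  have hd: "((\<lambda>t. (ln (w t) - ln ((\<mu> t)\<^sup>2) / 2) / 2) has_real_derivative (w' / w t - \<mu>' / \<mu> t) / 2) (at t)"
    if "(w has_real_derivative w') (at t)" "(\<mu> has_real_derivative \<mu>') (at t)" "w t > 0" "\<mu> t \<noteq> 0"
    for w \<mu> :: "real \<Rightarrow> real" and w' \<mu>' t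
  proof -
    have "\<mu> t * \<mu> t > 0" using that(4) not_real_square_gt_zero by blast
    then show ?thesis using that by (auto intro!: derivative_eq_intros simp: power2_eq_square field_simps)
  qed
  note fd = smooth_on_differentiable[OF smooth_on_asym_f uv]
  have "pd_u (asym_f z) (u, v) = pd_u ?h (u, v)" by (rule pd_cong(1)[OF o uv h fd])
  also have "\<dots> = ((2 * lorentz a b * (lorentz A b + lorentz a B) - 2 * lorentz A a * lorentz b b
      - 2 * lorentz a a * lorentz B b) / gram a b
    - (trip A b B + trip a B B + trip a b Bu) / trip a b B) / 2"
    using pd_eqI(1)[OF hd[OF gram_has_derivative[OF du(1,2)] trip_has_derivative[OF du(1,2,3)]]] W m
    unfolding a_def b_def B_def by blast
  also have "\<dots> = (lorentz a b * lorentz B a - lorentz a a * lorentz B b) / gram a b"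
    using W by (intro codazzi_algebra[OF _ m L N dL]) simp
  finally show "pd_u (asym_f z) (u, v) = (lorentz a b * lorentz B a - lorentz a a * lorentz B b) / gram a b" .
  have "pd_v (asym_f z) (u, v) = pd_v ?h (u, v)" by (rule pd_cong(2)[OF o uv h fd])
  also have "\<dots> = ((2 * lorentz a b * (lorentz B b + lorentz a C) - 2 * lorentz B a * lorentz b b
      - 2 * lorentz a a * lorentz C b) / gram a b
    - (trip B b B + trip a C B + trip a b Bv) / trip a b B) / 2"
    using pd_eqI(2)[OF hd[OF gram_has_derivative[OF dv(1,2)] trip_has_derivative[OF dv(1,2,3)]]] W m
    unfolding a_def b_def B_def by blast
  \<comment> \<open>Rewritten with \<open>a\<close> and \<open>b\<close> exchanged to match
    \<open>codazzi_algebra\<close>. The triple products change sign, but they occur as a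
    quotient.\<close>
  also have "\<dots> = ((2 * lorentz b a * (lorentz C a + lorentz b B) - 2 * lorentz C b * lorentz a a
      - 2 * lorentz b b * lorentz B a) / gram b a
    - (trip C a B + trip b B B + trip b a Bv) / trip b a B) / 2"
  proof -
    have e1: "gram b a = gram a b" by (simp add: gram_def lorentz_sym[of b a])
    have "trip C a B + trip b B B + trip b a Bv = - (trip B b B + trip a C B + trip a b Bv)"
      "trip b a B = - trip a b B"
      by (simp_all add: trip_expand algebra_simps)
    then have e2: "(trip C a B + trip b B B + trip b a Bv) / trip b a B =
        (trip B b B + trip a C B + trip a b Bv) / trip a b B"
      by (simp only: minus_divide_left[symmetric] minus_divide_right[symmetric] minus_minus)
    have e3: "2 * lorentz b a * (lorentz C a + lorentz b B) - 2 * lorentz C b * lorentz a a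
      - 2 * lorentz b b * lorentz B a = 2 * lorentz a b * (lorentz B b + lorentz a C) - 2 * lorentz B a * lorentz b b
      - 2 * lorentz a a * lorentz C b"
      by (simp add: lorentz_sym[of b a] lorentz_sym[of b B] lorentz_sym[of a C] algebra_simps)
    show ?thesis unfolding e1 e2 e3 ..
  qed
  also have "\<dots> = (lorentz b a * lorentz B b - lorentz b b * lorentz B a) / gram b a"
  proof (rule codazzi_algebra)
    show "gram b a \<noteq> 0" using W by (simp add: gram_def lorentz_sym[of b a] mult.commute)
    show "trip b a B \<noteq> 0" "trip b a C = 0" "trip b a A = 0" using m L N by (simp_all add: trip_swap(1)[of a b])
    show "trip B a C + trip b A C + trip b a Bv = 0"
      using dN by (simp add: trip_expand algebra_simps)
  qed
  finally show "pd_v (asym_f z) (u, v) = (lorentz a b * lorentz B b - lorentz b b * lorentz B a) / gram a b"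
    by (simp add: gram_def lorentz_sym[of b a] mult.commute)
qed

text \<open>By the components of \<open>z_uv\<close>, \<open>E_v = 2 (f_v E + f_u F)\<close> and
  \<open>G_u = 2 (f_v F + f_u G)\<close>. Dividing by \<open>2 E\<close> and \<open>2 G\<close>
  gives the integrands, because \<open>a sqrt (- G) / sqrt E = F / E\<close> and
  \<open>- a sqrt E / sqrt (- G) = F / G\<close>.\<close>

lemma codazzi_log_derivatives:
  assumes uv: "(u, v) \<in> D"
  shows "((\<lambda>s. ln (sqrt (coef_E z (u, s)))) has_real_derivative v_integrand z (u, v)) (at v)"
    and "((\<lambda>t. ln (sqrt (- coef_G z (t, v)))) has_real_derivative u_integrand z (u, v)) (at u)"
proof -
  note o = asym(1) and sm = asym(2)
  note s1 = smooth_on_pd[OF o sm]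
  define a b B where "a = pd_u z (u, v)" and "b = pd_v z (u, v)" and "B = pd_v (pd_u z) (u, v)"
  define d1 d2 where "d1 = (lorentz a b * lorentz B b - lorentz b b * lorentz B a) / gram a b"
    and "d2 = (lorentz a b * lorentz B a - lorentz a a * lorentz B b) / gram a b"
  note f = asym_f_partials[OF uv, folded a_def b_def B_def, folded d1_def d2_def]
  have W: "gram a b > 0" using asym(3)[OF uv] by (simp add: a_def b_def)
  have E: "coef_E z (u, v) = lorentz a a" "coef_F z (u, v) = lorentz a b" "coef_G z (u, v) = lorentz b b"
    by (simp_all add: coef_E_def coef_F_def coef_G_def a_def b_def)
  note pos = asym(7,8)[OF uv, unfolded E]
  have g: "gram a b = (lorentz a b)\<^sup>2 - lorentz a a * lorentz b b" by (simp add: gram_def)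
  have d: "d1 * gram a b = lorentz a b * lorentz B b - lorentz b b * lorentz B a"
    "d2 * gram a b = lorentz a b * lorentz B a - lorentz a a * lorentz B b"
    using W by (simp_all add: d1_def d2_def)
  have "gram a b * (lorentz B a - (d1 * lorentz a a + d2 * lorentz a b)) = 0"
    "gram a b * (lorentz B b - (d1 * lorentz a b + d2 * lorentz b b)) = 0"
    using d g by algebra+
  then have B: "lorentz B a = d1 * lorentz a a + d2 * lorentz a b"
    "lorentz B b = d1 * lorentz a b + d2 * lorentz b b" using W by simp_all
  have "((\<lambda>s. coef_E z (u, s)) has_real_derivative 2 * lorentz B a) (at v)"
    unfolding coef_E_def
    using lorentz_has_derivative[OF smooth_on_has_pd(2)[OF s1(1) uv, of UNIV] smooth_on_has_pd(2)[OF s1(1) uv, of UNIV]]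
    by (simp add: a_def B_def lorentz_sym)
  from ln_sqrt_has_derivative[OF this]
  have "((\<lambda>s. ln (sqrt (coef_E z (u, s)))) has_real_derivative lorentz B a / lorentz a a) (at v)"
    using pos(1) by (simp add: E)
  moreover have "v_integrand z (u, v) = lorentz B a / lorentz a a"
  proof -
    have "v_integrand z (u, v) = d1 + lorentz a b / (sqrt (lorentz a a) * sqrt (- lorentz b b)) * d2 *
        (sqrt (- lorentz b b) / sqrt (lorentz a a))"
      unfolding v_integrand_def f asym_a_def E ..
    also have "\<dots> = d1 + lorentz a b * d2 / (sqrt (lorentz a a) * sqrt (lorentz a a))"
      using pos by (simp add: field_simps)
    also have "\<dots> = lorentz B a / lorentz a a"
      using pos by (simp add: B field_simps)
    finally show ?thesis .
  qed
  ultimately show "((\<lambda>s. ln (sqrt (coef_E z (u, s)))) has_real_derivative v_integrand z (u, v)) (at v)"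
    by simp
  have "pd_u (pd_v z) (u, v) = B" unfolding B_def by (rule pd_commute[OF o sm uv, symmetric])
  then have "((\<lambda>t. coef_G z (t, v)) has_real_derivative 2 * lorentz B b) (at u)"
    unfolding coef_G_def
    using lorentz_has_derivative[OF smooth_on_has_pd(1)[OF s1(2) uv, of UNIV] smooth_on_has_pd(1)[OF s1(2) uv, of UNIV]]
    by (simp add: b_def lorentz_sym)
  from ln_sqrt_has_derivative[OF DERIV_minus[OF this]]
  have "((\<lambda>t. ln (sqrt (- coef_G z (t, v)))) has_real_derivative lorentz B b / lorentz b b) (at u)"
    using pos(2) by (simp add: E)
  moreover have "u_integrand z (u, v) = lorentz B b / lorentz b b"
  proof -
    have "u_integrand z (u, v) = - (lorentz a b / (sqrt (lorentz a a) * sqrt (- lorentz b b))) * d1 *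
        (sqrt (lorentz a a) / sqrt (- lorentz b b)) + d2"
      unfolding u_integrand_def f asym_a_def E ..
    also have "\<dots> = - (lorentz a b * d1 / (sqrt (- lorentz b b) * sqrt (- lorentz b b))) + d2"
      using pos by (simp add: field_simps)
    also have "\<dots> = lorentz B b / lorentz b b"
      using pos by (simp add: B field_simps)
    finally show ?thesis .
  qed
  ultimately show "((\<lambda>t. ln (sqrt (- coef_G z (t, v)))) has_real_derivative u_integrand z (u, v)) (at u)"
    by simp
qed

lemma smooth_on_integrands: "smooth_on D (u_integrand z)" "smooth_on D (v_integrand z)"
proof -
  note o = asym(1) and sm = smooth_on_forms[OF asym(1,2)] and sf = smooth_on_pd[OF asym(1) smooth_on_asym_f]
  have E: "smooth_on D (\<lambda>q. sqrt (coef_E z q))" "smooth_on D (\<lambda>q. sqrt (- coef_G z q))"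
    by (intro smooth_on_sqrt smooth_on_minus o sm; use asym(7,8) in simp)+
  have pos: "sqrt (coef_E z q) \<noteq> 0" "sqrt (- coef_G z q) \<noteq> 0" if "q \<in> D" for q
    using asym(7,8)[OF that] by auto
  have a: "smooth_on D (asym_a z)"
    unfolding asym_a_def[abs_def] using pos by (intro smooth_on_divide smooth_on_mult o sm E) auto
  show "smooth_on D (u_integrand z)" "smooth_on D (v_integrand z)"
    unfolding u_integrand_def[abs_def] v_integrand_def[abs_def]
    by (intro smooth_on_add smooth_on_mult smooth_on_divide smooth_on_minus o a sf E pos; assumption)+
qed

end

subsection \<open>Canonical parameters\<close>

lemma smooth_antiderivative:
  fixes g :: "real \<Rightarrow> real"
  assumes "smooth_on {-r<..<r} g"
  obtains H where "smooth_on {-r<..<r} H" "H 0 = 0" "\<And>x. x \<in> {-r<..<r} \<Longrightarrow> (H has_real_derivative g x) (at x)"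
proof -
  define H where "H t = t * integral {0..1} (\<lambda>\<theta>. g (t * \<theta>))" for t
  have H: "(H has_real_derivative g x) (at x)" if "x \<in> {-r<..<r}" for x
    unfolding H_def by (rule scaled_integral_has_derivative[OF smooth_on_continuous[OF assms] that])
  have "smooth_on {-r<..<r} H"
    using Ck_SucD[OF Ck_real_SucI[OF open_greaterThanLessThan H smooth_onD[OF assms]]] by (rule smooth_onI)
  then show thesis using H by (intro that[of H]) (auto simp: H_def)
qed

text \<open>The flow of the equation with right-hand side independent of time, restricted to the
  initial value 0.\<close>

lemma smooth_autonomous_ode:
  fixes \<rho> :: "real \<Rightarrow> real"
  assumes "r > 0" "smooth_on {-r<..<r} \<rho>"
  obtains \<delta> U where "\<delta> > 0" "smooth_on {-\<delta><..<\<delta>} U" "U 0 = 0"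
    "\<And>t. t \<in> {-\<delta><..<\<delta>} \<Longrightarrow> U t \<in> {-r<..<r}"
    "\<And>t. t \<in> {-\<delta><..<\<delta>} \<Longrightarrow> (U has_real_derivative \<rho> (U t)) (at t)"
proof -
  let ?W = "{-r<..<r} \<times> {-r<..<r}"
  have W: "open ?W" "0 \<in> ?W" using assms(1) by (auto simp: open_Times zero_prod_def)
  have sm: "smooth_on ?W (\<lambda>p. \<rho> (fst p))"
    by (rule smooth_on_compose[OF W(1) open_greaterThanLessThan _ smooth_on_fst[OF W(1) smooth_on_id] assms(2)]) auto
  obtain \<delta> \<sigma> where \<sigma>: "\<delta> > 0" "smooth_on ({-\<delta><..<\<delta>} \<times> {-\<delta><..<\<delta>}) \<sigma>"
    "\<And>c t. c \<in> {-\<delta><..<\<delta>} \<Longrightarrow> t \<in> {-\<delta><..<\<delta>} \<Longrightarrow> (\<sigma> (c, t), t) \<in> ?W"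
    "\<And>c. \<sigma> (c, 0) = c"
    "\<And>c t. c \<in> {-\<delta><..<\<delta>} \<Longrightarrow> t \<in> {-\<delta><..<\<delta>} \<Longrightarrow>
      ((\<lambda>t. \<sigma> (c, t)) has_real_derivative \<rho> (fst (\<sigma> (c, t), t))) (at t)"
    "\<And>c t. c \<in> {-\<delta><..<\<delta>} \<Longrightarrow> t \<in> {-\<delta><..<\<delta>} \<Longrightarrow> pd_u \<sigma> (c, t) > 0"
    by (rule smooth_flow[OF W sm]) blast
  show thesis
  proof (rule that[OF \<sigma>(1), of "\<lambda>t. \<sigma> (0, t)"])
    show "smooth_on {-\<delta><..<\<delta>} (\<lambda>t. \<sigma> (0, t))"
      using \<sigma>(1) by (intro smooth_on_compose[OF open_greaterThanLessThan _ _ _ \<sigma>(2)]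
          smooth_on_Pair smooth_on_const smooth_on_id) (auto simp: open_Times)
    show "\<sigma> (0, 0) = 0" by (rule \<sigma>(4))
    fix t assume t: "t \<in> {-\<delta><..<\<delta>}"
    show "\<sigma> (0, t) \<in> {-r<..<r}" using \<sigma>(1) \<sigma>(3)[of 0 t] t by auto
    show "((\<lambda>t. \<sigma> (0, t)) has_real_derivative \<rho> (\<sigma> (0, t))) (at t)"
      using \<sigma>(1) \<sigma>(5)[of 0 t] t by auto
  qed
qed

text \<open>The condition \<open>\<phi> \<equiv> 1\<close> on the new parameter is the equation \<open>U' = 1 / \<phi>(U)\<close> for the old one; here
  \<open>g = u_integrand z (\<cdot>, 0)\<close> and \<open>e = \<surd>E (\<cdot>, 0)\<close>, or the corresponding functions of \<open>v\<close>.\<close>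

lemma reparametrization_ode:
  fixes g e :: "real \<Rightarrow> real"
  assumes r: "r > 0" and g: "smooth_on {-r<..<r} g" and e: "smooth_on {-r<..<r} e"
    and e0: "\<And>x. x \<in> {-r<..<r} \<Longrightarrow> e x > 0"
  obtains \<delta> H U U' where "\<delta> > 0" "smooth_on {-\<delta><..<\<delta>} U" "U 0 = 0"
    "H 0 = 0" "\<forall>x\<in>{-r<..<r}. (H has_real_derivative g x) (at x)"
    "\<forall>t\<in>{-\<delta><..<\<delta>}. U t \<in> {-r<..<r} \<and> (U has_real_derivative U' t) (at t) \<and> U' t > 0 \<and>
      U' t * e (U t) = exp (H (U t) + k)"
proof -
  obtain H where H: "smooth_on {-r<..<r} H" "H 0 = 0" "\<And>x. x \<in> {-r<..<r} \<Longrightarrow> (H has_real_derivative g x) (at x)"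
    using smooth_antiderivative[OF g] by blast
  have "smooth_on {-r<..<r} (\<lambda>x. exp (H x + k) / e x)"
    using e0 by (intro smooth_on_divide smooth_on_exp smooth_on_add smooth_on_const H e) force+
  from smooth_autonomous_ode[OF r this] obtain \<delta> U where U: "\<delta> > 0" "smooth_on {-\<delta><..<\<delta>} U" "U 0 = 0"
    "\<And>t. t \<in> {-\<delta><..<\<delta>} \<Longrightarrow> U t \<in> {-r<..<r}"
    "\<And>t. t \<in> {-\<delta><..<\<delta>} \<Longrightarrow> (U has_real_derivative exp (H (U t) + k) / e (U t)) (at t)"
    by blast
  let ?U' = "\<lambda>t. exp (H (U t) + k) / e (U t)"
  have "U t \<in> {-r<..<r} \<and> (U has_real_derivative ?U' t) (at t) \<and> ?U' t > 0 \<and>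
      ?U' t * e (U t) = exp (H (U t) + k)" if "t \<in> {-\<delta><..<\<delta>}" for t
    using U(4,5)[OF that] e0[OF U(4)[OF that]] by simp
  then show thesis using H(3) by (intro that[where \<delta> = \<delta> and H = H and U = U and U' = ?U'] U(1-3) H(2)) blast+
qed

lemma LBINT_eq_antiderivative:
  fixes f :: "real \<Rightarrow> real"
  assumes "continuous_on {-r<..<r} f" "\<And>t. t \<in> {-r<..<r} \<Longrightarrow> (F has_real_derivative f t) (at t)"
    and "x \<in> {-r<..<r}"
  shows "(LBINT t=ereal 0..ereal x. f t) = F x - F 0"
proof (rule interval_integral_FTC_finite)
  have s: "{min 0 x..max 0 x} \<subseteq> {-r<..<r}" using assms(3) by auto
  show "continuous_on {min 0 x..max 0 x} f" by (rule continuous_on_subset[OF assms(1) s])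
  show "(F has_vector_derivative f t) (at t within {min 0 x..max 0 x})" if "min 0 x \<le> t" "t \<le> max 0 x" for t
  proof -
    have "t \<in> {-r<..<r}" using s that by auto
    from assms(2)[OF this] show ?thesis
      by (simp add: has_real_derivative_iff_has_vector_derivative has_vector_derivative_at_within)
  qed
qed

text \<open>The integral of \<open>v_integrand\<close> at fixed \<open>u\<close> cancels
  \<open>sqrt E (u, v)\<close> against its value on the axis \<open>v = 0\<close>, so
  \<open>\<phi> = 1\<close> need only hold there, where it is the differential equation for
  \<open>U\<close>. In the same way \<open>\<psi> = 1\<close> reduces to the axis
  \<open>u = 0\<close>, and the two equations are independent of each other.\<close>

lemma canonical_parameters_exist:
  assumes S: "time_like_surface S"
    and K: "\<forall>U z. local_parametrization S U z \<longrightarrow> (\<forall>q\<in>U. Gauss_curvature z q > 0)"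
    and z: "asymptotic_parameters S D z" and D0: "0 \<in> D"
  obtains \<delta> z' where "canonical_asymptotic_parameters S ({-\<delta><..<\<delta>} \<times> {-\<delta><..<\<delta>}) z' 0 0" "z' (0, 0) = z 0"
proof -
  note asym = asymptotic_parametersD[OF S K z]
  note smi = smooth_on_integrands[OF S K z]
  obtain A B where AB: "open A" "open B" "0 \<in> A" "0 \<in> B" "A \<times> B \<subseteq> D"
    using open_prod_elim[OF asym(1) D0] by (metis mem_Sigma_iff zero_prod_def)
  obtain r1 r2 where r12: "r1 > 0" "ball 0 r1 \<subseteq> A" "r2 > 0" "ball 0 r2 \<subseteq> B"
    using AB open_contains_ball by metis
  define r where "r = min r1 r2"
  have r: "r > 0" using r12 by (simp add: r_def)
  let ?I = "{-r<..<r}"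
  have ID: "(x, y) \<in> D" if "x \<in> ?I" "y \<in> ?I" for x y
  proof -
    have "x \<in> ball 0 r1" "y \<in> ball 0 r2" using that by (auto simp: r_def dist_real_def)
    then show ?thesis using r12 AB by blast
  qed
  have 0: "0 \<in> ?I" using r by simp
  have slice: "smooth_on ?I (\<lambda>t. h (t, 0))" "smooth_on ?I (\<lambda>t. h (0, t))" if "smooth_on D h" for h :: "real \<times> real \<Rightarrow> real"
    using ID 0 by (intro smooth_on_compose[OF open_greaterThanLessThan asym(1) _ _ that]
        smooth_on_Pair smooth_on_const smooth_on_id open_greaterThanLessThan; simp)+
  have smE: "smooth_on D (\<lambda>q. sqrt (coef_E z q))" "smooth_on D (\<lambda>q. sqrt (- coef_G z q))"
    by (intro smooth_on_sqrt smooth_on_minus asym(1) smooth_on_forms[OF asym(1,2)]; use asym(7,8) in simp)+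
  have E0: "sqrt (coef_E z (t, 0)) > 0" "sqrt (- coef_G z (0, t)) > 0" if "t \<in> ?I" for t
    using asym(7,8) ID[OF that 0] ID[OF 0 that] by auto
  \<comment> \<open>On the axis \<open>v = 0\<close> the new \<open>sqrt E\<close> is
    \<open>U'\<close> times the old one, and the integral of the new \<open>u_integrand\<close> is
    \<open>H1\<close> at \<open>U\<close>. With \<open>k\<close> the constant \<open>f(0, 0)\<close>
    from the definition of \<open>\<phi>\<close>, the last clause therefore says
    \<open>\<phi> = 1\<close> there.\<close>
  obtain \<delta>1 H1 U U' where U: "\<delta>1 > 0" "smooth_on {-\<delta>1<..<\<delta>1} U" "U 0 = 0"
    "H1 0 = 0" "\<forall>x\<in>{-r<..<r}. (H1 has_real_derivative u_integrand z (x, 0)) (at x)"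
    "\<forall>t\<in>{-\<delta>1<..<\<delta>1}. U t \<in> {-r<..<r} \<and> (U has_real_derivative U' t) (at t) \<and> U' t > 0 \<and>
      U' t * sqrt (coef_E z (U t, 0)) = exp (H1 (U t) + asym_f z (0, 0))"
    by (rule reparametrization_ode[OF r slice(1)[OF smi(1)] slice(1)[OF smE(1)] E0(1), where k = "asym_f z (0, 0)"])
  obtain \<delta>2 H2 V V' where V: "\<delta>2 > 0" "smooth_on {-\<delta>2<..<\<delta>2} V" "V 0 = 0"
    "H2 0 = 0" "\<forall>x\<in>{-r<..<r}. (H2 has_real_derivative v_integrand z (0, x)) (at x)"
    "\<forall>t\<in>{-\<delta>2<..<\<delta>2}. V t \<in> {-r<..<r} \<and> (V has_real_derivative V' t) (at t) \<and> V' t > 0 \<and>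
      V' t * sqrt (- coef_G z (0, V t)) = exp (H2 (V t) + asym_f z (0, 0))"
    by (rule reparametrization_ode[OF r slice(2)[OF smi(2)] slice(2)[OF smE(2)] E0(2), where k = "asym_f z (0, 0)"])
  define \<delta> where "\<delta> = min \<delta>1 \<delta>2"
  let ?J = "{-\<delta><..<\<delta>}" and ?D = "{-\<delta><..<\<delta>} \<times> {-\<delta><..<\<delta>}"
  have \<delta>: "\<delta> > 0" "\<And>t. t \<in> ?J \<Longrightarrow> t \<in> {-\<delta>1<..<\<delta>1}" "\<And>t. t \<in> ?J \<Longrightarrow> t \<in> {-\<delta>2<..<\<delta>2}"
    using U(1) V(1) by (auto simp: \<delta>_def)
  have 0: "0 \<in> ?J" using \<delta>(1) by simp
  have oD: "open ?D" by (simp add: open_Times)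
  have Ud: "U t \<in> {-r<..<r}" "(U has_real_derivative U' t) (at t)" "U' t > 0"
    "U' t * sqrt (coef_E z (U t, 0)) = exp (H1 (U t) + asym_f z (0, 0))" if "t \<in> ?J" for t
    using U(6) \<delta>(2)[OF that] by blast+
  have Vd: "V t \<in> {-r<..<r}" "(V has_real_derivative V' t) (at t)" "V' t > 0"
    "V' t * sqrt (- coef_G z (0, V t)) = exp (H2 (V t) + asym_f z (0, 0))" if "t \<in> ?J" for t
    using V(6) \<delta>(3)[OF that] by blast+
  define \<Phi> where "\<Phi> p = (U (fst p), V (snd p))" for p
  have sm\<Phi>: "smooth_on ?D \<Phi>"
    unfolding \<Phi>_def[abs_def] using \<delta>
    by (intro smooth_on_Pair oD smooth_on_compose[OF oD open_greaterThanLessThan _ smooth_on_fst[OF oD smooth_on_id] U(2)]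
        smooth_on_compose[OF oD open_greaterThanLessThan _ smooth_on_snd[OF oD smooth_on_id] V(2)]) auto
  have \<Phi>D: "\<Phi> p \<in> D" if "p \<in> ?D" for p
    unfolding \<Phi>_def using that by (intro ID Ud Vd) auto
  have pd\<Phi>: "pd_u \<Phi> (x, y) = (U' x, 0)" "pd_v \<Phi> (x, y) = (0, V' y)" if "x \<in> ?J" "y \<in> ?J" for x y
  proof -
    have "((\<lambda>t. (U t, V y)) has_vector_derivative (U' x, 0)) (at x)"
      "((\<lambda>s. (U x, V s)) has_vector_derivative (0, V' y)) (at y)"
      using Ud(2)[OF that(1)] Vd(2)[OF that(2)]
      by (auto intro!: has_vector_derivative_Pair simp: has_real_derivative_iff_has_vector_derivative)
    then show "pd_u \<Phi> (x, y) = (U' x, 0)" "pd_v \<Phi> (x, y) = (0, V' y)"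
      by (simp_all add: pd_u_def pd_v_def \<Phi>_def vector_derivative_at)
  qed
  have strict: "f s < f t" if "s < t" "s \<in> ?J" "t \<in> ?J" "\<And>x. x \<in> ?J \<Longrightarrow> (f has_real_derivative f' x) (at x)"
    "\<And>x. x \<in> ?J \<Longrightarrow> f' x > 0" for f f' :: "real \<Rightarrow> real" and s t
  proof (rule DERIV_pos_imp_increasing[OF that(1)])
    fix x assume "s \<le> x" "x \<le> t"
    then have "x \<in> ?J" using that(2,3) by auto
    then show "\<exists>y. (f has_real_derivative y) (at x) \<and> 0 < y" using that(4,5) by blast
  qed
  have inj': "s = t" if "f s = f t" "s \<in> ?J" "t \<in> ?J" "\<And>x. x \<in> ?J \<Longrightarrow> (f has_real_derivative f' x) (at x)"
    "\<And>x. x \<in> ?J \<Longrightarrow> f' x > 0" for f f' :: "real \<Rightarrow> real" and s t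
  proof (rule ccontr)
    assume "s \<noteq> t"
    then consider "s < t" | "t < s" by linarith
    then show False
    proof cases
      case 1
      from strict[OF 1 that(2,3) that(4,5)] that(1) show False by simp
    next
      case 2
      from strict[OF 2 that(3,2) that(4,5)] that(1) show False by simp
    qed
  qed
  have injU: "s = t" if "U s = U t" "s \<in> ?J" "t \<in> ?J" for s t
    by (rule inj'[OF that Ud(2,3)])
  have injV: "s = t" if "V s = V t" "s \<in> ?J" "t \<in> ?J" for s t
    by (rule inj'[OF that Vd(2,3)])
  have inj: "inj_on \<Phi> ?D"
  proof (rule inj_onI)
    fix p q assume p: "p \<in> ?D" "q \<in> ?D" and "\<Phi> p = \<Phi> q"
    then have "U (fst p) = U (fst q)" "V (snd p) = V (snd q)" unfolding \<Phi>_def prod.inject by blast+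
    moreover have "fst p \<in> ?J" "fst q \<in> ?J" "snd p \<in> ?J" "snd q \<in> ?J" using p by (auto simp only: mem_Times_iff)
    ultimately show "p = q" using injU injV by (metis prod_eqI)
  qed
  define z' where "z' q = z (\<Phi> q)" for q
  have lp: "local_parametrization S ?D z'"
    unfolding z'_def[abs_def]
  proof (rule local_parametrization_compose[OF _ oD sm\<Phi> _ inj])
    show "local_parametrization S D z" using z by (simp add: asymptotic_parameters_def)
    show "\<Phi> ` ?D \<subseteq> D" using \<Phi>D by blast
    show "jac \<Phi> q \<noteq> 0" if "q \<in> ?D" for q
      using that pd\<Phi>[of "fst q" "snd q"] Ud(3)[of "fst q"] Vd(3)[of "snd q"] by (auto simp: jac_def)
  qed
  have forms: "coef_E z' (x, y) = (U' x)\<^sup>2 * coef_E z (U x, V y)" "coef_F z' (x, y) = U' x * V' y * coef_F z (U x, V y)"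
    "coef_G z' (x, y) = (V' y)\<^sup>2 * coef_G z (U x, V y)" "coef_W z' (x, y) = (U' x * V' y)\<^sup>2 * coef_W z (U x, V y)"
    "sL z' (x, y) = U' x * V' y * ((U' x)\<^sup>2 * sL z (U x, V y))"
    "sM z' (x, y) = (U' x * V' y)\<^sup>2 * sM z (U x, V y)"
    "sN z' (x, y) = U' x * V' y * ((V' y)\<^sup>2 * sN z (U x, V y))" if "x \<in> ?J" "y \<in> ?J" for x y
  proof -
    have "(x, y) \<in> ?D" using that by simp
    from forms_compose[OF asym(1,2) oD sm\<Phi> \<Phi>D this pd\<Phi>[OF that], folded z'_def[abs_def]]
    show "coef_E z' (x, y) = (U' x)\<^sup>2 * coef_E z (U x, V y)" "coef_F z' (x, y) = U' x * V' y * coef_F z (U x, V y)"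
      "coef_G z' (x, y) = (V' y)\<^sup>2 * coef_G z (U x, V y)" "coef_W z' (x, y) = (U' x * V' y)\<^sup>2 * coef_W z (U x, V y)"
      "sL z' (x, y) = U' x * V' y * ((U' x)\<^sup>2 * sL z (U x, V y))"
      "sM z' (x, y) = (U' x * V' y)\<^sup>2 * sM z (U x, V y)"
      "sN z' (x, y) = U' x * V' y * ((V' y)\<^sup>2 * sN z (U x, V y))"
      by (simp_all add: \<Phi>_def power2_eq_square)
  qed
  have UVD: "(U x, V y) \<in> D" if "x \<in> ?J" "y \<in> ?J" for x y
    by (intro ID Ud Vd that)
  have z': "asymptotic_parameters S ?D z'"
    unfolding asymptotic_parameters_def
  proof (intro conjI ballI)
    show "local_parametrization S ?D z'" by (rule lp)
    fix q assume q: "q \<in> ?D"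
    obtain x y where xy: "q = (x, y)" "x \<in> ?J" "y \<in> ?J" using q by blast
    note f = forms[OF xy(2,3)] and a = asym(3-8)[OF UVD[OF xy(2,3)]]
    show "coef_L z' q = 0" "coef_N z' q = 0"
      using second_form_eq(1,3)[OF coef_W_pos[OF S lp q]] f(5,7) a(2,3) by (simp_all add: xy(1))
    show "coef_E z' q > 0" "coef_G z' q < 0"
      using Ud(3)[OF xy(2)] Vd(3)[OF xy(3)] a(5,6) by (simp_all add: xy(1) f mult_pos_neg)
  qed
  note asym' = asymptotic_parametersD[OF S K z']
  have f': "asym_f z' q = asym_f z (\<Phi> q)" if q: "q \<in> ?D" for q
  proof -
    obtain x y where xy: "q = (x, y)" "x \<in> ?J" "y \<in> ?J" using q by blast
    note f = forms[OF xy(2,3)] and a = asym(3-8)[OF UVD[OF xy(2,3)]]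
    \<comment> \<open>Both \<open>coef_W\<close> and \<open>sM\<close> acquire the same factor, the
      squared Jacobian, so the difference of their logarithms is invariant.\<close>
    define k where "k = (U' x * V' y)\<^sup>2"
    have k: "k > 0" using Ud(3)[OF xy(2)] Vd(3)[OF xy(3)] by (simp add: k_def)
    have "asym_f z' q = (ln (coef_W z' q) - ln \<bar>sM z' q\<bar>) / 2"
      by (rule asym_f_eq[OF asym'(3,6,7,8)[OF q]])
    also have "\<dots> = (ln (k * coef_W z (U x, V y)) - ln (k * \<bar>sM z (U x, V y)\<bar>)) / 2"
      unfolding xy(1) f(4,6) k_def[symmetric] using k by (simp add: abs_mult)
    also have "\<dots> = (ln (coef_W z (U x, V y)) - ln \<bar>sM z (U x, V y)\<bar>) / 2"
      using k a(1,4) by (simp add: ln_mult)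
    also have "\<dots> = asym_f z (U x, V y)" by (rule asym_f_eq[OF a(1,4,5,6), symmetric])
    finally show ?thesis by (simp add: xy(1) \<Phi>_def)
  qed
  have roots: "sqrt (coef_E z' (x, y)) = U' x * sqrt (coef_E z (U x, V y))"
    "sqrt (- coef_G z' (x, y)) = V' y * sqrt (- coef_G z (U x, V y))" if xy: "x \<in> ?J" "y \<in> ?J" for x y
  proof -
    have "sqrt (coef_E z' (x, y)) = sqrt ((U' x)\<^sup>2) * sqrt (coef_E z (U x, V y))"
      unfolding forms(1)[OF xy] by (rule real_sqrt_mult)
    moreover have "sqrt (- coef_G z' (x, y)) = sqrt ((V' y)\<^sup>2) * sqrt (- coef_G z (U x, V y))"
      unfolding forms(3)[OF xy] mult_minus_right[symmetric] by (rule real_sqrt_mult)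
    ultimately show "sqrt (coef_E z' (x, y)) = U' x * sqrt (coef_E z (U x, V y))"
      "sqrt (- coef_G z' (x, y)) = V' y * sqrt (- coef_G z (U x, V y))"
      using Ud(3)[OF xy(1)] Vd(3)[OF xy(2)] by simp_all
  qed
  \<comment> \<open>The integrands change like coefficients of one-forms: \<open>f\<close> and
    \<open>a\<close> are invariant, and the quotient of roots trades the chain rule factor of one
    partial derivative for that of the other.\<close>
  have int': "u_integrand z' (x, y) = U' x * u_integrand z (U x, V y)"
    "v_integrand z' (x, y) = V' y * v_integrand z (U x, V y)" if xy: "x \<in> ?J" "y \<in> ?J" for x y
  proof -
    have q: "(x, y) \<in> ?D" using xy by simp
    have \<Phi>q: "\<Phi> (x, y) = (U x, V y)" by (simp add: \<Phi>_def)
    have "pd_u (asym_f z') (x, y) = pd_u (\<lambda>q. asym_f z (\<Phi> q)) (x, y)"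
      "pd_v (asym_f z') (x, y) = pd_v (\<lambda>q. asym_f z (\<Phi> q)) (x, y)"
      by (rule pd_cong[OF oD q f' smooth_on_differentiable[OF smooth_on_asym_f[OF S K z'] q]], assumption)+
    then have pf: "pd_u (asym_f z') (x, y) = U' x * pd_u (asym_f z) (U x, V y)"
      "pd_v (asym_f z') (x, y) = V' y * pd_v (asym_f z) (U x, V y)"
      using pd_compose[OF smooth_on_differentiable[OF sm\<Phi> q]
          smooth_on_differentiable[OF smooth_on_asym_f[OF S K z] \<Phi>D[OF q]]] pd\<Phi>[OF xy] \<Phi>q by simp_all
    define e g where "e = sqrt (coef_E z (U x, V y))" and "g = sqrt (- coef_G z (U x, V y))"
    have pos: "U' x > 0" "V' y > 0" "e > 0" "g > 0"
      using Ud(3)[OF xy(1)] Vd(3)[OF xy(2)] asym(7,8)[OF UVD[OF xy]] by (simp_all add: e_def g_def)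
    have e': "sqrt (coef_E z' (x, y)) = U' x * e" "sqrt (- coef_G z' (x, y)) = V' y * g"
      unfolding e_def g_def by (rule roots[OF xy])+
    have a': "asym_a z' (x, y) = asym_a z (U x, V y)"
      unfolding asym_a_def e' forms(2)[OF xy] e_def[symmetric] g_def[symmetric] using pos by (simp add: field_simps)
    show "u_integrand z' (x, y) = U' x * u_integrand z (U x, V y)"
      "v_integrand z' (x, y) = V' y * v_integrand z (U x, V y)"
      unfolding u_integrand_def v_integrand_def a' pf e' e_def[symmetric] g_def[symmetric]
      using pos by (simp_all add: field_simps)
  qed
  have contU: "continuous_on ?J (\<lambda>t. u_integrand z' (t, y))" if "y \<in> ?J" for y
    by (rule continuous_on_compose2[OF smooth_on_continuous[OF smooth_on_integrands(1)[OF S K z']]])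
      (use that in \<open>auto intro!: continuous_intros\<close>)
  have contV: "continuous_on ?J (\<lambda>s. v_integrand z' (x, s))" if "x \<in> ?J" for x
    by (rule continuous_on_compose2[OF smooth_on_continuous[OF smooth_on_integrands(2)[OF S K z']]])
      (use that in \<open>auto intro!: continuous_intros\<close>)
  have intu: "(LBINT t=ereal 0..ereal x. u_integrand z' (t, y)) =
      ln (sqrt (- coef_G z' (x, y))) - ln (sqrt (- coef_G z' (0, y)))"
    if "x \<in> ?J" "y \<in> ?J" for x y
    by (rule LBINT_eq_antiderivative[OF contU[OF that(2)] codazzi_log_derivatives(2)[OF S K z'] that(1)])
      (use that in auto)
  have intv: "(LBINT s=ereal 0..ereal y. v_integrand z' (x, s)) =
      ln (sqrt (coef_E z' (x, y))) - ln (sqrt (coef_E z' (x, 0)))"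
    if "x \<in> ?J" "y \<in> ?J" for x y
    by (rule LBINT_eq_antiderivative[OF contV[OF that(1)] codazzi_log_derivatives(1)[OF S K z'] that(2)])
      (use that in auto)
  \<comment> \<open>On the axis the same integral is evaluated a second time, through
    \<open>H1\<close>, since \<open>U\<close> was chosen in terms of \<open>H1\<close>.\<close>
  have intH1: "(LBINT t=ereal 0..ereal x. u_integrand z' (t, 0)) = H1 (U x)" if "x \<in> ?J" for x
  proof -
    have "((\<lambda>t. H1 (U t)) has_real_derivative u_integrand z' (t, 0)) (at t)" if "t \<in> ?J" for t
      using DERIV_chain2[OF bspec[OF U(5) Ud(1)[OF that]] Ud(2)[OF that]] int'(1)[OF that 0] V(3)
      by (simp add: mult.commute)
    from LBINT_eq_antiderivative[OF contU[OF 0] this that] show ?thesis by (simp only: U(3,4) diff_0_right)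
  qed
  have intH2: "(LBINT s=ereal 0..ereal y. v_integrand z' (0, s)) = H2 (V y)" if "y \<in> ?J" for y
  proof -
    have "((\<lambda>s. H2 (V s)) has_real_derivative v_integrand z' (0, s)) (at s)" if "s \<in> ?J" for s
      using DERIV_chain2[OF bspec[OF V(5) Vd(1)[OF that]] Vd(2)[OF that]] int'(2)[OF 0 that] U(3)
      by (simp add: mult.commute)
    from LBINT_eq_antiderivative[OF contV[OF 0] this that] show ?thesis by (simp only: V(3,4) diff_0_right)
  qed
  have f0: "asym_f z' (0, 0) = asym_f z (0, 0)" using f'[of "(0, 0)"] 0 U(3) V(3) by (simp add: \<Phi>_def)
  have edge: "sqrt (coef_E z' (x, 0)) = exp (H1 (U x) + asym_f z (0, 0))" if "x \<in> ?J" for x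
    using roots(1)[OF that 0] Ud(4)[OF that] by (simp only: V(3))
  have edge': "sqrt (- coef_G z' (0, y)) = exp (H2 (V y) + asym_f z (0, 0))" if "y \<in> ?J" for y
    using roots(2)[OF 0 that] Vd(4)[OF that] by (simp only: U(3))
  have phi: "asym_phi z' 0 0 x y = 1" if xy: "x \<in> ?J" "y \<in> ?J" for x y
  proof -
    have pos: "sqrt (coef_E z' (x, y)) > 0" using asym'(7)[of "(x, y)"] xy by simp
    \<comment> \<open>The logarithm of the axis value \<open>sqrt E (x, 0)\<close> is
      \<open>H1 (U x) + f(0, 0)\<close>, which cancels the remaining terms of the exponent.\<close>
    have "asym_phi z' 0 0 x y = sqrt (coef_E z' (x, y)) * exp (- ln (sqrt (coef_E z' (x, y))))"
      unfolding asym_phi_def intv[OF xy] intH1[OF xy(1)] f0 edge[OF xy(1)] by simp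
    then show ?thesis using pos by (simp add: exp_minus)
  qed
  have psi: "asym_psi z' 0 0 x y = 1" if xy: "x \<in> ?J" "y \<in> ?J" for x y
  proof -
    have pos: "sqrt (- coef_G z' (x, y)) > 0" using asym'(8)[of "(x, y)"] xy by simp
    have "asym_psi z' 0 0 x y = sqrt (- coef_G z' (x, y)) * exp (- ln (sqrt (- coef_G z' (x, y))))"
      unfolding asym_psi_def intu[OF xy] intH2[OF xy(2)] f0 edge'[OF xy(2)] by simp
    then show ?thesis using pos by (simp add: exp_minus del: real_sqrt_minus)
  qed
  show thesis
  proof (rule that)
    show "canonical_asymptotic_parameters S ?D z' 0 0"
      unfolding canonical_asymptotic_parameters_def using z' phi psi 0 by auto
    show "z' (0, 0) = z 0" using U(3) V(3) by (simp add: z'_def \<Phi>_def zero_prod_def)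
  qed
qed

theorem proposition4p2:
  fixes S :: "(real ^ 3) set"
  assumes "time_like_surface S"
    and "\<And>U z q. local_parametrization S U z \<Longrightarrow> q \<in> U \<Longrightarrow> Gauss_curvature z q > 0"
    and "\<And>U z q. local_parametrization S U z \<Longrightarrow> q \<in> U \<Longrightarrow>
           Gauss_curvature z q - (mean_curvature z q)\<^sup>2 > 0"
  shows "\<forall>p\<in>S. \<exists>D z u0 v0. canonical_asymptotic_parameters S D z u0 v0 \<and> z (u0, v0) = p"
proof
  fix p assume "p \<in> S"
  obtain D z where z: "asymptotic_parameters S D z" "0 \<in> D" "z 0 = p"
    by (rule asymptotic_parameters_exist[OF assms \<open>p \<in> S\<close>])
  have "\<forall>U z. local_parametrization S U z \<longrightarrow> (\<forall>q\<in>U. Gauss_curvature z q > 0)"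
    using assms(2) by blast
  from canonical_parameters_exist[OF assms(1) this z(1,2)] z(3)
  show "\<exists>D z u0 v0. canonical_asymptotic_parameters S D z u0 v0 \<and> z (u0, v0) = p" by metis
qed

end
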